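(* Let $p\ge 2$ be a prime and let $\mathbb F$ be a field of characteristic $p$. Then $$H^2_*(\mathfrak m_0^0(p))=H^2(\mathfrak m_0^0(p))\oplus\operatorname{Hom}_{\rm Fr}(\mathfrak m_0^0(p),\mathbb F)$$ (as $\mathbb F$-vector spaces), and there is a $p$-dimensional subspace of $H^2_*(\mathfrak m_0^0(p))$ spanned by the cohomology classes of the cocycles $(0,\overline e^k)$, $1\le k\le p$, such that if $E_k$ denotes the corresponding one-dimensional restricted central extension of $\mathfrak m_0^0(p)$, then $E_k=\mathfrak m_0^0(p)\oplus\mathbb F c$ as an $\mathbb F$-vector space, and for all $1\le i,j\le p$ the bracket and $[p]$-operator of $E_k$ are given by $$[e_i,e_j]=[e_i,e_j]_{\mathfrak g},\qquad [e_i,c]=0,\qquad e_i^{[p]}=e_i^{[p]_{\mathfrak g}}+\delta_{k,i}\,c,\qquad c^{[p]}=0,$$ where $[\cdot,\cdot]_{\mathfrak g}$ and $\cdot^{[p]_{\mathfrak g}}$ denote the bracket and $[p]$-operator of $\mathfrak g=\mathfrak m_0^0(p)$ and $\delta$ is the Kronecker delta.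
   Context: Let $\mathbb F$ be a field of characteristic $p>0$. $\mathfrak g=\mathfrak m_0^0(p)$ is the restricted Lie algebra over $\mathbb F$ with basis $e_1,\dots,e_p$, brackets $[e_1,e_i]=-[e_i,e_1]=e_{i+1}$ for $1<i<p$ (all other brackets of basis elements being $0$), and $[p]$-operator $g^{[p]}=0$ for all $g$. $\operatorname{Hom}_{\rm Fr}(\mathfrak g,\mathbb F)$ is the space of maps $f:\mathfrak g\to\mathbb F$ with $f(\alpha x+\beta y)=\alpha^pf(x)+\beta^pf(y)$; $\overline e^k\in\operatorname{Hom}_{\rm Fr}(\mathfrak g,\mathbb F)$ is $\overline e^k\left(\sum_i\alpha_ie_i\right)=\alpha_k^p$. Ordinary cohomology (trivial coefficients $\mathbb F$): $C^n(\mathfrak g)=(\wedge^n\mathfrak g)^*$, $d^1(\psi)(g,h)=\psi([g,h])$, $d^2(\phi)(g,h,f)=\phi([g,h]\wedge f)-\phi([g,f]\wedge h)+\phi([h,f]\wedge g)$, $H^2(\mathfrak g)=\ker d^2/\operatorname{im}d^1$. Restricted cohomology: $C^1_*(\mathfrak g)=\mathfrak g^*$. For $\phi\in C^2(\mathfrak g)$, a map $\omega:\mathfrak g\to\mathbb F$ has the $*$-property with respect to $\phi$ if $\omega(\alpha g)=\alpha^p\omega(g)$ for $\alpha\in\mathbb F$, and for all $g,h\in\mathfrak g$ $$\omega(g+h)=\omega(g)+\omega(h)+\sum\frac{1}{\#(g)}\,\phi([g_1,g_2,\dots,g_{p-1}]\wedge g_p),$$ the sum being over all formal sequences $(g_1,\dots,g_p)$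 with each $g_i$ equal to $g$ or $h$, $g_1=g$, $g_2=h$; $\#(g)$ is the number of positions filled with $g$, and $[g_1,\dots,g_j]=[[\cdots[[g_1,g_2],g_3],\dots],g_j]$ (with $[g_1]=g_1$). $C^2_*(\mathfrak g)$ is the vector space of pairs $(\phi,\omega)$ with $\phi\in C^2(\mathfrak g)$ and $\omega$ having the $*$-property with respect to $\phi$. The differentials are $d^1_*(\psi)=(d^1\psi,\operatorname{ind}^1(\psi))$ with $\operatorname{ind}^1(\psi)(g)=\psi(g^{[p]})$, and $d^2_*(\phi,\omega)=(d^2\phi,\operatorname{ind}^2(\phi,\omega))$ with $\operatorname{ind}^2(\phi,\omega)(g,h)=\phi(g\wedge h^{[p]})$; $\ker d^2_*$ consists of the pairs with $d^2\phi=0$ and $\operatorname{ind}^2(\phi,\omega)=0$, and $H^2_*(\mathfrak g)=\ker d^2_*/\operatorname{im}d^1_*$. The direct sum decomposition is the one coming from the short exact sequence $0\to\operatorname{Hom}_{\rm Fr}(\mathfrak g,\mathbb F)\to H^2_*(\mathfrak g)\to H^2(\mathfrak g)\to0$ of $\mathbb F$-vector spaces with maps $\omega\mapsto[(0,\omega)]$ and $[(\phi,\omega)]\mapsto[\phi]$. Correspondence with extensions: a one-dimensional restricted central extension of $\mathfrak g$ is a restricted Lie algebra $E$ with a surjective restricted homomorphism $E\to\mathfrak g$ whose kernel is a one-dimensional central subspace $\mathbb F c$ with $c^{[p]}=0$. It corresponds to the class of $(\phi,\omega)$ in $H^2_*(\mathfrak g)$ if, for some linear identification $E=\mathfrak g\oplus\mathbb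 F c$ compatible with the projection to $\mathfrak g$, one has $[x,y]=[x,y]_{\mathfrak g}+\phi(x\wedge y)c$ and $x^{[p]}=x^{[p]_{\mathfrak g}}+\omega(x)c$ for $x,y\in\mathfrak g$. *)

theory Defs
  imports
    "Jordan_Normal_Form.VS_Connect"
    "HOL-Algebra.AbelCoset"
    "HOL-Computational_Algebra.Primes"
begin

text \<open>
  The ground field is a type of class \<open>field\<close>, turned into a record by \<open>class_ring\<close>.
  A space of \<open>F\<close>-valued functions on a set \<open>S\<close> is the library's \<open>func_space S\<close>, possibly
  with a smaller carrier; its elements are extensional on \<open>S\<close>, so that they are
  determined by their values on \<open>S\<close>.
\<close>

abbreviation funs :: "'x set \<Rightarrow> ('a::field, 'x \<Rightarrow> 'a) module" where
  "funs S \<equiv> ring.func_space class_ring S"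

definition scalar_space :: "('a::field, 'a) module" where
  "scalar_space = \<lparr>carrier = UNIV, mult = (*), one = 1, zero = 0, add = (+), smult = (*)\<rparr>"

definition quot_space :: "('a, 'v, 'm) module_scheme \<Rightarrow> 'v set \<Rightarrow> ('a, 'v set) module" where
  "quot_space V B = \<lparr>carrier = a_rcosets\<^bsub>V\<^esub> B, mult = undefined, one = undefined, zero = B,
     add = (\<lambda>X Y. X <+>\<^bsub>V\<^esub> Y), smult = (\<lambda>a X. B <+>\<^bsub>V\<^esub> (\<lambda>x. a \<odot>\<^bsub>V\<^esub> x) ` X)\<rparr>"


section \<open>Restricted Lie algebras\<close>

record ('a, 'v) restricted_lie = "('a, 'v) module" +
  lie_br :: "'v \<Rightarrow> 'v \<Rightarrow> 'v"
  pmap :: "'v \<Rightarrow> 'v"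

definition left_normed :: "('a, 'v, 'm) restricted_lie_scheme \<Rightarrow> 'v list \<Rightarrow> 'v" where
  "left_normed L gs = foldl (lie_br L) (hd gs) (tl gs)"

text \<open>
  A formal sequence \<open>(g\<^sub>1, \<dots>, g\<^sub>p)\<close> in two symbols \<open>g\<close>, \<open>h\<close> with \<open>g\<^sub>1 = g\<close>, \<open>g\<^sub>2 = h\<close> is a list of
  booleans, \<open>True\<close> standing for \<open>g\<close>; the number of positions filled with \<open>g\<close>
  is \<open>count_list s True\<close>.
\<close>

definition formal_seqs :: "nat \<Rightarrow> bool list set" where
  "formal_seqs p = {s. length s = p \<and> s ! 0 \<and> \<not> s ! 1}"

definition fill :: "'v \<Rightarrow> 'v \<Rightarrow> bool list \<Rightarrow> 'v list" where
  "fill g h s = map (\<lambda>b. if b then g else h) s"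

text \<open>
  In \<open>pmap_add\<close> the sum over formal sequences is Jacobson's \<open>\<Sum>i=1..p-1. s\<^sub>i(g,h)\<close>, where
  \<open>i s\<^sub>i(g,h)\<close> is the coefficient of \<open>t^(i-1)\<close> in \<open>(ad (t g + h))^(p-1) (g)\<close>.
\<close>

locale restricted_lie_algebra = vectorspace class_ring L
  for p :: nat and L :: "('a::field, 'v, 'm) restricted_lie_scheme" (structure) +
  assumes prime_p: "prime p"
    and char_p: "CHAR('a) = p"
    and br_closed: "\<lbrakk>x \<in> carrier L; y \<in> carrier L\<rbrakk> \<Longrightarrow> lie_br L x y \<in> carrier L"
    and br_linear_left: "y \<in> carrier L \<Longrightarrow> (\<lambda>x. lie_br L x y) \<in> LinearCombinations.module_hom class_ring L L"
    and br_linear_right: "x \<in> carrier L \<Longrightarrow> lie_br L x \<in> LinearCombinations.module_hom class_ring L L"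
    and br_alternating: "x \<in> carrier L \<Longrightarrow> lie_br L x x = \<zero>"
    and jacobi: "\<lbrakk>x \<in> carrier L; y \<in> carrier L; z \<in> carrier L\<rbrakk> \<Longrightarrow>
      lie_br L x (lie_br L y z) \<oplus> lie_br L y (lie_br L z x) \<oplus> lie_br L z (lie_br L x y) = \<zero>"
    and pmap_closed: "x \<in> carrier L \<Longrightarrow> pmap L x \<in> carrier L"
    and pmap_smult: "x \<in> carrier L \<Longrightarrow> pmap L (\<alpha> \<odot> x) = \<alpha> ^ p \<odot> pmap L x"
    and ad_pmap: "\<lbrakk>x \<in> carrier L; y \<in> carrier L\<rbrakk> \<Longrightarrow>
      lie_br L (pmap L x) y = (lie_br L x ^^ p) y"
    and pmap_add: "\<lbrakk>g \<in> carrier L; h \<in> carrier L\<rbrakk> \<Longrightarrow>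
      pmap L (g \<oplus> h) = pmap L g \<oplus> pmap L h \<oplus>
        (\<Oplus>s\<in>formal_seqs p. (1 / of_nat (count_list s True)) \<odot> left_normed L (fill g h s))"

definition restricted_hom ::
  "('a::field, 'v, 'm) restricted_lie_scheme \<Rightarrow> ('a, 'w, 'n) restricted_lie_scheme \<Rightarrow> ('v \<Rightarrow> 'w) set"
where
  "restricted_hom L M = {f \<in> LinearCombinations.module_hom class_ring L M.
     (\<forall>x\<in>carrier L. \<forall>y\<in>carrier L. f (lie_br L x y) = lie_br M (f x) (f y)) \<and>
     (\<forall>x\<in>carrier L. f (pmap L x) = pmap M (f x))}"


section \<open>Ordinary and restricted cohomology with trivial coefficients\<close>

definition C1 :: "('a::field, 'v, 'm) restricted_lie_scheme \<Rightarrow> ('a, 'v \<Rightarrow> 'a) module" where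
  "C1 L = (funs (carrier L))\<lparr>carrier :=
     LinearCombinations.module_hom class_ring L scalar_space \<inter> extensional (carrier L)\<rparr>"

text \<open>
  Linear functionals on the exterior square are alternating bilinear forms;
  \<open>\<phi> (x, y)\<close> is the value on \<open>x \<and> y\<close>.
\<close>

definition C2 :: "('a::field, 'v, 'm) restricted_lie_scheme \<Rightarrow> ('a, 'v \<times> 'v \<Rightarrow> 'a) module" where
  "C2 L = (funs (carrier L \<times> carrier L))\<lparr>carrier :=
     {\<phi> \<in> extensional (carrier L \<times> carrier L).
        (\<forall>y\<in>carrier L. (\<lambda>x. \<phi> (x, y)) \<in> LinearCombinations.module_hom class_ring L scalar_space) \<and>
        (\<forall>x\<in>carrier L. (\<lambda>y. \<phi> (x, y)) \<in> LinearCombinations.module_hom class_ring L scalar_space) \<and>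
        (\<forall>x\<in>carrier L. \<phi> (x, x) = 0)}\<rparr>"

definition d1 :: "('a::field, 'v, 'm) restricted_lie_scheme \<Rightarrow> ('v \<Rightarrow> 'a) \<Rightarrow> 'v \<times> 'v \<Rightarrow> 'a" where
  "d1 L \<psi> = restrict (\<lambda>(g, h). \<psi> (lie_br L g h)) (carrier L \<times> carrier L)"

definition d2 ::
  "('a::field, 'v, 'm) restricted_lie_scheme \<Rightarrow> ('v \<times> 'v \<Rightarrow> 'a) \<Rightarrow> 'v \<times> 'v \<times> 'v \<Rightarrow> 'a" where
  "d2 L \<phi> = restrict
     (\<lambda>(g, h, f). \<phi> (lie_br L g h, f) - \<phi> (lie_br L g f, h) + \<phi> (lie_br L h f, g))
     (carrier L \<times> carrier L \<times> carrier L)"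

definition Z2 :: "('a::field, 'v, 'm) restricted_lie_scheme \<Rightarrow> ('v \<times> 'v \<Rightarrow> 'a) set" where
  "Z2 L = {\<phi> \<in> carrier (C2 L). d2 L \<phi> = \<zero>\<^bsub>funs (carrier L \<times> carrier L \<times> carrier L)\<^esub>}"

definition B2 :: "('a::field, 'v, 'm) restricted_lie_scheme \<Rightarrow> ('v \<times> 'v \<Rightarrow> 'a) set" where
  "B2 L = d1 L ` carrier (C1 L)"

definition H2 :: "('a::field, 'v, 'm) restricted_lie_scheme \<Rightarrow> ('a, ('v \<times> 'v \<Rightarrow> 'a) set) module" where
  "H2 L = quot_space ((C2 L)\<lparr>carrier := Z2 L\<rparr>) (B2 L)"

definition class2 ::
  "('a::field, 'v, 'm) restricted_lie_scheme \<Rightarrow> ('v \<times> 'v \<Rightarrow> 'a) \<Rightarrow> ('v \<times> 'v \<Rightarrow> 'a) set" where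
  "class2 L \<phi> = B2 L +>\<^bsub>C2 L\<^esub> \<phi>"

definition star_property ::
  "nat \<Rightarrow> ('a::field, 'v, 'm) restricted_lie_scheme \<Rightarrow> ('v \<times> 'v \<Rightarrow> 'a) \<Rightarrow> ('v \<Rightarrow> 'a) \<Rightarrow> bool" where
  "star_property p L \<phi> \<omega> \<longleftrightarrow>
     (\<forall>\<alpha>. \<forall>g\<in>carrier L. \<omega> (\<alpha> \<odot>\<^bsub>L\<^esub> g) = \<alpha> ^ p * \<omega> g) \<and>
     (\<forall>g\<in>carrier L. \<forall>h\<in>carrier L. \<omega> (g \<oplus>\<^bsub>L\<^esub> h) = \<omega> g + \<omega> h +
        (\<Sum>s\<in>formal_seqs p. (1 / of_nat (count_list s True)) *
           \<phi> (left_normed L (butlast (fill g h s)), last (fill g h s))))"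

definition C2s ::
  "nat \<Rightarrow> ('a::field, 'v, 'm) restricted_lie_scheme \<Rightarrow> ('a, ('v \<times> 'v \<Rightarrow> 'a) \<times> ('v \<Rightarrow> 'a)) module"
where
  "C2s p L = (direct_sum (C2 L) (funs (carrier L)))\<lparr>carrier :=
     {(\<phi>, \<omega>). \<phi> \<in> carrier (C2 L) \<and> \<omega> \<in> extensional (carrier L) \<and> star_property p L \<phi> \<omega>}\<rparr>"

definition ind1 :: "('a::field, 'v, 'm) restricted_lie_scheme \<Rightarrow> ('v \<Rightarrow> 'a) \<Rightarrow> 'v \<Rightarrow> 'a" where
  "ind1 L \<psi> = restrict (\<lambda>g. \<psi> (pmap L g)) (carrier L)"

definition d1s ::
  "('a::field, 'v, 'm) restricted_lie_scheme \<Rightarrow> ('v \<Rightarrow> 'a) \<Rightarrow> ('v \<times> 'v \<Rightarrow> 'a) \<times> ('v \<Rightarrow> 'a)" where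
  "d1s L \<psi> = (d1 L \<psi>, ind1 L \<psi>)"

definition ind2 ::
  "('a::field, 'v, 'm) restricted_lie_scheme \<Rightarrow> ('v \<times> 'v \<Rightarrow> 'a) \<times> ('v \<Rightarrow> 'a) \<Rightarrow> 'v \<times> 'v \<Rightarrow> 'a"
where
  "ind2 L = (\<lambda>(\<phi>, \<omega>). restrict (\<lambda>(g, h). \<phi> (g, pmap L h)) (carrier L \<times> carrier L))"

definition d2s ::
  "('a::field, 'v, 'm) restricted_lie_scheme \<Rightarrow> ('v \<times> 'v \<Rightarrow> 'a) \<times> ('v \<Rightarrow> 'a) \<Rightarrow>
   ('v \<times> 'v \<times> 'v \<Rightarrow> 'a) \<times> ('v \<times> 'v \<Rightarrow> 'a)" where
  "d2s L = (\<lambda>(\<phi>, \<omega>). (d2 L \<phi>, ind2 L (\<phi>, \<omega>)))"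

definition Z2s ::
  "nat \<Rightarrow> ('a::field, 'v, 'm) restricted_lie_scheme \<Rightarrow> (('v \<times> 'v \<Rightarrow> 'a) \<times> ('v \<Rightarrow> 'a)) set" where
  "Z2s p L = {z \<in> carrier (C2s p L). d2s L z =
     (\<zero>\<^bsub>funs (carrier L \<times> carrier L \<times> carrier L)\<^esub>, \<zero>\<^bsub>funs (carrier L \<times> carrier L)\<^esub>)}"

definition B2s ::
  "('a::field, 'v, 'm) restricted_lie_scheme \<Rightarrow> (('v \<times> 'v \<Rightarrow> 'a) \<times> ('v \<Rightarrow> 'a)) set" where
  "B2s L = d1s L ` carrier (C1 L)"

definition H2s ::
  "nat \<Rightarrow> ('a::field, 'v, 'm) restricted_lie_scheme \<Rightarrow>
   ('a, (('v \<times> 'v \<Rightarrow> 'a) \<times> ('v \<Rightarrow> 'a)) set) module" where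
  "H2s p L = quot_space ((C2s p L)\<lparr>carrier := Z2s p L\<rparr>) (B2s L)"

definition class2s ::
  "nat \<Rightarrow> ('a::field, 'v, 'm) restricted_lie_scheme \<Rightarrow> ('v \<times> 'v \<Rightarrow> 'a) \<times> ('v \<Rightarrow> 'a) \<Rightarrow>
   (('v \<times> 'v \<Rightarrow> 'a) \<times> ('v \<Rightarrow> 'a)) set" where
  "class2s p L z = B2s L +>\<^bsub>C2s p L\<^esub> z"

definition Hom_Fr :: "nat \<Rightarrow> ('a::field, 'v, 'm) restricted_lie_scheme \<Rightarrow> ('a, 'v \<Rightarrow> 'a) module" where
  "Hom_Fr p L = (funs (carrier L))\<lparr>carrier :=
     {f \<in> extensional (carrier L). \<forall>\<alpha> \<beta>. \<forall>x\<in>carrier L. \<forall>y\<in>carrier L.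
        f (\<alpha> \<odot>\<^bsub>L\<^esub> x \<oplus>\<^bsub>L\<^esub> \<beta> \<odot>\<^bsub>L\<^esub> y) = \<alpha> ^ p * f x + \<beta> ^ p * f y}\<rparr>"

definition Fr_incl ::
  "nat \<Rightarrow> ('a::field, 'v, 'm) restricted_lie_scheme \<Rightarrow> ('v \<Rightarrow> 'a) \<Rightarrow>
   (('v \<times> 'v \<Rightarrow> 'a) \<times> ('v \<Rightarrow> 'a)) set" where
  "Fr_incl p L \<omega> = class2s p L (\<zero>\<^bsub>C2 L\<^esub>, \<omega>)"


section \<open>One-dimensional restricted central extensions\<close>

text \<open>The generator \<open>c\<close> of the kernel is part of the data: rescaling it rescales the class.\<close>

definition central_extension ::
  "nat \<Rightarrow> ('a::field, 'v, 'm) restricted_lie_scheme \<Rightarrow> ('a, 'e, 'n) restricted_lie_scheme \<Rightarrow>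
   ('e \<Rightarrow> 'v) \<Rightarrow> 'e \<Rightarrow> bool" where
  "central_extension p L E \<pi> c \<longleftrightarrow>
     restricted_lie_algebra p L \<and> restricted_lie_algebra p E \<and>
     \<pi> \<in> restricted_hom E L \<and> \<pi> ` carrier E = carrier L \<and>
     c \<in> carrier E \<and> c \<noteq> \<zero>\<^bsub>E\<^esub> \<and>
     {x \<in> carrier E. \<pi> x = \<zero>\<^bsub>L\<^esub>} = {a \<odot>\<^bsub>E\<^esub> c | a. True} \<and>
     (\<forall>x\<in>carrier E. lie_br E x c = \<zero>\<^bsub>E\<^esub>) \<and> pmap E c = \<zero>\<^bsub>E\<^esub>"

text \<open>\<open>\<theta> (x, a)\<close> is the element of \<open>E\<close> identified with \<open>x + a c\<close>.\<close>

definition identification ::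
  "('a::field, 'v, 'm) restricted_lie_scheme \<Rightarrow> ('a, 'e, 'n) restricted_lie_scheme \<Rightarrow>
   ('e \<Rightarrow> 'v) \<Rightarrow> 'e \<Rightarrow> ('v \<times> 'a \<Rightarrow> 'e) \<Rightarrow> bool" where
  "identification L E \<pi> c \<theta> \<longleftrightarrow>
     linear_map class_ring (direct_sum L scalar_space) E \<theta> \<and>
     bij_betw \<theta> (carrier (direct_sum L scalar_space)) (carrier E) \<and>
     (\<forall>x\<in>carrier L. \<forall>a. \<pi> (\<theta> (x, a)) = x) \<and> \<theta> (\<zero>\<^bsub>L\<^esub>, 1) = c"

definition corresponds ::
  "('a::field, 'v, 'm) restricted_lie_scheme \<Rightarrow> ('a, 'e, 'n) restricted_lie_scheme \<Rightarrow>
   ('e \<Rightarrow> 'v) \<Rightarrow> 'e \<Rightarrow> (('v \<times> 'v \<Rightarrow> 'a) \<times> ('v \<Rightarrow> 'a)) set \<Rightarrow> bool" where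
  "corresponds L E \<pi> c \<xi> \<longleftrightarrow> (\<exists>(\<phi>, \<omega>)\<in>\<xi>. \<exists>\<theta>. identification L E \<pi> c \<theta> \<and>
     (\<forall>x\<in>carrier L. \<forall>y\<in>carrier L.
        lie_br E (\<theta> (x, 0)) (\<theta> (y, 0)) = \<theta> (lie_br L x y, 0) \<oplus>\<^bsub>E\<^esub> \<phi> (x, y) \<odot>\<^bsub>E\<^esub> c) \<and>
     (\<forall>x\<in>carrier L. pmap E (\<theta> (x, 0)) = \<theta> (pmap L x, 0) \<oplus>\<^bsub>E\<^esub> \<omega> x \<odot>\<^bsub>E\<^esub> c))"


section \<open>The algebra \<open>m\<^sub>0\<^sup>0(p)\<close>\<close>

text \<open>Elements are coordinate vectors indexed by \<open>{1..p}\<close>.\<close>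

definition bvec :: "nat \<Rightarrow> nat \<Rightarrow> nat \<Rightarrow> 'a::field" where
  "bvec p k = restrict (\<lambda>n. if n = k then 1 else 0) {1..p}"

text \<open>\<open>m00_coeff p i j n\<close> is the coefficient of \<open>e\<^sub>n\<close> in \<open>[e\<^sub>i, e\<^sub>j]\<close>.\<close>

definition m00_coeff :: "nat \<Rightarrow> nat \<Rightarrow> nat \<Rightarrow> nat \<Rightarrow> 'a::field" where
  "m00_coeff p i j n =
     (if i = 1 \<and> 1 < j \<and> j < p \<and> n = j + 1 then 1
      else if j = 1 \<and> 1 < i \<and> i < p \<and> n = i + 1 then - 1
      else 0)"

definition m00 :: "nat \<Rightarrow> ('a::field, nat \<Rightarrow> 'a) restricted_lie" where
  "m00 p = module.extend (funs {1..p})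
     \<lparr>lie_br = (\<lambda>x y. restrict
        (\<lambda>n. \<Sum>i = 1..p. \<Sum>j = 1..p. x i * y j * m00_coeff p i j n) {1..p}),
      pmap = (\<lambda>x. \<zero>\<^bsub>funs {1..p}\<^esub>)\<rparr>"

definition ebar :: "nat \<Rightarrow> nat \<Rightarrow> (nat \<Rightarrow> 'a::field) \<Rightarrow> 'a" where
  "ebar p k = restrict (\<lambda>x. x k ^ p) (carrier (m00 p))"

end

theory Submission
  imports Defs
begin

text \<open>
  Since the \<open>[p]\<close>-operator of \<open>\<gg> = m\<^sub>0\<^sup>0(p)\<close> is zero, restricted cocycles are pairs \<open>(\<phi>, \<omega>)\<close> with
  \<open>\<phi>\<close> an ordinary cocycle and \<open>\<omega>\<close> having the \<open>*\<close>-property, restricted coboundaries are the pairs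
  \<open>(d\<^sup>1 \<psi>, 0)\<close>, and two choices of \<open>\<omega>\<close> for the same \<open>\<phi>\<close> differ by an element of \<open>Hom\<^sub>F\<^sub>r\<close>.
  So a splitting is a linear choice of \<open>\<omega>\<close> that vanishes on coboundaries. In the sum of the
  \<open>*\<close>-property each \<open>(p-1)\<close>-fold bracket is a multiple of \<open>e\<^sub>p\<close>, and a cocycle satisfies
  \<open>\<phi>(e\<^sub>p, e\<^sub>j) = 0\<close> for \<open>j \<ge> 3\<close>; summing up with binomial identities in characteristic \<open>p\<close> shows that
  \<open>- \<phi>(e\<^sub>p, e\<^sub>1) x\<^sub>1\<^bsup>p-1\<^esup> x\<^sub>2 - (1/2) \<phi>(e\<^sub>p, e\<^sub>2) x\<^sub>1\<^bsup>p-2\<^esup> x\<^sub>2\<^sup>2\<close>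
  is such a choice. The extension attached to \<open>(0, \<omega>)\<close> is \<open>\<gg> \<oplus> F c\<close> with the bracket of \<open>\<gg>\<close> and
  \<open>(x + a c)\<^bsup>[p]\<^esup> = \<omega>(x) c\<close>; any other representative \<open>(d\<^sup>1 \<psi>, \<omega>)\<close> is brought to this form by the
  change of identification \<open>x \<mapsto> x + \<psi>(x) c\<close>.
\<close>

text \<open>Over a field the sequence splits once it is exact; the content is that every ordinary
  cocycle \<phi> admits some \<omega>. Two such maps that agree on \<open>e_1, ..., e_p\<close>
  coincide, so \<omega> can be normalised to vanish on the basis, which makes it unique and hence
  linear in \<phi>. For odd p the constants come from the star property at
  \<open>g = x_1 e_1\<close>, \<open>h = x_2 e_2\<close>: only the sequences
  \<open>g h g ... g g\<close> and \<open>g h g ... g h\<close> contribute, with \<open>#(g)\<close>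
  equal to \<open>p - 1\<close> and \<open>p - 2\<close>, and in characteristic p the inverses of
  these are \<open>- 1\<close> and \<open>- 1/2\<close>. The obstacle is the verification for all
  \<open>g\<close> and \<open>h\<close>. The denominators \<open>#(g)\<close> can be absorbed into
  binomial coefficients only at the cost of a factor \<open>g_1\<close> or \<open>h_1\<close>, and
  in a given field these values may be zero. The closed forms are therefore kept in multiplied form,
  and the one place that divides by \<open>g_1 h_1\<close> treats the zero values apart.
  Characteristic 2, where the half makes no sense, is handled directly.\<close>

section \<open>Quotient spaces\<close>

text \<open>Nothing is assumed about \<open>Q\<close> beyond its operations: every axiom is
  transported from \<open>V\<close> along the surjection \<open>q\<close>. This serves quotients
  and, with \<open>q\<close> the identity, records such as \<open>m00 p\<close> that copy the
  operations of a known space.\<close>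

lemma vectorspace_surj_image:
  fixes V :: "('a, 'v, 'm) module_scheme" and Q :: "('a, 'w, 'n) module_scheme"
  assumes "vectorspace K V"
    and surj: "q ` carrier V = carrier Q"
    and zero: "q \<zero>\<^bsub>V\<^esub> = \<zero>\<^bsub>Q\<^esub>"
    and add: "\<And>x y. x \<in> carrier V \<Longrightarrow> y \<in> carrier V \<Longrightarrow> q (x \<oplus>\<^bsub>V\<^esub> y) = q x \<oplus>\<^bsub>Q\<^esub> q y"
    and smult: "\<And>a x. a \<in> carrier K \<Longrightarrow> x \<in> carrier V \<Longrightarrow> q (a \<odot>\<^bsub>V\<^esub> x) = a \<odot>\<^bsub>Q\<^esub> q x"
  shows "linear_map K V Q q"
proof -
  interpret V: vectorspace K V by fact
  have Q: "X \<in> carrier Q \<longleftrightarrow> (\<exists>x\<in>carrier V. X = q x)" for X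
    using surj by blast
  have neg: "\<exists>Y\<in>carrier Q. X \<oplus>\<^bsub>Q\<^esub> Y = \<zero>\<^bsub>Q\<^esub>" if X: "X \<in> carrier Q" for X
  proof -
    from X obtain x where x: "x \<in> carrier V" "X = q x" using Q by blast
    then have "X \<oplus>\<^bsub>Q\<^esub> q (\<ominus>\<^bsub>V\<^esub> x) = \<zero>\<^bsub>Q\<^esub>"
      by (simp add: add[symmetric] V.module.M.r_neg zero)
    then show ?thesis using x Q by blast
  qed
  interpret Q: vectorspace K Q
  proof (rule vs_criteria)
    show "\<forall>X\<in>carrier Q. \<exists>Y\<in>carrier Q. X \<oplus>\<^bsub>Q\<^esub> Y = \<zero>\<^bsub>Q\<^esub>" using neg by blast
    show "field K" ..
    show "\<forall>v w x. v \<in> carrier Q \<and> w \<in> carrier Q \<and> x \<in> carrier Q \<longrightarrow> v \<oplus>\<^bsub>Q\<^esub> w \<oplus>\<^bsub>Q\<^esub> x = v \<oplus>\<^bsub>Q\<^esub> (w \<oplus>\<^bsub>Q\<^esub> x)"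
      by (auto simp: Q add[symmetric] V.module.M.a_assoc)
    show "\<forall>v w. v \<in> carrier Q \<and> w \<in> carrier Q \<longrightarrow> v \<oplus>\<^bsub>Q\<^esub> w = w \<oplus>\<^bsub>Q\<^esub> v"
      by (auto simp: Q add[symmetric] V.module.M.a_comm)
    show "\<forall>a b v. a \<in> carrier K \<and> b \<in> carrier K \<and> v \<in> carrier Q \<longrightarrow>
        (a \<oplus>\<^bsub>K\<^esub> b) \<odot>\<^bsub>Q\<^esub> v = a \<odot>\<^bsub>Q\<^esub> v \<oplus>\<^bsub>Q\<^esub> b \<odot>\<^bsub>Q\<^esub> v"
      by (auto simp: Q add[symmetric] smult[symmetric] V.module.smult_l_distr)
    show "\<forall>a v w. a \<in> carrier K \<and> v \<in> carrier Q \<and> w \<in> carrier Q \<longrightarrow>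
        a \<odot>\<^bsub>Q\<^esub> (v \<oplus>\<^bsub>Q\<^esub> w) = a \<odot>\<^bsub>Q\<^esub> v \<oplus>\<^bsub>Q\<^esub> a \<odot>\<^bsub>Q\<^esub> w"
      by (auto simp: Q add[symmetric] smult[symmetric] V.module.smult_r_distr)
    show "\<forall>a b v. a \<in> carrier K \<and> b \<in> carrier K \<and> v \<in> carrier Q \<longrightarrow>
        (a \<otimes>\<^bsub>K\<^esub> b) \<odot>\<^bsub>Q\<^esub> v = a \<odot>\<^bsub>Q\<^esub> (b \<odot>\<^bsub>Q\<^esub> v)"
      by (auto simp: Q smult[symmetric] V.module.smult_assoc1)
    show "\<zero>\<^bsub>Q\<^esub> \<in> carrier Q" using Q zero by force
    show "\<forall>v w. v \<in> carrier Q \<and> w \<in> carrier Q \<longrightarrow> v \<oplus>\<^bsub>Q\<^esub> w \<in> carrier Q"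
      using Q add by (metis V.module.M.a_closed)
    show "\<forall>c v. c \<in> carrier K \<and> v \<in> carrier Q \<longrightarrow> c \<odot>\<^bsub>Q\<^esub> v \<in> carrier Q"
      using Q smult by (metis V.module.smult_closed)
    show "\<forall>v\<in>carrier Q. v \<oplus>\<^bsub>Q\<^esub> \<zero>\<^bsub>Q\<^esub> = v"
      by (auto simp: Q add[symmetric] zero[symmetric])
    show "\<forall>v\<in>carrier Q. \<one>\<^bsub>K\<^esub> \<odot>\<^bsub>Q\<^esub> v = v"
      by (auto simp: Q smult[symmetric])
  qed
  show ?thesis
    by unfold_locales (use surj add smult in \<open>auto simp: LinearCombinations.module_hom_def\<close>)
qed

context subspace
begin

sublocale V: vectorspace K V by (rule vs)

lemma W_add_closed: "b \<in> W \<Longrightarrow> b' \<in> W \<Longrightarrow> b \<oplus> b' \<in> W"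
  and W_smult_closed: "a \<in> carrier K \<Longrightarrow> b \<in> W \<Longrightarrow> a \<odot> b \<in> W"
  and W_zero: "\<zero> \<in> W"
  and W_subset: "W \<subseteq> carrier V"
  using submod unfolding submodule_def by auto

lemma W_minus_closed: "b \<in> W \<Longrightarrow> \<ominus> b \<in> W"
  by (metis V.module.smult_minus_1 V.R.add.inv_closed V.R.one_closed W_smult_closed W_subset subsetD)

lemma coset_mem_iff: "X \<in> W +> v \<longleftrightarrow> (\<exists>b\<in>W. X = b \<oplus> v)"
  by (auto simp: a_r_coset_def')

lemma coset_eq_iff:
  assumes "v \<in> carrier V" "w \<in> carrier V"
  shows "W +> v = W +> w \<longleftrightarrow> v \<ominus> w \<in> W"
proof
  assume "W +> v = W +> w"
  moreover have "v \<in> W +> v" using coset_mem_iff W_zero assms by force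
  ultimately obtain b where b: "b \<in> W" "v = b \<oplus> w" using coset_mem_iff by auto
  then have "v \<ominus> w = b"
    using assms W_subset by (simp add: V.module.M.a_assoc V.module.M.minus_eq V.module.M.r_neg subsetD)
  with b show "v \<ominus> w \<in> W" by simp
next
  assume vw: "v \<ominus> w \<in> W"
  have *: "W +> x \<subseteq> W +> y" if "x \<ominus> y \<in> W" "x \<in> carrier V" "y \<in> carrier V" for x y
  proof
    fix u assume "u \<in> W +> x"
    then obtain b where b: "b \<in> W" "u = b \<oplus> x" using coset_mem_iff by auto
    then have "u = (b \<oplus> (x \<ominus> y)) \<oplus> y"
      using that W_subset
      by (simp add: V.module.M.a_assoc V.module.M.minus_eq V.module.M.l_neg subsetD)
    then show "u \<in> W +> y" using that b W_add_closed coset_mem_iff by blast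
  qed
  have "w \<ominus> v = \<ominus> (v \<ominus> w)"
    using assms by (simp add: V.module.M.minus_eq V.module.M.minus_add V.module.M.a_comm)
  then have "w \<ominus> v \<in> W" using W_minus_closed vw by simp
  then show "W +> v = W +> w" using * vw assms by blast
qed

lemma coset_eq_iff_add:
  assumes "v \<in> carrier V" "w \<in> carrier V"
  shows "W +> v = W +> w \<longleftrightarrow> (\<exists>b\<in>W. v = b \<oplus> w)"
proof -
  have "v \<ominus> w = b \<longleftrightarrow> v = b \<oplus> w" if "b \<in> W" for b
    using that W_subset assms
    by (metis V.module.M.add.inv_solve_right V.module.M.minus_eq subsetD)
  then have "(\<exists>b\<in>W. v = b \<oplus> w) \<longleftrightarrow> (\<exists>b\<in>W. v \<ominus> w = b)" by simp
  then show ?thesis using coset_eq_iff[OF assms] by simp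
qed

text \<open>The summand \<open>W\<close> in the scalar multiplication of \<open>quot_space\<close>
  matters for the scalar 0: the bare image of a coset would be the single vector 0, and adding
  \<open>W\<close> restores a coset. Elements of sums and multiples thus carry two members of
  \<open>W\<close>, which the closure properties of \<open>W\<close> merge into one.\<close>

lemma quot_space_linear: "linear_map K V (quot_space V W) (\<lambda>v. W +> v)"
proof (rule vectorspace_surj_image)
  show "(\<lambda>v. W +> v) ` carrier V = carrier (quot_space V W)"
    by (auto simp: quot_space_def A_RCOSETS_def')
  show "W +> \<zero> = \<zero>\<^bsub>quot_space V W\<^esub>"
    using W_subset by (auto simp: quot_space_def coset_mem_iff subset_iff) 
next
  fix x y assume xy: "x \<in> carrier V" "y \<in> carrier V"
  show "W +> (x \<oplus> y) = (W +> x) \<oplus>\<^bsub>quot_space V W\<^esub> (W +> y)"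
  proof (rule Set.set_eqI)
    fix u
    have "u \<in> (W +> x) \<oplus>\<^bsub>quot_space V W\<^esub> (W +> y) \<longleftrightarrow>
        (\<exists>b\<in>W. \<exists>b'\<in>W. u = (b \<oplus> x) \<oplus> (b' \<oplus> y))"
      by (simp add: quot_space_def set_add_def' Bex_def coset_mem_iff) blast
    also have "\<dots> \<longleftrightarrow> (\<exists>b\<in>W. \<exists>b'\<in>W. u = (b \<oplus> b') \<oplus> (x \<oplus> y))"
      using xy W_subset by (intro bex_cong refl) (auto simp: V.module.M.a_ac subset_iff)
    also have "\<dots> \<longleftrightarrow> (\<exists>b\<in>W. u = b \<oplus> (x \<oplus> y))"
      using W_add_closed W_zero W_subset V.module.M.r_zero by (metis subsetD)
    finally show "u \<in> W +> (x \<oplus> y) \<longleftrightarrow> u \<in> (W +> x) \<oplus>\<^bsub>quot_space V W\<^esub> (W +> y)"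
      by (simp add: coset_mem_iff)
  qed
next
  fix a x assume ax: "a \<in> carrier K" "x \<in> carrier V"
  show "W +> (a \<odot> x) = a \<odot>\<^bsub>quot_space V W\<^esub> (W +> x)"
  proof (rule Set.set_eqI)
    fix u
    have "u \<in> a \<odot>\<^bsub>quot_space V W\<^esub> (W +> x) \<longleftrightarrow> (\<exists>b\<in>W. \<exists>b'\<in>W. u = b \<oplus> a \<odot> (b' \<oplus> x))"
      by (simp add: quot_space_def set_add_def' Bex_def coset_mem_iff) blast
    also have "\<dots> \<longleftrightarrow> (\<exists>b\<in>W. \<exists>b'\<in>W. u = (b \<oplus> a \<odot> b') \<oplus> a \<odot> x)"
      using ax W_subset
      by (intro bex_cong refl) (auto simp: V.module.smult_r_distr V.module.M.a_assoc subset_iff)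
    also have "\<dots> \<longleftrightarrow> (\<exists>b\<in>W. u = b \<oplus> a \<odot> x)"
    proof
      assume "\<exists>b\<in>W. u = b \<oplus> a \<odot> x"
      then obtain b where b: "b \<in> W" "u = (b \<oplus> a \<odot> \<zero>) \<oplus> a \<odot> x"
        using W_subset ax by (auto simp: subset_iff)
      then show "\<exists>b\<in>W. \<exists>b'\<in>W. u = (b \<oplus> a \<odot> b') \<oplus> a \<odot> x" using W_zero by blast
    qed (use W_add_closed W_smult_closed ax in blast)
    finally show "u \<in> W +> (a \<odot> x) \<longleftrightarrow> u \<in> a \<odot>\<^bsub>quot_space V W\<^esub> (W +> x)"
      by (simp add: coset_mem_iff)
  qed
qed (rule vs)

lemma quot_space_carrier: "carrier (quot_space V W) = (\<lambda>v. W +> v) ` carrier V"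
  by (auto simp: quot_space_def A_RCOSETS_def')

text \<open>Universal property of the quotient. \<open>F\<close> picks an arbitrary representative;
  another choice differs by an element of \<open>W\<close>, which \<open>f\<close> kills.\<close>

lemma quot_space_lift:
  assumes "linear_map K V U f" and ker: "\<And>b. b \<in> W \<Longrightarrow> f b = \<zero>\<^bsub>U\<^esub>"
  shows "\<exists>F. linear_map K (quot_space V W) U F \<and> (\<forall>v\<in>carrier V. F (W +> v) = f v)"
proof -
  interpret f: linear_map K V U f by fact
  interpret q: linear_map K V "quot_space V W" "\<lambda>v. W +> v" by (rule quot_space_linear)
  define F where "F X = f (SOME v. v \<in> carrier V \<and> X = W +> v)" for X
  have F: "F (W +> v) = f v" if v: "v \<in> carrier V" for v
  proof -
    define w where "w = (SOME w. w \<in> carrier V \<and> W +> v = W +> w)"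
    have w: "w \<in> carrier V \<and> W +> v = W +> w"
      unfolding w_def by (rule someI[of _ v]) (use v in auto)
    then have "v \<ominus> w \<in> W" using coset_eq_iff v by blast
    then have "f v \<ominus>\<^bsub>U\<^esub> f w = \<zero>\<^bsub>U\<^esub>" using ker f.f_minus v w by metis
    then have "f v = f w" using v w f.W.module.M.minus_other_side by auto
    then show ?thesis unfolding F_def w_def[symmetric] by simp
  qed
  have "linear_map K (quot_space V W) U F"
  proof (unfold_locales)
    show "F \<in> LinearCombinations.module_hom K (quot_space V W) U"
      unfolding LinearCombinations.module_hom_def quot_space_carrier
      by (auto simp: F simp flip: q.f_add q.f_smult)
  qed
  with F show ?thesis by blast
qed

end

section \<open>Cochain spaces\<close>

lemma carrier_funs: "carrier (funs S) = extensional S"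
  and zero_funs: "\<zero>\<^bsub>funs S\<^esub> = restrict (\<lambda>_. 0) S"
  and add_funs: "f \<oplus>\<^bsub>funs S\<^esub> g = restrict (\<lambda>v. f v + g v) S"
  and smult_funs: "a \<odot>\<^bsub>funs S\<^esub> f = restrict (\<lambda>v. a * f v) S"
  by (simp_all add: class_ring.func_space_def PiE_def)

lemmas funs_simps = carrier_funs zero_funs add_funs smult_funs

lemma vectorspace_funs: "vectorspace class_ring (funs S)"
  unfolding vectorspace_def using class_cring.func_space_is_module class_field by blast

lemma vectorspace_scalar_space: "vectorspace class_ring scalar_space"
proof (rule vs_criteria)
  show "field (class_ring :: 'a ring)" by (rule class_field)
  show "\<forall>v\<in>carrier scalar_space. \<exists>w\<in>carrier scalar_space. v \<oplus>\<^bsub>scalar_space\<^esub> w = \<zero>\<^bsub>scalar_space\<^esub>"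
    by (auto simp: scalar_space_def intro!: exI[of _ "- _"])
qed (auto simp: scalar_space_def algebra_simps)

lemma restrict_eq_restrict_iff: "restrict f S = restrict g S \<longleftrightarrow> (\<forall>x\<in>S. f x = g x)"
  by (metis restrict_apply' restrict_ext)

lemma submodule_funsI:
  assumes "N \<subseteq> extensional S" "restrict (\<lambda>_. 0) S \<in> N"
    and "\<And>f g. f \<in> N \<Longrightarrow> g \<in> N \<Longrightarrow> restrict (\<lambda>v. f v + g v) S \<in> N"
    and "\<And>a f. f \<in> N \<Longrightarrow> restrict (\<lambda>v. a * f v) S \<in> N"
  shows "submodule class_ring N (funs S)"
  using assms class_cring.func_space_is_module
  by (auto simp: submodule_def funs_simps)

text \<open>Submodules are checked inside the full function space, where the operations are
  explicit, and the ambient carrier is shrunk to the cocycles afterwards.\<close>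

lemma submodule_carrier_update:
  assumes "submodule R B M" "submodule R N M" "B \<subseteq> N"
  shows "submodule R B (M\<lparr>carrier := N\<rparr>)"
proof -
  interpret Module.module R M using assms(1) by (simp add: submodule_def)
  show ?thesis using assms submodule_is_module[OF assms(2)] by (auto simp: submodule_def)
qed

lemma vectorspace_carrier_update:
  assumes "vectorspace K M" "submodule K N M"
  shows "vectorspace K (M\<lparr>carrier := N\<rparr>)"
  using vectorspace.subspace_is_vs[OF assms(1)] assms by (simp add: subspace_def)

lemma subspace_carrier_update:
  assumes "vectorspace K M" "submodule K N M" "submodule K B M" "B \<subseteq> N"
  shows "subspace K B (M\<lparr>carrier := N\<rparr>)"
  using vectorspace_carrier_update submodule_carrier_update assms by (auto simp: subspace_def)

lemma linear_mapI:
  assumes "vectorspace K V" "vectorspace K W"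
    and "\<And>x. x \<in> carrier V \<Longrightarrow> T x \<in> carrier W"
    and "\<And>x y. x \<in> carrier V \<Longrightarrow> y \<in> carrier V \<Longrightarrow> T (x \<oplus>\<^bsub>V\<^esub> y) = T x \<oplus>\<^bsub>W\<^esub> T y"
    and "\<And>a x. a \<in> carrier K \<Longrightarrow> x \<in> carrier V \<Longrightarrow> T (a \<odot>\<^bsub>V\<^esub> x) = a \<odot>\<^bsub>W\<^esub> T x"
  shows "linear_map K V W T"
proof -
  interpret V: vectorspace K V by fact
  interpret W: vectorspace K W by fact
  show ?thesis
    by unfold_locales (use assms in \<open>auto simp: LinearCombinations.module_hom_def\<close>)
qed

lemma linear_map_comp:
  assumes "linear_map K U V S" "linear_map K V W T"
  shows "linear_map K U W (\<lambda>x. T (S x))"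
proof -
  interpret S: linear_map K U V S by fact
  interpret T: linear_map K V W T by fact
  show ?thesis
    by unfold_locales (auto simp: LinearCombinations.module_hom_def)
qed

lemma linear_map_fst:
  assumes "vectorspace K V" "vectorspace K W"
  shows "linear_map K (direct_sum V W) V fst"
  by (rule linear_mapI) (use assms direct_sum_is_vs[OF assms] in \<open>auto simp: direct_sum_def\<close>)

lemma linear_functional_iff:
  "f \<in> LinearCombinations.module_hom class_ring L scalar_space \<longleftrightarrow>
    (\<forall>x\<in>carrier L. \<forall>y\<in>carrier L. f (x \<oplus>\<^bsub>L\<^esub> y) = f x + f y) \<and>
    (\<forall>a. \<forall>x\<in>carrier L. f (a \<odot>\<^bsub>L\<^esub> x) = a * f x)"
  by (auto simp: LinearCombinations.module_hom_def scalar_space_def)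

lemma C2_ops:
  "\<zero>\<^bsub>C2 L\<^esub> = restrict (\<lambda>_. 0) (carrier L \<times> carrier L)"
  "f \<oplus>\<^bsub>C2 L\<^esub> g = restrict (\<lambda>v. f v + g v) (carrier L \<times> carrier L)"
  "a \<odot>\<^bsub>C2 L\<^esub> f = restrict (\<lambda>v. a * f v) (carrier L \<times> carrier L)"
  by (simp_all add: C2_def funs_simps)

lemma C2s_ops:
  "\<zero>\<^bsub>C2s p L\<^esub> = (\<zero>\<^bsub>C2 L\<^esub>, \<zero>\<^bsub>funs (carrier L)\<^esub>)"
  "z \<oplus>\<^bsub>C2s p L\<^esub> w = (fst z \<oplus>\<^bsub>C2 L\<^esub> fst w, snd z \<oplus>\<^bsub>funs (carrier L)\<^esub> snd w)"
  "a \<odot>\<^bsub>C2s p L\<^esub> z = (a \<odot>\<^bsub>C2 L\<^esub> fst z, a \<odot>\<^bsub>funs (carrier L)\<^esub> snd z)"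
  by (simp_all add: C2s_def direct_sum_def)

lemma C2_mem_iff:
  "\<phi> \<in> carrier (C2 L) \<longleftrightarrow> \<phi> \<in> extensional (carrier L \<times> carrier L) \<and>
    (\<forall>x\<in>carrier L. \<forall>y\<in>carrier L. \<forall>z\<in>carrier L. \<phi> (x \<oplus>\<^bsub>L\<^esub> y, z) = \<phi> (x, z) + \<phi> (y, z)) \<and>
    (\<forall>a. \<forall>x\<in>carrier L. \<forall>z\<in>carrier L. \<phi> (a \<odot>\<^bsub>L\<^esub> x, z) = a * \<phi> (x, z)) \<and>
    (\<forall>x\<in>carrier L. \<forall>y\<in>carrier L. \<forall>z\<in>carrier L. \<phi> (z, x \<oplus>\<^bsub>L\<^esub> y) = \<phi> (z, x) + \<phi> (z, y)) \<and>
    (\<forall>a. \<forall>x\<in>carrier L. \<forall>z\<in>carrier L. \<phi> (z, a \<odot>\<^bsub>L\<^esub> x) = a * \<phi> (z, x)) \<and>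
    (\<forall>x\<in>carrier L. \<phi> (x, x) = 0)"
  unfolding C2_def linear_functional_iff by auto

lemma Z2_mem_iff:
  "\<phi> \<in> Z2 L \<longleftrightarrow> \<phi> \<in> carrier (C2 L) \<and>
    (\<forall>g\<in>carrier L. \<forall>h\<in>carrier L. \<forall>f\<in>carrier L.
      \<phi> (lie_br L g h, f) - \<phi> (lie_br L g f, h) + \<phi> (lie_br L h f, g) = 0)"
  unfolding Z2_def d2_def zero_funs by (auto simp: restrict_eq_restrict_iff)

lemma Hom_Fr_ops:
  "\<zero>\<^bsub>Hom_Fr p L\<^esub> = restrict (\<lambda>_. 0) (carrier L)"
  "f \<oplus>\<^bsub>Hom_Fr p L\<^esub> g = restrict (\<lambda>v. f v + g v) (carrier L)"
  "a \<odot>\<^bsub>Hom_Fr p L\<^esub> f = restrict (\<lambda>v. a * f v) (carrier L)"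
  by (simp_all add: Hom_Fr_def funs_simps)

section \<open>Cocycles and coboundaries of a restricted Lie algebra\<close>

context restricted_lie_algebra
begin

lemma p_pos: "p > 0"
  using prime_p prime_gt_0_nat by blast

lemma br_add_left: "x \<in> carrier L \<Longrightarrow> y \<in> carrier L \<Longrightarrow> z \<in> carrier L \<Longrightarrow>
    lie_br L (x \<oplus> y) z = lie_br L x z \<oplus> lie_br L y z"
  and br_smult_left: "x \<in> carrier L \<Longrightarrow> z \<in> carrier L \<Longrightarrow> lie_br L (a \<odot> x) z = a \<odot> lie_br L x z"
  using br_linear_left by (auto simp: LinearCombinations.module_hom_def)

lemma br_add_right: "x \<in> carrier L \<Longrightarrow> y \<in> carrier L \<Longrightarrow> z \<in> carrier L \<Longrightarrow>
    lie_br L z (x \<oplus> y) = lie_br L z x \<oplus> lie_br L z y"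
  and br_smult_right: "x \<in> carrier L \<Longrightarrow> z \<in> carrier L \<Longrightarrow> lie_br L z (a \<odot> x) = a \<odot> lie_br L z x"
  using br_linear_right by (auto simp: LinearCombinations.module_hom_def)

lemma smult_carrier: "x \<in> carrier L \<Longrightarrow> a \<odot> x \<in> carrier L"
  by (rule smult_closed) auto

lemma br_anticomm:
  assumes "x \<in> carrier L" "y \<in> carrier L"
  shows "lie_br L y x = \<ominus> lie_br L x y"
proof -
  have "lie_br L y x \<oplus> lie_br L x y = lie_br L (x \<oplus> y) (x \<oplus> y)"
    using assms br_alternating[of x] br_alternating[of y]
    by (simp add: br_add_left br_add_right br_closed M.a_comm)
  then have "lie_br L y x \<oplus> lie_br L x y = \<zero>" using assms by (simp add: br_alternating)
  then show ?thesis using assms br_closed M.minus_equality by metis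
qed

lemma functional_zero:
  assumes "f \<in> LinearCombinations.module_hom class_ring L scalar_space"
  shows "f \<zero> = 0"
  using assms M.zero_closed unfolding linear_functional_iff by (metis M.r_zero add_cancel_right_right)

lemma functional_minus:
  assumes "f \<in> LinearCombinations.module_hom class_ring L scalar_space" "x \<in> carrier L"
  shows "f (\<ominus> x) = - f x"
proof -
  have "f (x \<oplus> \<ominus> x) = f x + f (\<ominus> x)"
    using assms M.a_inv_closed unfolding linear_functional_iff by blast
  then show ?thesis
    using assms(2) functional_zero[OF assms(1)] by (simp add: M.r_neg eq_neg_iff_add_eq_0 add.commute)
qed

lemma submodule_Z2: "submodule class_ring (Z2 L) (funs (carrier L \<times> carrier L))"
proof (rule submodule_funsI)
  fix f g assume "f \<in> Z2 L" "g \<in> Z2 L"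
  note f = this(1)[unfolded Z2_mem_iff] and g = this(2)[unfolded Z2_mem_iff]
  have "restrict (\<lambda>v. f v + g v) (carrier L \<times> carrier L) \<in> carrier (C2 L)"
    using f g by (auto simp: C2_mem_iff smult_carrier algebra_simps)
  moreover have "(f (lie_br L x y, z) + g (lie_br L x y, z)) - (f (lie_br L x z, y) + g (lie_br L x z, y))
      + (f (lie_br L y z, x) + g (lie_br L y z, x)) = 0"
    if "x \<in> carrier L" "y \<in> carrier L" "z \<in> carrier L" for x y z
  proof -
    have "f (lie_br L x y, z) - f (lie_br L x z, y) + f (lie_br L y z, x) +
        (g (lie_br L x y, z) - g (lie_br L x z, y) + g (lie_br L y z, x)) = 0"
      using f g that by simp
    then show ?thesis by (simp add: algebra_simps)
  qed
  ultimately show "restrict (\<lambda>v. f v + g v) (carrier L \<times> carrier L) \<in> Z2 L"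
    by (simp add: Z2_mem_iff br_closed)
next
  fix a f assume "f \<in> Z2 L"
  note f = this(1)[unfolded Z2_mem_iff]
  have "restrict (\<lambda>v. a * f v) (carrier L \<times> carrier L) \<in> carrier (C2 L)"
    using f by (auto simp: C2_mem_iff smult_carrier algebra_simps)
  moreover have "a * f (lie_br L x y, z) - a * f (lie_br L x z, y) + a * f (lie_br L y z, x) = 0"
    if "x \<in> carrier L" "y \<in> carrier L" "z \<in> carrier L" for x y z
    using f that by (simp flip: right_diff_distrib distrib_left)
  ultimately show "restrict (\<lambda>v. a * f v) (carrier L \<times> carrier L) \<in> Z2 L"
    by (simp add: Z2_mem_iff br_closed)
qed (auto simp: Z2_mem_iff C2_mem_iff smult_carrier br_closed)

lemma C1_mem_iff: "\<psi> \<in> carrier (C1 L) \<longleftrightarrow>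
    \<psi> \<in> extensional (carrier L) \<and> \<psi> \<in> LinearCombinations.module_hom class_ring L scalar_space"
  by (auto simp: C1_def)

lemma submodule_B2: "submodule class_ring (B2 L) (funs (carrier L \<times> carrier L))"
proof (rule submodule_funsI)
  show "B2 L \<subseteq> extensional (carrier L \<times> carrier L)"
    by (auto simp: B2_def d1_def)
  show "restrict (\<lambda>_. 0) (carrier L \<times> carrier L) \<in> B2 L"
    unfolding B2_def
    by (rule image_eqI[of _ _ "restrict (\<lambda>_. 0) (carrier L)"])
      (auto simp: d1_def br_closed C1_mem_iff linear_functional_iff smult_carrier fun_eq_iff)
next
  fix f g assume "f \<in> B2 L" "g \<in> B2 L"
  then obtain \<psi> \<eta> where *: "\<psi> \<in> carrier (C1 L)" "\<eta> \<in> carrier (C1 L)" "f = d1 L \<psi>" "g = d1 L \<eta>"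
    by (auto simp: B2_def)
  show "restrict (\<lambda>v. f v + g v) (carrier L \<times> carrier L) \<in> B2 L"
    unfolding B2_def
    by (rule image_eqI[of _ _ "restrict (\<lambda>x. \<psi> x + \<eta> x) (carrier L)"])
      (use * in \<open>auto simp: d1_def br_closed C1_mem_iff linear_functional_iff smult_carrier fun_eq_iff algebra_simps\<close>)
next
  fix a f assume "f \<in> B2 L"
  then obtain \<psi> where *: "\<psi> \<in> carrier (C1 L)" "f = d1 L \<psi>"
    by (auto simp: B2_def)
  show "restrict (\<lambda>v. a * f v) (carrier L \<times> carrier L) \<in> B2 L"
    unfolding B2_def
    by (rule image_eqI[of _ _ "restrict (\<lambda>x. a * \<psi> x) (carrier L)"])
      (use * in \<open>auto simp: d1_def br_closed C1_mem_iff linear_functional_iff smult_carrier fun_eq_iff algebra_simps\<close>)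
qed

text \<open>\<open>d2\<close> after \<open>d1\<close> is zero by the Jacobi identity: the cocycle
  expression of \<open>d1 L \<psi>\<close> is, up to sign, \<psi> of the Jacobi sum once each inner
  bracket is brought to the left.\<close>

lemma B2_subset_Z2: "B2 L \<subseteq> Z2 L"
proof
  fix \<phi> assume "\<phi> \<in> B2 L"
  then obtain \<psi> where \<psi>: "\<psi> \<in> carrier (C1 L)" "\<phi> = d1 L \<psi>" by (auto simp: B2_def)
  have hom: "\<psi> \<in> LinearCombinations.module_hom class_ring L scalar_space"
    using \<psi> by (simp add: C1_mem_iff)
  note lin = hom[unfolded linear_functional_iff]
  have "\<phi> \<in> carrier (C2 L)"
    using lin functional_zero[OF hom] unfolding \<psi>(2) C2_mem_iff
    by (auto simp: d1_def br_closed smult_carrier br_add_left br_add_right br_smult_left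
      br_smult_right br_alternating)
  moreover have "\<phi> (lie_br L g h, f) - \<phi> (lie_br L g f, h) + \<phi> (lie_br L h f, g) = 0"
    if c: "g \<in> carrier L" "h \<in> carrier L" "f \<in> carrier L" for g h f
  proof -
    have fh: "lie_br L f (lie_br L g h) = \<ominus> lie_br L (lie_br L g h) f"
      and hg: "lie_br L g (lie_br L h f) = \<ominus> lie_br L (lie_br L h f) g"
      using c by (simp_all add: br_closed br_anticomm[of "lie_br L _ _"])
    have "lie_br L f g = (- 1) \<odot> lie_br L g f"
      using c smult_minus_1[of "lie_br L g f"] by (simp add: br_closed br_anticomm[of g f] class_ring_simps)
    then have gf: "lie_br L h (lie_br L f g) = lie_br L (lie_br L g f) h"
      using c smult_minus_1[of "\<ominus> lie_br L (lie_br L g f) h"]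
      by (simp add: br_closed br_smult_right br_anticomm[of "lie_br L g f" h] class_ring_simps)
    have "\<psi> (lie_br L g (lie_br L h f) \<oplus> lie_br L h (lie_br L f g) \<oplus> lie_br L f (lie_br L g h)) = 0"
      using jacobi[OF c] functional_zero[OF hom] by simp
    then have "- \<psi> (lie_br L (lie_br L h f) g) + \<psi> (lie_br L (lie_br L g f) h)
        - \<psi> (lie_br L (lie_br L g h) f) = 0"
      unfolding fh gf hg using c lin functional_minus[OF hom] by (simp add: br_closed)
    then show ?thesis using c unfolding \<psi>(2) by (simp add: d1_def br_closed algebra_simps)
  qed
  ultimately show "\<phi> \<in> Z2 L" by (simp add: Z2_mem_iff)
qed

lemma C2_carrier_update: "(C2 L)\<lparr>carrier := N\<rparr> = (funs (carrier L \<times> carrier L))\<lparr>carrier := N\<rparr>"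
  by (simp add: C2_def)

lemma C2s_carrier_update: "(C2s p L)\<lparr>carrier := N\<rparr> =
    (direct_sum (funs (carrier L \<times> carrier L)) (funs (carrier L)))\<lparr>carrier := N\<rparr>"
  by (simp add: C2s_def direct_sum_def C2_def)

lemma subspace_B2: "subspace class_ring (B2 L) ((C2 L)\<lparr>carrier := Z2 L\<rparr>)"
  unfolding C2_carrier_update
  by (intro subspace_carrier_update vectorspace_funs submodule_Z2 submodule_B2 B2_subset_Z2)

section \<open>Formal sequences and the star property\<close>

lemma left_normed_closed:
  assumes "set gs \<subseteq> carrier L" "gs \<noteq> []"
  shows "left_normed L gs \<in> carrier L"
proof -
  have "foldl (lie_br L) x ys \<in> carrier L" if "set ys \<subseteq> carrier L" "x \<in> carrier L" for x ys
    using that by (induction ys arbitrary: x) (auto simp: br_closed)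
  then show ?thesis using assms unfolding left_normed_def by (cases gs) auto
qed

lemma fill_subset: "g \<in> carrier L \<Longrightarrow> h \<in> carrier L \<Longrightarrow> set (fill g h s) \<subseteq> carrier L"
  by (auto simp: fill_def)

lemma formal_seqs_Cons: "s \<in> formal_seqs p \<Longrightarrow> \<exists>t. s = True # False # t \<and> length t = p - 2"
  using prime_ge_2_nat[OF prime_p] unfolding formal_seqs_def
  by (cases s; cases "tl s") auto

lemma formal_seq_args_closed:
  assumes "s \<in> formal_seqs p" "g \<in> carrier L" "h \<in> carrier L"
  shows "left_normed L (butlast (fill g h s)) \<in> carrier L" "last (fill g h s) \<in> carrier L"
proof -
  obtain t where t: "s = True # False # t" using formal_seqs_Cons assms by blast
  show "left_normed L (butlast (fill g h s)) \<in> carrier L"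
  proof (rule left_normed_closed)
    show "set (butlast (fill g h s)) \<subseteq> carrier L"
      using fill_subset[OF assms(2,3), of s] by (auto dest: in_set_butlastD)
    show "butlast (fill g h s) \<noteq> []" by (simp add: t fill_def)
  qed
  show "last (fill g h s) \<in> carrier L"
    using fill_subset[OF assms(2,3), of s] last_in_set[of "fill g h s"] by (auto simp: t fill_def)
qed

end

lemma star_property_linear:
  assumes "star_property p L \<phi> \<omega>" "star_property p L \<phi>' \<omega>'"
    and "\<And>s g h. s \<in> formal_seqs p \<Longrightarrow> g \<in> carrier L \<Longrightarrow> h \<in> carrier L \<Longrightarrow>
      \<phi>'' (left_normed L (butlast (fill g h s)), last (fill g h s)) =
      \<phi> (left_normed L (butlast (fill g h s)), last (fill g h s)) +
      b * \<phi>' (left_normed L (butlast (fill g h s)), last (fill g h s))"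
    and "\<And>x. x \<in> carrier L \<Longrightarrow> \<omega>'' x = \<omega> x + b * \<omega>' x"
    and "\<And>a x. x \<in> carrier L \<Longrightarrow> a \<odot>\<^bsub>L\<^esub> x \<in> carrier L"
    and "\<And>x y. x \<in> carrier L \<Longrightarrow> y \<in> carrier L \<Longrightarrow> x \<oplus>\<^bsub>L\<^esub> y \<in> carrier L"
  shows "star_property p L \<phi>'' \<omega>''"
  unfolding star_property_def
proof (intro conjI allI ballI)
  fix \<alpha> g assume "g \<in> carrier L"
  then show "\<omega>'' (\<alpha> \<odot>\<^bsub>L\<^esub> g) = \<alpha> ^ p * \<omega>'' g"
    using assms by (simp add: star_property_def algebra_simps)
next
  fix g h assume gh: "g \<in> carrier L" "h \<in> carrier L"
  have eq: "(\<Sum>s\<in>formal_seqs p. 1 / of_nat (count_list s True) *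
        \<phi>'' (left_normed L (butlast (fill g h s)), last (fill g h s))) =
      (\<Sum>s\<in>formal_seqs p. 1 / of_nat (count_list s True) *
        \<phi> (left_normed L (butlast (fill g h s)), last (fill g h s))) +
      b * (\<Sum>s\<in>formal_seqs p. 1 / of_nat (count_list s True) *
        \<phi>' (left_normed L (butlast (fill g h s)), last (fill g h s)))"
    unfolding sum_distrib_left sum.distrib[symmetric]
    by (rule sum.cong) (simp_all add: assms(3) gh algebra_simps add_divide_distrib)
  show "\<omega>'' (g \<oplus>\<^bsub>L\<^esub> h) = \<omega>'' g + \<omega>'' h + (\<Sum>s\<in>formal_seqs p. 1 / of_nat (count_list s True) *
        \<phi>'' (left_normed L (butlast (fill g h s)), last (fill g h s)))"
    unfolding eq using assms(1,2) gh
    by (simp add: assms(4,6) star_property_def distrib_left)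
qed

lemma formal_seqs_finite: "finite (formal_seqs p)"
  by (rule finite_subset[OF _ finite_lists_length_eq[of "UNIV :: bool set" p]])
    (auto simp: formal_seqs_def)

context restricted_lie_algebra
begin

lemma star_property_combine:
  assumes "star_property p L \<phi> \<omega>" "star_property p L \<phi>' \<omega>'"
  shows "star_property p L (restrict (\<lambda>v. \<phi> v + b * \<phi>' v) (carrier L \<times> carrier L))
    (restrict (\<lambda>v. \<omega> v + b * \<omega>' v) (carrier L))"
  by (rule star_property_linear[OF assms, where b = b])
    (auto simp: formal_seq_args_closed smult_carrier)

text \<open>Exactness in the middle, on the level of cochains: over \<phi> = 0 the sum vanishes, and
  the two remaining clauses amount to Frobenius semilinearity, of which they are the special cases
  \<alpha> = \<beta> = 1 and \<beta> = 0.\<close>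

lemma star_property_zero_iff:
  assumes "\<omega> \<in> extensional (carrier L)"
  shows "star_property p L (restrict (\<lambda>_. 0) (carrier L \<times> carrier L)) \<omega> \<longleftrightarrow> \<omega> \<in> carrier (Hom_Fr p L)"
proof -
  have sum0: "(\<Sum>s\<in>formal_seqs p. 1 / of_nat (count_list s True) *
      restrict (\<lambda>_. 0) (carrier L \<times> carrier L)
        (left_normed L (butlast (fill g h s)), last (fill g h s))) = (0 :: 'a)"
    if "g \<in> carrier L" "h \<in> carrier L" for g h
    by (rule sum.neutral) (use that formal_seq_args_closed in simp)
  have "star_property p L (restrict (\<lambda>_. 0) (carrier L \<times> carrier L)) \<omega> \<longleftrightarrow>
     (\<forall>\<alpha>. \<forall>g\<in>carrier L. \<omega> (\<alpha> \<odot> g) = \<alpha> ^ p * \<omega> g) \<and>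
     (\<forall>g\<in>carrier L. \<forall>h\<in>carrier L. \<omega> (g \<oplus> h) = \<omega> g + \<omega> h)"
    unfolding star_property_def using sum0 by simp
  also have "\<dots> \<longleftrightarrow> (\<forall>\<alpha> \<beta>. \<forall>x\<in>carrier L. \<forall>y\<in>carrier L.
      \<omega> (\<alpha> \<odot> x \<oplus> \<beta> \<odot> y) = \<alpha> ^ p * \<omega> x + \<beta> ^ p * \<omega> y)" (is "?A \<longleftrightarrow> ?B")
  proof
    assume ?A then show ?B by (simp add: smult_carrier)
  next
    assume B: ?B
    have 1: "\<omega> (g \<oplus> h) = \<omega> g + \<omega> h" if "g \<in> carrier L" "h \<in> carrier L" for g h
      using B[rule_format, OF that, of 1 1] that smult_one by (simp add: class_ring_simps)
    have 2: "\<omega> (\<alpha> \<odot> g) = \<alpha> ^ p * \<omega> g" if "g \<in> carrier L" for \<alpha> g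
      using B[rule_format, OF that that, of \<alpha> 0] that lmult_0 p_pos
      by (simp add: class_ring_simps smult_carrier)
    from 1 2 show ?A by blast
  qed
  finally show ?thesis using assms by (simp add: Hom_Fr_def)
qed

lemma functional_finsum:
  assumes "\<psi> \<in> LinearCombinations.module_hom class_ring L scalar_space"
    and "finite A" "v \<in> A \<rightarrow> carrier L"
  shows "\<psi> (\<Oplus>i\<in>A. v i) = (\<Sum>i\<in>A. \<psi> (v i))"
  using assms(2,3)
proof (induction A)
  case empty
  then show ?case using functional_zero[OF assms(1)] by simp
next
  case (insert i A)
  then have "\<psi> (v i \<oplus> (\<Oplus>i\<in>A. v i)) = \<psi> (v i) + \<psi> (\<Oplus>i\<in>A. v i)"
    using assms(1) M.finsum_closed unfolding linear_functional_iff by (simp add: Pi_iff)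
  then show ?case using insert by (simp add: Pi_iff M.finsum_insert)
qed

text \<open>With the last bracket split off, a linear form \<psi> on a monomial of Jacobson's sum
  becomes \<open>d1 L \<psi>\<close> at the arguments prescribed by the star property.\<close>

lemma left_normed_fill_butlast:
  assumes "s \<in> formal_seqs p"
  shows "left_normed L (fill g h s) = lie_br L (left_normed L (butlast (fill g h s))) (last (fill g h s))"
proof -
  obtain t where t: "s = True # False # t" using formal_seqs_Cons assms by blast
  define u where "u = fill g h (False # t)"
  have "fill g h s = g # u" "u \<noteq> []" by (auto simp: t u_def fill_def)
  then show ?thesis
    using foldl_append[of "lie_br L" g "butlast u" "[last u]"]
    by (simp add: left_normed_def)
qed

text \<open>Apply \<psi> to Jacobson's formula \<open>pmap_add\<close>.\<close>

lemma star_property_d1s: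
  assumes "\<psi> \<in> carrier (C1 L)"
  shows "star_property p L (d1 L \<psi>) (ind1 L \<psi>)"
  unfolding star_property_def
proof (intro conjI allI ballI)
  note hom = assms[unfolded C1_mem_iff, THEN conjunct2]
  fix \<alpha> g assume "g \<in> carrier L"
  then show "ind1 L \<psi> (\<alpha> \<odot> g) = \<alpha> ^ p * ind1 L \<psi> g"
    using hom by (simp add: ind1_def smult_carrier pmap_smult pmap_closed linear_functional_iff)
next
  note hom = assms[unfolded C1_mem_iff, THEN conjunct2]
  fix g h assume gh: "g \<in> carrier L" "h \<in> carrier L"
  let ?v = "\<lambda>s. (1 / of_nat (count_list s True)) \<odot> left_normed L (fill g h s)"
  have ln: "left_normed L (fill g h s) \<in> carrier L" if "s \<in> formal_seqs p" for s
    using that formal_seq_args_closed gh by (simp add: left_normed_fill_butlast br_closed)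
  then have v: "?v \<in> formal_seqs p \<rightarrow> carrier L" by (simp add: smult_carrier)
  then have "\<psi> (pmap L (g \<oplus> h)) = \<psi> (pmap L g) + \<psi> (pmap L h) + \<psi> (\<Oplus>s\<in>formal_seqs p. ?v s)"
    using hom gh M.finsum_closed by (simp add: pmap_add pmap_closed linear_functional_iff)
  also have "\<psi> (\<Oplus>s\<in>formal_seqs p. ?v s) = (\<Sum>s\<in>formal_seqs p. \<psi> (?v s))"
    by (rule functional_finsum[OF hom formal_seqs_finite v])
  also have "\<dots> = (\<Sum>s\<in>formal_seqs p. 1 / of_nat (count_list s True) *
      d1 L \<psi> (left_normed L (butlast (fill g h s)), last (fill g h s)))"
    using hom ln formal_seq_args_closed gh
    by (intro sum.cong) (simp_all add: linear_functional_iff d1_def flip: left_normed_fill_butlast)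
  finally show "ind1 L \<psi> (g \<oplus> h) = ind1 L \<psi> g + ind1 L \<psi> h +
      (\<Sum>s\<in>formal_seqs p. 1 / of_nat (count_list s True) *
        d1 L \<psi> (left_normed L (butlast (fill g h s)), last (fill g h s)))"
    using gh by (simp add: ind1_def)
qed

lemma submodule_Hom_Fr: "submodule class_ring (carrier (Hom_Fr p L)) (funs (carrier L))"
  by (rule submodule_funsI) (auto simp: Hom_Fr_def smult_carrier algebra_simps)

lemma vectorspace_Hom_Fr: "vectorspace class_ring (Hom_Fr p L)"
  using vectorspace_carrier_update[OF vectorspace_funs submodule_Hom_Fr]
  by (simp add: Hom_Fr_def)

lemma vectorspace_H2: "vectorspace class_ring (H2 L)"
  using subspace.quot_space_linear[OF subspace_B2] unfolding H2_def linear_map_def by blast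

end

section \<open>Restricted Lie algebras with zero [p]-operator\<close>

locale null_restricted_lie_algebra = restricted_lie_algebra p L
  for p :: nat and L :: "('a::field, 'v, 'm) restricted_lie_scheme" (structure) +
  assumes pmap_null: "x \<in> carrier L \<Longrightarrow> pmap L x = \<zero>"
begin

lemma Z2s_mem_iff:
  "(\<phi>, \<omega>) \<in> Z2s p L \<longleftrightarrow> \<phi> \<in> Z2 L \<and> \<omega> \<in> extensional (carrier L) \<and> star_property p L \<phi> \<omega>"
proof -
  have "\<phi> (g, pmap L h) = 0" if "\<phi> \<in> carrier (C2 L)" "g \<in> carrier L" "h \<in> carrier L" for g h
    using that functional_zero[of "\<lambda>y. \<phi> (g, y)"] by (simp add: pmap_null C2_def)
  then show ?thesis
    by (auto simp: Z2s_def C2s_def d2s_def ind2_def Z2_def zero_funs restrict_eq_restrict_iff)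
qed

lemma B2s_eq: "B2s L = B2 L \<times> {restrict (\<lambda>_. 0) (carrier L)}"
proof -
  have "ind1 L \<psi> = restrict (\<lambda>_. 0) (carrier L)" if "\<psi> \<in> carrier (C1 L)" for \<psi>
    using that functional_zero[of \<psi>] by (auto simp: ind1_def pmap_null C1_mem_iff fun_eq_iff)
  then show ?thesis by (force simp: B2s_def B2_def d1s_def)
qed

lemma submodule_Z2s:
  "submodule class_ring (Z2s p L) (direct_sum (funs (carrier L \<times> carrier L)) (funs (carrier L)))"
  unfolding submodule_def
proof (intro conjI allI impI)
  let ?D = "direct_sum (funs (carrier L \<times> carrier L)) (funs (carrier L))"
  show "Module.module class_ring ?D"
    by (intro direct_sum_is_module class_cring.func_space_is_module)
  note Z2 = submodule_Z2[unfolded submodule_def funs_simps]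
  show "Z2s p L \<subseteq> carrier ?D"
    using Z2 by (auto simp: Z2s_mem_iff direct_sum_def funs_simps)
  show "\<zero>\<^bsub>?D\<^esub> \<in> Z2s p L"
    using Z2 star_property_zero_iff[of "restrict (\<lambda>_. 0) (carrier L)"] submodule_Hom_Fr
    by (auto simp: Z2s_mem_iff direct_sum_def funs_simps submodule_def)
next
  let ?D = "direct_sum (funs (carrier L \<times> carrier L)) (funs (carrier L))"
  fix v w assume "v \<in> Z2s p L" "w \<in> Z2s p L"
  then show "v \<oplus>\<^bsub>?D\<^esub> w \<in> Z2s p L"
    using submodule_Z2[unfolded submodule_def funs_simps]
      star_property_combine[of "fst v" "snd v" "fst w" "snd w" 1]
    by (cases v; cases w) (simp add: Z2s_mem_iff direct_sum_def funs_simps)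
next
  let ?D = "direct_sum (funs (carrier L \<times> carrier L)) (funs (carrier L))"
  fix a v assume "v \<in> Z2s p L"
  then show "a \<odot>\<^bsub>?D\<^esub> v \<in> Z2s p L"
    using submodule_Z2[unfolded submodule_def funs_simps]
      star_property_combine[of "fst v" "snd v" "fst v" "snd v" "a - 1"]
    by (cases v) (simp add: Z2s_mem_iff direct_sum_def funs_simps algebra_simps)
qed

lemma submodule_B2s:
  "submodule class_ring (B2s L) (direct_sum (funs (carrier L \<times> carrier L)) (funs (carrier L)))"
proof -
  have "Module.module class_ring (direct_sum (funs (carrier L \<times> carrier L)) (funs (carrier L)) :: ('a, _) module)"
    by (intro direct_sum_is_module class_cring.func_space_is_module)
  then show ?thesis
    using submodule_B2 by (auto simp: submodule_def B2s_eq direct_sum_def funs_simps fun_eq_iff)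
qed

lemma B2s_subset_Z2s: "B2s L \<subseteq> Z2s p L"
proof
  fix z assume "z \<in> B2s L"
  then obtain \<psi> where \<psi>: "\<psi> \<in> carrier (C1 L)" "z = d1s L \<psi>" by (auto simp: B2s_def)
  then have "d1 L \<psi> \<in> Z2 L" using B2_subset_Z2 by (auto simp: B2_def)
  then show "z \<in> Z2s p L"
    using \<psi> star_property_d1s by (simp add: d1s_def Z2s_mem_iff ind1_def)
qed

lemma subspace_B2s: "subspace class_ring (B2s L) ((C2s p L)\<lparr>carrier := Z2s p L\<rparr>)"
  unfolding C2s_carrier_update
  by (intro subspace_carrier_update direct_sum_is_vs vectorspace_funs submodule_Z2s submodule_B2s
      B2s_subset_Z2s)

text \<open>A coset is formed with the addition alone, so it does not see the change of carrier that
  separates \<open>class2\<close> from the cosets making up \<open>H2\<close>.\<close>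

lemma class2_coset: "class2 L \<phi> = B2 L +>\<^bsub>(C2 L)\<lparr>carrier := Z2 L\<rparr>\<^esub> \<phi>"
  by (simp add: class2_def a_r_coset_def')

lemma class2s_coset: "class2s p L z = B2s L +>\<^bsub>(C2s p L)\<lparr>carrier := Z2s p L\<rparr>\<^esub> z"
  by (simp add: class2s_def a_r_coset_def')

lemma linear_map_class2: "linear_map class_ring ((C2 L)\<lparr>carrier := Z2 L\<rparr>) (H2 L) (class2 L)"
  unfolding class2_coset[abs_def] H2_def by (rule subspace.quot_space_linear[OF subspace_B2])

lemma linear_map_class2s:
  "linear_map class_ring ((C2s p L)\<lparr>carrier := Z2s p L\<rparr>) (H2s p L) (class2s p L)"
  unfolding class2s_coset[abs_def] H2s_def by (rule subspace.quot_space_linear[OF subspace_B2s])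

lemma carrier_H2: "carrier (H2 L) = class2 L ` Z2 L"
  unfolding class2_coset[abs_def] H2_def subspace.quot_space_carrier[OF subspace_B2] by simp

lemma carrier_H2s: "carrier (H2s p L) = class2s p L ` Z2s p L"
  unfolding class2s_coset[abs_def] H2s_def subspace.quot_space_carrier[OF subspace_B2s] by simp

lemma class2_eq_iff:
  assumes "\<phi> \<in> Z2 L" "\<phi>' \<in> Z2 L"
  shows "class2 L \<phi> = class2 L \<phi>' \<longleftrightarrow> (\<exists>\<beta>\<in>B2 L. \<phi> = \<beta> \<oplus>\<^bsub>C2 L\<^esub> \<phi>')"
  using subspace.coset_eq_iff_add[OF subspace_B2, of \<phi> \<phi>'] assms unfolding class2_coset by simp

lemma class2s_eq_iff:
  assumes "z \<in> Z2s p L" "w \<in> Z2s p L"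
  shows "class2s p L z = class2s p L w \<longleftrightarrow> (\<exists>b\<in>B2s L. z = b \<oplus>\<^bsub>C2s p L\<^esub> w)"
  using subspace.coset_eq_iff_add[OF subspace_B2s, of z w] assms unfolding class2s_coset by simp

lemma vectorspace_H2s: "vectorspace class_ring (H2s p L)"
  using linear_map_class2s by (simp add: linear_map_def)

lemma zero_mem_Z2: "restrict (\<lambda>_. 0) (carrier L \<times> carrier L) \<in> Z2 L"
  using submodule_Z2 by (simp add: submodule_def funs_simps)

lemma zero_mem_B2: "restrict (\<lambda>_. 0) (carrier L \<times> carrier L) \<in> B2 L"
  using submodule_B2 by (simp add: submodule_def funs_simps)

lemma Hom_Fr_Z2s:
  assumes "\<omega> \<in> carrier (Hom_Fr p L)"
  shows "(\<zero>\<^bsub>C2 L\<^esub>, \<omega>) \<in> Z2s p L"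
proof -
  have "\<omega> \<in> extensional (carrier L)" using assms by (simp add: Hom_Fr_def)
  then show ?thesis
    using assms zero_mem_Z2 star_property_zero_iff by (simp add: Z2s_mem_iff C2_ops)
qed

lemma linear_map_Fr_incl: "linear_map class_ring (Hom_Fr p L) (H2s p L) (Fr_incl p L)"
proof -
  have "linear_map class_ring (Hom_Fr p L) ((C2s p L)\<lparr>carrier := Z2s p L\<rparr>) (\<lambda>\<omega>. (\<zero>\<^bsub>C2 L\<^esub>, \<omega>))"
    using vectorspace_Hom_Fr linear_map_class2s Hom_Fr_Z2s
    by (intro linear_mapI)
      (auto simp: linear_map_def C2s_ops C2_ops Hom_Fr_ops funs_simps fun_eq_iff)
  from linear_map_comp[OF this linear_map_class2s] show ?thesis
    by (simp add: Fr_incl_def[abs_def])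
qed

text \<open>
  A linear choice \<open>\<tau>\<close> of a map with the \<open>*\<close>-property for every cocycle, trivial on coboundaries,
  splits the sequence: \<open>(\<phi>, \<omega>)\<close> is sent to \<open>([\<phi>], \<omega> - \<tau> \<phi>)\<close>.
\<close>

theorem H2s_split:
  assumes \<tau>_lin: "linear_map class_ring ((C2 L)\<lparr>carrier := Z2 L\<rparr>) (funs (carrier L)) \<tau>"
    and \<tau>_star: "\<And>\<phi>. \<phi> \<in> Z2 L \<Longrightarrow> star_property p L \<phi> (\<tau> \<phi>)"
    and \<tau>_B2: "\<And>\<phi>. \<phi> \<in> B2 L \<Longrightarrow> \<tau> \<phi> = \<zero>\<^bsub>funs (carrier L)\<^esub>"
  shows "\<exists>\<Phi>. linear_map class_ring (H2s p L) (direct_sum (H2 L) (Hom_Fr p L)) \<Phi> \<and>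
    bij_betw \<Phi> (carrier (H2s p L)) (carrier (direct_sum (H2 L) (Hom_Fr p L))) \<and>
    (\<forall>(\<phi>, \<omega>)\<in>Z2s p L. fst (\<Phi> (class2s p L (\<phi>, \<omega>))) = class2 L \<phi>) \<and>
    (\<forall>\<omega>\<in>carrier (Hom_Fr p L). \<Phi> (Fr_incl p L \<omega>) = (\<zero>\<^bsub>H2 L\<^esub>, \<omega>))"
proof -
  let ?X = "carrier L" and ?U = "(C2 L)\<lparr>carrier := Z2 L\<rparr>" and ?V = "(C2s p L)\<lparr>carrier := Z2s p L\<rparr>"
  interpret \<tau>: linear_map class_ring ?U "funs ?X" \<tau> by fact
  interpret c: linear_map class_ring ?U "H2 L" "class2 L" by (rule linear_map_class2)
  have \<tau>_ext: "\<tau> \<phi> \<in> extensional ?X" if "\<phi> \<in> Z2 L" for \<phi>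
    using \<tau>.f_im[of \<phi>] that by (simp add: funs_simps)
  have \<tau>_add: "\<tau> (\<phi> \<oplus>\<^bsub>C2 L\<^esub> \<phi>') = restrict (\<lambda>x. \<tau> \<phi> x + \<tau> \<phi>' x) ?X"
    if "\<phi> \<in> Z2 L" "\<phi>' \<in> Z2 L" for \<phi> \<phi>'
    using \<tau>.f_add[of \<phi> \<phi>'] that by (simp add: funs_simps)
  have \<tau>_smult: "\<tau> (a \<odot>\<^bsub>C2 L\<^esub> \<phi>) = restrict (\<lambda>x. a * \<tau> \<phi> x) ?X" if "\<phi> \<in> Z2 L" for a \<phi>
    using \<tau>.f_smult[of a \<phi>] that by (simp add: funs_simps)
  have c_add: "class2 L (\<phi> \<oplus>\<^bsub>C2 L\<^esub> \<phi>') = class2 L \<phi> \<oplus>\<^bsub>H2 L\<^esub> class2 L \<phi>'"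
    if "\<phi> \<in> Z2 L" "\<phi>' \<in> Z2 L" for \<phi> \<phi>'
    using c.f_add[of \<phi> \<phi>'] that by simp
  have c_smult: "class2 L (a \<odot>\<^bsub>C2 L\<^esub> \<phi>) = a \<odot>\<^bsub>H2 L\<^esub> class2 L \<phi>" if "\<phi> \<in> Z2 L" for a \<phi>
    using c.f_smult[of a \<phi>] that by simp
  have c_zero: "class2 L \<zero>\<^bsub>C2 L\<^esub> = \<zero>\<^bsub>H2 L\<^esub>"
    using c.f0_is_0 by simp
  have c_B2: "class2 L \<phi> = \<zero>\<^bsub>H2 L\<^esub>" if "\<phi> \<in> B2 L" for \<phi>
  proof -
    have ext: "\<phi> \<in> extensional (?X \<times> ?X)"
      using that B2_subset_Z2 by (auto simp: Z2_mem_iff C2_mem_iff)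
    have "class2 L \<phi> = class2 L \<zero>\<^bsub>C2 L\<^esub>"
      using that B2_subset_Z2 zero_mem_Z2 ext
      by (subst class2_eq_iff) (auto simp: C2_ops fun_eq_iff extensional_def intro!: bexI[of _ \<phi>])
    then show ?thesis using c_zero by simp
  qed
  define f where "f = (\<lambda>(\<phi>, \<omega>). (class2 L \<phi>, restrict (\<lambda>x. \<omega> x - \<tau> \<phi> x) ?X))"
  have f_Fr: "restrict (\<lambda>x. \<omega> x - \<tau> \<phi> x) ?X \<in> carrier (Hom_Fr p L)" if "(\<phi>, \<omega>) \<in> Z2s p L" for \<phi> \<omega>
  proof -
    \<comment> \<open>The difference of \<open>(\<phi>, \<omega>)\<close> and
      \<open>(\<phi>, \<tau> \<phi>)\<close> has first component 0, so its second component is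
      Frobenius-semilinear.\<close>
    have "star_property p L (restrict (\<lambda>v. \<phi> v + (- 1) * \<phi> v) (?X \<times> ?X))
        (restrict (\<lambda>v. \<omega> v + (- 1) * \<tau> \<phi> v) ?X)"
      using that \<tau>_star by (intro star_property_combine) (auto simp: Z2s_mem_iff)
    then show ?thesis by (subst star_property_zero_iff[symmetric]) simp_all
  qed
  have f_lin: "linear_map class_ring ?V (direct_sum (H2 L) (Hom_Fr p L)) f"
  proof (rule linear_mapI)
    show "vectorspace class_ring ?V" using linear_map_class2s by (simp add: linear_map_def)
    show "vectorspace class_ring (direct_sum (H2 L) (Hom_Fr p L))"
      by (intro direct_sum_is_vs vectorspace_H2 vectorspace_Hom_Fr)
  next
    fix z assume "z \<in> carrier ?V"
    then show "f z \<in> carrier (direct_sum (H2 L) (Hom_Fr p L))"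
      using f_Fr by (cases z) (auto simp: f_def direct_sum_def carrier_H2 Z2s_mem_iff)
  next
    fix z w assume "z \<in> carrier ?V" "w \<in> carrier ?V"
    then show "f (z \<oplus>\<^bsub>?V\<^esub> w) = f z \<oplus>\<^bsub>direct_sum (H2 L) (Hom_Fr p L)\<^esub> f w"
      by (cases z; cases w) (auto simp: f_def C2s_ops direct_sum_def Z2s_mem_iff c_add \<tau>_add
          Hom_Fr_ops funs_simps fun_eq_iff)
  next
    fix a z assume "z \<in> carrier ?V"
    then show "f (a \<odot>\<^bsub>?V\<^esub> z) = a \<odot>\<^bsub>direct_sum (H2 L) (Hom_Fr p L)\<^esub> f z"
      by (cases z) (auto simp: f_def C2s_ops direct_sum_def Z2s_mem_iff c_smult \<tau>_smult
          Hom_Fr_ops funs_simps fun_eq_iff algebra_simps)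
  qed
  have f_B2s: "f b = \<zero>\<^bsub>direct_sum (H2 L) (Hom_Fr p L)\<^esub>" if "b \<in> B2s L" for b
    using that c_B2 \<tau>_B2 by (auto simp: B2s_eq f_def direct_sum_def Hom_Fr_ops funs_simps fun_eq_iff)
  obtain \<Phi> where \<Phi>: "linear_map class_ring (H2s p L) (direct_sum (H2 L) (Hom_Fr p L)) \<Phi>"
    and \<Phi>_class: "\<And>z. z \<in> Z2s p L \<Longrightarrow> \<Phi> (class2s p L z) = f z"
    using subspace.quot_space_lift[OF subspace_B2s f_lin f_B2s]
    unfolding H2s_def[symmetric] class2s_coset[symmetric] by auto
  have "inj_on \<Phi> (carrier (H2s p L))"
  proof (rule inj_onI)
    fix Y Y' assume "Y \<in> carrier (H2s p L)" "Y' \<in> carrier (H2s p L)" and eq: "\<Phi> Y = \<Phi> Y'"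
    then obtain \<phi> \<omega> \<phi>' \<omega>' where z: "(\<phi>, \<omega>) \<in> Z2s p L" "(\<phi>', \<omega>') \<in> Z2s p L"
      and Y: "Y = class2s p L (\<phi>, \<omega>)" "Y' = class2s p L (\<phi>', \<omega>')"
      unfolding carrier_H2s by force
    note z' = z[unfolded Z2s_mem_iff]
    have "class2 L \<phi> = class2 L \<phi>'"
      and \<omega>: "restrict (\<lambda>x. \<omega> x - \<tau> \<phi> x) ?X = restrict (\<lambda>x. \<omega>' x - \<tau> \<phi>' x) ?X"
      using eq z by (auto simp: Y \<Phi>_class f_def)
    then obtain \<beta> where \<beta>: "\<beta> \<in> B2 L" "\<phi> = \<beta> \<oplus>\<^bsub>C2 L\<^esub> \<phi>'"
      using class2_eq_iff z' by blast
    \<comment> \<open>Changing \<phi> by the coboundary \<beta> leaves \<tau> \<phi> unchanged, so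
      equality of the differences forces \<open>\<omega> = \<omega>'\<close>.\<close>
    have "\<tau> \<phi> = restrict (\<lambda>x. \<tau> \<beta> x + \<tau> \<phi>' x) ?X"
      unfolding \<beta>(2) using \<beta>(1) z' B2_subset_Z2 by (intro \<tau>_add) auto
    then have "\<omega> x = \<omega>' x" if "x \<in> ?X" for x
      using \<omega> that \<tau>_B2[OF \<beta>(1)] by (auto simp: restrict_eq_restrict_iff zero_funs)
    then have "\<omega> = \<omega>'" using z' by (meson extensionalityI)
    moreover have "restrict (\<lambda>x. 0 + \<omega>' x) ?X = \<omega>'" using z' by (simp add: extensional_restrict)
    ultimately have "(\<phi>, \<omega>) = (\<beta>, restrict (\<lambda>_. 0) ?X) \<oplus>\<^bsub>C2s p L\<^esub> (\<phi>', \<omega>')"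
      using \<beta>(2) by (simp add: C2s_ops add_funs cong: restrict_cong)
    then show "Y = Y'" unfolding Y class2s_eq_iff[OF z] using \<beta>(1) by (auto simp: B2s_eq)
  qed
  moreover have "\<Phi> ` carrier (H2s p L) = carrier (direct_sum (H2 L) (Hom_Fr p L))"
  proof (intro equalityI subsetI)
    fix y assume "y \<in> carrier (direct_sum (H2 L) (Hom_Fr p L))"
    then obtain \<phi> \<eta> where y: "\<phi> \<in> Z2 L" "\<eta> \<in> carrier (Hom_Fr p L)" "y = (class2 L \<phi>, \<eta>)"
      by (auto simp: direct_sum_def carrier_H2)
    \<comment> \<open>The preimage of \<open>([\<phi>], \<eta>)\<close> is the class of
      \<open>(\<phi>, \<tau> \<phi> + \<eta>)\<close>; the factor 1 keeps the shape of
      \<open>star_property_combine\<close>.\<close>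
    let ?\<omega> = "restrict (\<lambda>x. \<tau> \<phi> x + 1 * \<eta> x) ?X"
    have \<eta>: "\<eta> \<in> extensional ?X" using y by (simp add: Hom_Fr_def)
    have "\<phi> \<in> extensional (?X \<times> ?X)" using y by (auto simp: Z2_mem_iff C2_mem_iff)
    then have \<phi>: "restrict (\<lambda>v. \<phi> v + 1 * restrict (\<lambda>_. 0) (?X \<times> ?X) v) (?X \<times> ?X) = \<phi>"
      by (auto simp: fun_eq_iff extensional_def)
    have "star_property p L \<phi> ?\<omega>"
      using star_property_combine[OF \<tau>_star[OF y(1)] star_property_zero_iff[OF \<eta>, THEN iffD2, OF y(2)],
          of 1, unfolded \<phi>] .
    then have z: "(\<phi>, ?\<omega>) \<in> Z2s p L" using y by (simp add: Z2s_mem_iff)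
    have "\<Phi> (class2s p L (\<phi>, ?\<omega>)) = y"
      unfolding \<Phi>_class[OF z] using \<eta> by (auto simp: f_def y fun_eq_iff extensional_def)
    then show "y \<in> \<Phi> ` carrier (H2s p L)" using z carrier_H2s by blast
  next
    fix y assume "y \<in> \<Phi> ` carrier (H2s p L)"
    then show "y \<in> carrier (direct_sum (H2 L) (Hom_Fr p L))"
      using mod_hom.f_im[OF linear_map.axioms(3)[OF \<Phi>]] by auto
  qed
  moreover have "fst (\<Phi> (class2s p L (\<phi>, \<omega>))) = class2 L \<phi>" if "(\<phi>, \<omega>) \<in> Z2s p L" for \<phi> \<omega>
    using \<Phi>_class[OF that] by (simp add: f_def)
  moreover have "\<Phi> (Fr_incl p L \<omega>) = (\<zero>\<^bsub>H2 L\<^esub>, \<omega>)" if "\<omega> \<in> carrier (Hom_Fr p L)" for \<omega>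
  proof -
    have "\<tau> \<zero>\<^bsub>C2 L\<^esub> = restrict (\<lambda>_. 0) ?X" using \<tau>_B2[OF zero_mem_B2] by (simp add: C2_ops funs_simps)
    moreover have "\<omega> \<in> extensional ?X" using that by (simp add: Hom_Fr_def)
    ultimately show ?thesis
      unfolding Fr_incl_def \<Phi>_class[OF Hom_Fr_Z2s[OF that]]
      by (auto simp: f_def c_zero fun_eq_iff extensional_def)
  qed
  ultimately show ?thesis using \<Phi> unfolding bij_betw_def by blast
qed

end

section \<open>Sums over formal sequences\<close>

lemma sum_lists_Suc:
  fixes F :: "bool list \<Rightarrow> 'b::comm_monoid_add"
  shows "(\<Sum>t | length t = Suc n. F t) = (\<Sum>t | length t = n. F (True # t)) + (\<Sum>t | length t = n. F (False # t))"
proof -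
  have fin: "finite {t :: bool list. length t = n}"
    using finite_lists_length_eq[of "UNIV :: bool set" n] by simp
  have "{t :: bool list. length t = Suc n} =
      (#) True ` {t. length t = n} \<union> (#) False ` {t. length t = n}"
    by (auto simp: length_Suc_conv)
  then have "(\<Sum>t | length t = Suc n. F t) =
      sum F ((#) True ` {t. length t = n}) + sum F ((#) False ` {t. length t = n})"
    using fin by (simp, subst sum.union_disjoint) auto
  then show ?thesis by (simp add: sum.reindex)
qed

text \<open>The last letter of a formal sequence becomes the second argument of \<phi>, so words
  have to be split at the end. The induction still peels the first letter, where lists are
  built.\<close>

lemma sum_lists_snoc:
  fixes F :: "bool list \<Rightarrow> 'b::comm_monoid_add"
  shows "(\<Sum>t | length t = Suc n. F t) =
    (\<Sum>t | length t = n. F (t @ [True])) + (\<Sum>t | length t = n. F (t @ [False]))"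
proof (induction n arbitrary: F)
  case 0
  have "{t :: bool list. length t = Suc 0} = {[True], [False]}"
    by (auto simp: length_Suc_conv)
  then show ?case by simp
next
  case (Suc n)
  have "(\<Sum>t | length t = Suc (Suc n). F t) =
      (\<Sum>t | length t = Suc n. F (True # t)) + (\<Sum>t | length t = Suc n. F (False # t))"
    by (rule sum_lists_Suc)
  also have "\<dots> = (\<Sum>t | length t = n. F (True # t @ [True])) + (\<Sum>t | length t = n. F (True # t @ [False])) +
      ((\<Sum>t | length t = n. F (False # t @ [True])) + (\<Sum>t | length t = n. F (False # t @ [False])))"
    by (simp only: Suc.IH)
  also have "\<dots> = (\<Sum>t | length t = Suc n. F (t @ [True])) + (\<Sum>t | length t = Suc n. F (t @ [False]))"
    by (simp add: sum_lists_Suc add.assoc add.left_commute)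
  finally show ?case .
qed

text \<open>Words are grouped by their number of letters \<open>True\<close>. The weight
  \<open>f\<close> stays arbitrary because a leading \<open>True\<close> shifts its argument by one;
  Pascal's rule then combines the two halves. Later \<open>f\<close> is the factor
  \<open>1/#(g)\<close>.\<close>

lemma sum_lists_binomial:
  fixes a b :: "'b::comm_semiring_1"
  shows "(\<Sum>t | length t = n. f (count_list t True) * prod_list (map (\<lambda>c. if c then a else b) t)) =
    (\<Sum>k\<le>n. of_nat (n choose k) * f k * a ^ k * b ^ (n - k))"
proof (induction n arbitrary: f)
  case 0
  then show ?case by simp
next
  case (Suc n)
  let ?c = "\<lambda>k. of_nat (n choose k) :: 'b"
  have "(\<Sum>t | length t = Suc n. f (count_list t True) * prod_list (map (\<lambda>c. if c then a else b) t)) =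
      a * (\<Sum>t | length t = n. f (Suc (count_list t True)) * prod_list (map (\<lambda>c. if c then a else b) t)) +
      b * (\<Sum>t | length t = n. f (count_list t True) * prod_list (map (\<lambda>c. if c then a else b) t))"
    by (simp add: sum_lists_Suc sum_distrib_left algebra_simps)
  also have "\<dots> = a * (\<Sum>k\<le>n. ?c k * f (Suc k) * a ^ k * b ^ (n - k)) +
      b * (\<Sum>k\<le>n. ?c k * f k * a ^ k * b ^ (n - k))"
    using Suc.IH[of "\<lambda>k. f (Suc k)"] Suc.IH[of f] by simp
  also have "a * (\<Sum>k\<le>n. ?c k * f (Suc k) * a ^ k * b ^ (n - k)) =
      (\<Sum>k\<le>n. ?c k * f (Suc k) * a ^ Suc k * b ^ (n - k))"
    by (simp add: sum_distrib_left algebra_simps)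
  also have "b * (\<Sum>k\<le>n. ?c k * f k * a ^ k * b ^ (n - k)) =
      (\<Sum>k\<le>n. ?c k * f k * a ^ k * b ^ (Suc n - k))"
    by (auto simp: sum_distrib_left Suc_diff_le algebra_simps intro!: sum.cong)
  also have "\<dots> = (\<Sum>k\<le>Suc n. ?c k * f k * a ^ k * b ^ (Suc n - k))" by (simp add: binomial_eq_0)
  also have "\<dots> = f 0 * b ^ Suc n + (\<Sum>k\<le>n. of_nat (n choose Suc k) * f (Suc k) * a ^ Suc k * b ^ (n - k))"
    by (subst sum.atMost_Suc_shift) simp
  finally have "(\<Sum>t | length t = Suc n. f (count_list t True) * prod_list (map (\<lambda>c. if c then a else b) t)) =
      f 0 * b ^ Suc n +
      ((\<Sum>k\<le>n. ?c k * f (Suc k) * a ^ Suc k * b ^ (n - k)) +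
       (\<Sum>k\<le>n. of_nat (n choose Suc k) * f (Suc k) * a ^ Suc k * b ^ (n - k)))"
    by (simp only: add.left_commute)
  also have "\<dots> = f 0 * b ^ Suc n + (\<Sum>k\<le>n. of_nat (Suc n choose Suc k) * f (Suc k) * a ^ Suc k * b ^ (n - k))"
    unfolding sum.distrib[symmetric] by (simp add: distrib_right)
  also have "\<dots> = (\<Sum>k\<le>Suc n. of_nat (Suc n choose k) * f k * a ^ k * b ^ (Suc n - k))"
    by (subst sum.atMost_Suc_shift) simp
  finally show ?case .
qed

lemma formal_seqs_eq: "p \<ge> 2 \<Longrightarrow> formal_seqs p = (\<lambda>t. True # False # t) ` {t. length t = p - 2}"
proof (intro equalityI subsetI)
  fix s assume "p \<ge> 2" "s \<in> formal_seqs p"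
  then show "s \<in> (\<lambda>t. True # False # t) ` {t. length t = p - 2}"
    by (cases s; cases "tl s") (auto simp: formal_seqs_def)
qed (auto simp: formal_seqs_def)

section \<open>Binomial sums in characteristic \<open>p\<close>\<close>

context
  fixes p :: nat and a b :: "'a::field"
  assumes p: "prime p" "CHAR('a) = p"
begin

lemma of_nat_neq_0_char: "0 < k \<Longrightarrow> k < p \<Longrightarrow> (of_nat k :: 'a) \<noteq> 0"
  using p(2) by (auto simp: of_nat_eq_0_iff_char_dvd dest: dvd_imp_le)

lemma of_nat_p_minus: "k \<le> p \<Longrightarrow> (of_nat (p - k) :: 'a) = - of_nat k"
  using of_nat_CHAR[where 'a = 'a] unfolding p(2) by (simp add: of_nat_diff)

text \<open>\<open>binom (m-1) k / (k+1) = binom m (k+1) / m\<close>.\<close>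

lemma sum_binomial_div_Suc:
  assumes m: "0 < m" "m < p"
  shows "a * (\<Sum>k\<le>m-1. of_nat (m - 1 choose k) * (1 / of_nat (Suc k)) * a ^ k * b ^ (m - 1 - k)) =
    ((a + b) ^ m - b ^ m) / of_nat m"
proof -
  have "of_nat (m - 1 choose k) * (1 / of_nat (Suc k)) = (of_nat (m choose Suc k) / of_nat m :: 'a)"
    if "k \<le> m - 1" for k
  proof -
    have "Suc (m - 1) * (m - 1 choose k) = (Suc (m - 1) choose Suc k) * Suc k"
      by (rule Suc_times_binomial_eq)
    then have "of_nat m * of_nat (m - 1 choose k) = (of_nat (m choose Suc k) * of_nat (Suc k) :: 'a)"
      using m by (metis Suc_pred' of_nat_mult)
    then show ?thesis
      using m that of_nat_neq_0_char[of m] of_nat_neq_0_char[of "Suc k"] by (simp add: field_simps del: of_nat_Suc)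
  qed
  then have "a * (\<Sum>k\<le>m-1. of_nat (m - 1 choose k) * (1 / of_nat (Suc k)) * a ^ k * b ^ (m - 1 - k)) =
      (\<Sum>k\<le>m-1. of_nat (m choose Suc k) * a ^ Suc k * b ^ (m - Suc k)) / of_nat m"
    unfolding sum_distrib_left sum_divide_distrib by (intro sum.cong) simp_all
  also have "(\<Sum>k\<le>m-1. of_nat (m choose Suc k) * a ^ Suc k * b ^ (m - Suc k)) = (a + b) ^ m - b ^ m"
    using sum.atMost_Suc_shift[of "\<lambda>k. of_nat (m choose k) * a ^ k * b ^ (m - k)" "m - 1"] m
    by (simp add: binomial_ring)
  finally show ?thesis .
qed

text \<open>In characteristic \<open>p\<close>, \<open>p - m + k = - (m - k)\<close> and \<open>binom (m-1) k / (m-k) = binom m k / m\<close>.\<close>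

lemma sum_binomial_div_complement:
  assumes m: "0 < m" "m < p"
  shows "b * (\<Sum>k\<le>m-1. of_nat (m - 1 choose k) * (1 / of_nat (p - m + k)) * a ^ k * b ^ (m - 1 - k)) =
    - ((a + b) ^ m - a ^ m) / of_nat m"
proof -
  have eq: "of_nat (m - 1 choose k) * (1 / of_nat (p - m + k)) = (- of_nat (m choose k) / of_nat m :: 'a)"
    if "k \<le> m - 1" for k
  proof -
    have "(m - k) * (m choose k) = m * (m - 1 choose k)"
      using binomial_absorb_comp by blast
    then have "of_nat (m - k) * of_nat (m choose k) = (of_nat m * of_nat (m - 1 choose k) :: 'a)"
      by (simp flip: of_nat_mult)
    moreover have "(of_nat (p - m + k) :: 'a) = - of_nat (m - k)"
      using of_nat_p_minus[of "m - k"] that m by simp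
    ultimately show ?thesis
      using m that of_nat_neq_0_char[of m] of_nat_neq_0_char[of "m - k"] by (simp add: field_simps del: of_nat_diff)
  qed
  then have "b * (\<Sum>k\<le>m-1. of_nat (m - 1 choose k) * (1 / of_nat (p - m + k)) * a ^ k * b ^ (m - 1 - k)) =
      (\<Sum>k\<le>m-1. - of_nat (m choose k) / of_nat m * a ^ k * b ^ (m - k))"
    unfolding sum_distrib_left
  proof (intro sum.cong refl)
    fix k assume "k \<in> {..m-1}"
    moreover from this m have "m - k = Suc (m - 1 - k)" by auto
    then have "b ^ (m - k) = b * b ^ (m - 1 - k)" by (metis power_Suc)
    ultimately show "b * (of_nat (m - 1 choose k) * (1 / of_nat (p - m + k)) * a ^ k * b ^ (m - 1 - k)) =
        - of_nat (m choose k) / of_nat m * a ^ k * b ^ (m - k)"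
      using eq[of k] by (metis atMost_iff mult.assoc mult.left_commute)
  qed
  also have "\<dots> = - (\<Sum>k\<le>m-1. of_nat (m choose k) * a ^ k * b ^ (m - k)) / of_nat m"
    by (simp add: sum_divide_distrib sum_negf[symmetric])
  also have "(\<Sum>k\<le>m-1. of_nat (m choose k) * a ^ k * b ^ (m - k)) = (a + b) ^ m - a ^ m"
    using sum.atMost_Suc[of "\<lambda>k. of_nat (m choose k) * a ^ k * b ^ (m - k)" "m - 1"] m
    by (simp add: binomial_ring)
  finally show ?thesis .
qed

lemma add_power_char: "(a + b) ^ p = a ^ p + b ^ p"
  by (rule freshmans_dream) (simp_all only: p)

section \<open>Odd characteristic: closed forms of the sums with denominators\<close>

context
  assumes p_ge_3: "p \<ge> 3"
begin

text \<open>The sum over the free letters, where \<open>j\<close> counts the occurrences of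
  \<open>g\<close> outside them and \<open>a\<close>, \<open>b\<close> stand for the first
  coordinates of \<open>g\<close> and \<open>h\<close>. For \<open>n = p - 2\<close> the last letter
  is among the free ones and \<open>j = 1\<close>; for \<open>n = p - 3\<close> it is removed, and
  \<open>j\<close> is 2 if it was \<open>g\<close> and 1 otherwise.\<close>

definition seq_sum :: "nat \<Rightarrow> nat \<Rightarrow> 'a" where
  "seq_sum j n = (\<Sum>t | length t = n.
    1 / of_nat (count_list t True + j) * prod_list (map (\<lambda>c. if c then a else b) t))"

lemma seq_sum_binomial:
  "seq_sum j n = (\<Sum>k\<le>n. of_nat (n choose k) * (1 / of_nat (k + j)) * a ^ k * b ^ (n - k))"
  unfolding seq_sum_def by (rule sum_lists_binomial)

lemma two_neq_0: "(2 :: 'a) \<noteq> 0"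
  using of_nat_neq_0_char[of 2] p_ge_3 by simp

text \<open>For \<open>m = p - 1\<close> the denominators \<open>k + 1\<close> and
  \<open>p - m + k\<close> coincide, so one and the same sum has a closed form after multiplication
  by \<open>a\<close> and another after multiplication by \<open>b\<close>. Here
  \<open>1/m = - 1\<close>.\<close>

lemma seq_sum_1_a: "a * seq_sum 1 (p - 2) = b ^ (p - 1) - (a + b) ^ (p - 1)"
  using sum_binomial_div_Suc[of "p - 1"] p_ge_3 of_nat_p_minus[of 1]
  by (simp add: seq_sum_binomial numeral_2_eq_2 numeral_3_eq_3 add.commute)

lemma seq_sum_1_b: "b * seq_sum 1 (p - 2) = (a + b) ^ (p - 1) - a ^ (p - 1)"
  using sum_binomial_div_complement[of "p - 1"] p_ge_3 of_nat_p_minus[of 1]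
  by (simp add: seq_sum_binomial numeral_2_eq_2 numeral_3_eq_3 add.commute)

text \<open>For \<open>m = p - 2\<close> the two denominators are \<open>k + 1\<close> and
  \<open>k + 2\<close>, so the sum with \<open>j = 1\<close> is obtained with the multiplier
  \<open>a\<close> and the sum with \<open>j = 2\<close> with the multiplier \<open>b\<close>. Here
  \<open>1/m = - 1/2\<close>.\<close>

lemma seq_sum_3_a: "a * seq_sum 1 (p - 3) = (b ^ (p - 2) - (a + b) ^ (p - 2)) / 2"
  using sum_binomial_div_Suc[of "p - 2"] p_ge_3 of_nat_p_minus[of 2] two_neq_0
  by (simp add: seq_sum_binomial numeral_3_eq_3 add.commute field_simps)

lemma seq_sum_3_b: "b * seq_sum 2 (p - 3) = ((a + b) ^ (p - 2) - a ^ (p - 2)) / 2"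
  using sum_binomial_div_complement[of "p - 2"] p_ge_3 of_nat_p_minus[of 2] two_neq_0
  by (simp add: seq_sum_binomial numeral_3_eq_3 add.commute field_simps)

text \<open>Multiplied by \<open>a * b\<close>, the left side is expressed by the two preceding
  closed forms. Cancelling \<open>a * b\<close> leaves the cases \<open>a = 0\<close> and
  \<open>b = 0\<close>, where a single term of the relevant sum survives.\<close>

lemma seq_sum_3_ab: "a * seq_sum 2 (p - 3) - b * seq_sum 1 (p - 3) = - ((a + b) ^ (p - 2))"
proof -
  consider "a = 0" | "b = 0" | "a * b \<noteq> 0" by auto
  then show ?thesis
  proof cases
    case 1
    then have "seq_sum 1 (p - 3) = b ^ (p - 3)"
      unfolding seq_sum_binomial by (subst sum.remove[of _ 0]) (auto intro!: sum.neutral)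
    then show ?thesis using 1 p_ge_3 by (simp add: power_eq_if[of b "p - 2"] numeral_3_eq_3)
  next
    case 2
    \<comment> \<open>Only \<open>k = p - 3\<close> survives; its denominator
      \<open>(p - 3) + 2\<close> is -1 in the field.\<close>
    have "seq_sum 2 (p - 3) = a ^ (p - 3) / of_nat (p - 1)"
      unfolding seq_sum_binomial using 2 p_ge_3 by (subst sum.remove[of _ "p - 3"]) (auto intro!: sum.neutral)
    then have "seq_sum 2 (p - 3) = - (a ^ (p - 3))"
      using of_nat_p_minus[of 1] p_ge_3 by simp
    then show ?thesis using 2 p_ge_3 by (simp add: power_eq_if[of a "p - 2"] numeral_3_eq_3)
  next
    case 3
    let ?P = "(a + b) ^ (p - 2)"
    have pow: "x ^ p = x\<^sup>2 * x ^ (p - 2)" for x :: 'a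
    proof -
      have "p = 2 + (p - 2)" using p_ge_3 by simp
      then show ?thesis by (metis power_add)
    qed
    \<comment> \<open>The powers \<open>a^p + b^p\<close> that appear equal
      \<open>(a + b)^p\<close>, so \<open>(a^2 + b^2) - (a + b)^2 = - 2 a b\<close> is all that
      remains in front of \<open>?P\<close>.\<close>
    have "a * b * (a * seq_sum 2 (p - 3) - b * seq_sum 1 (p - 3)) =
        a\<^sup>2 * (b * seq_sum 2 (p - 3)) - b\<^sup>2 * (a * seq_sum 1 (p - 3))"
      by (simp add: power2_eq_square algebra_simps)
    also have "\<dots> = ((a\<^sup>2 + b\<^sup>2) * ?P - (a\<^sup>2 * a ^ (p - 2) + b\<^sup>2 * b ^ (p - 2))) / 2"
      unfolding seq_sum_3_a seq_sum_3_b by (simp add: algebra_simps add_divide_distrib diff_divide_distrib)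
    also have "a\<^sup>2 * a ^ (p - 2) + b\<^sup>2 * b ^ (p - 2) = (a + b)\<^sup>2 * ?P"
      using add_power_char unfolding pow by simp
    also have "(a\<^sup>2 + b\<^sup>2) * ?P - (a + b)\<^sup>2 * ?P = 2 * (a * b * (- ?P))"
      by (simp add: algebra_simps power2_eq_square)
    also have "\<dots> / 2 = a * b * (- ?P)" using two_neq_0 by simp
    finally show ?thesis using 3 by (metis mult_left_cancel)
  qed
qed

lemma seq_sum_Suc: "seq_sum j (Suc n) = a * seq_sum (Suc j) n + b * seq_sum j n"
  unfolding seq_sum_def sum_lists_snoc by (simp add: sum_distrib_left algebra_simps)

text \<open>Here \<open>a, c\<close> and \<open>b, d\<close> are the first two coordinates of
  \<open>g\<close> and of \<open>h\<close>, and \<mu>, \<nu> are the values of \<phi> at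
  \<open>(e_p, e_1)\<close> and \<open>(e_p, e_2)\<close>. The right side is the additivity defect
  of the map in \<open>star_section\<close>.\<close>

lemma star_sum_identity:
  "(\<Sum>t | length t = p - 2. 1 / of_nat (count_list t True + 1) *
      ((a * d - b * c) * prod_list (map (\<lambda>e. if e then a else b) (butlast t)) *
        (if last t then \<mu> * a + \<nu> * c else \<mu> * b + \<nu> * d))) =
    - \<mu> * ((a + b) ^ (p - 1) * (c + d) - a ^ (p - 1) * c - b ^ (p - 1) * d)
    - \<nu> / 2 * ((a + b) ^ (p - 2) * (c + d)\<^sup>2 - a ^ (p - 2) * c\<^sup>2 - b ^ (p - 2) * d\<^sup>2)"
proof -
  let ?D = "a * d - b * c" and ?T1 = "seq_sum 1 (p - 3)" and ?T2 = "seq_sum 2 (p - 3)"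
  have len: "p - 2 = Suc (p - 3)" using p_ge_3 by simp
  have R: "seq_sum 1 (p - 2) = a * ?T2 + b * ?T1"
    unfolding len seq_sum_Suc by (simp add: numeral_2_eq_2)
  have "(\<Sum>t | length t = p - 2. 1 / of_nat (count_list t True + 1) *
      (?D * prod_list (map (\<lambda>e. if e then a else b) (butlast t)) *
        (if last t then \<mu> * a + \<nu> * c else \<mu> * b + \<nu> * d))) =
      ?D * (\<mu> * a + \<nu> * c) * ?T2 + ?D * (\<mu> * b + \<nu> * d) * ?T1"
    unfolding len sum_lists_snoc seq_sum_def sum_distrib_left
    by (intro arg_cong2[of _ _ _ _ "(+)"] sum.cong) (simp_all add: numeral_2_eq_2)
  \<comment> \<open>Regrouped so that the sums occur only in combinations with a closed form; in
    particular \<open>(a * d - b * c) * seq_sum 1 (p - 2)\<close> is split into its multiples by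
    \<open>a\<close> and by \<open>b\<close>.\<close>
  also have "\<dots> = \<mu> * (d * (a * seq_sum 1 (p - 2)) - c * (b * seq_sum 1 (p - 2))) +
      \<nu> * (c * d * (a * ?T2 - b * ?T1) + d\<^sup>2 * (a * ?T1) - c\<^sup>2 * (b * ?T2))"
    unfolding R by (simp add: power2_eq_square algebra_simps)
  also have "\<dots> = - \<mu> * ((a + b) ^ (p - 1) * (c + d) - a ^ (p - 1) * c - b ^ (p - 1) * d)
    - \<nu> / 2 * ((a + b) ^ (p - 2) * (c + d)\<^sup>2 - a ^ (p - 2) * c\<^sup>2 - b ^ (p - 2) * d\<^sup>2)"
  proof -
    define h where "h = (1 / 2 :: 'a)"
    have h: "2 * h = 1" "x / 2 = h * x" for x using two_neq_0 by (simp_all add: h_def)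
    have eq: "c * d * (- x) + d\<^sup>2 * (h * (z - x)) - c\<^sup>2 * (h * (x - y)) =
        - h * (x * (c + d)\<^sup>2 - y * c\<^sup>2 - z * d\<^sup>2)" for x y z
    proof -
      \<comment> \<open>Inserting \<open>2 * h = 1\<close> into the cross term completes the square
        \<open>(c + d)^2\<close>.\<close>
      have "c * d * (- x) = - (2 * h) * (c * d * x)" by (simp add: h)
      then show ?thesis by (simp add: power2_eq_square algebra_simps)
    qed
    show ?thesis
      unfolding seq_sum_1_a seq_sum_1_b seq_sum_3_a seq_sum_3_b seq_sum_3_ab h(2) eq
      by (simp add: algebra_simps)
  qed
  finally show ?thesis .
qed

end

end

section \<open>The algebra \<open>m\<^sub>0\<^sup>0(p)\<close>\<close>

lemma m00_simps:
  "carrier (m00 p) = extensional {1..p}"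
  "\<zero>\<^bsub>m00 p\<^esub> = restrict (\<lambda>_. 0) {1..p}"
  "x \<oplus>\<^bsub>m00 p\<^esub> y = restrict (\<lambda>n. x n + y n) {1..p}"
  "a \<odot>\<^bsub>m00 p\<^esub> x = restrict (\<lambda>n. a * x n) {1..p}"
  "pmap (m00 p) x = restrict (\<lambda>_. 0) {1..p}"
  by (simp_all add: m00_def module.extend_def funs_simps)

text \<open>The vector \<open>e_n\<close> arises only from \<open>e_1\<close> and
  \<open>e_(n-1)\<close> with \<open>n \<ge> 3\<close>, so a bracket has no components along
  \<open>e_1\<close> and \<open>e_2\<close>. In this form the later computations are
  coordinatewise.\<close>

lemma m00_br:
  "lie_br (m00 p) x y =
    restrict (\<lambda>n. if 3 \<le> n then x 1 * y (n - 1) - x (n - 1) * y 1 else 0) {1..p}"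
proof -
  have "(\<Sum>i = 1..p. \<Sum>j = 1..p. x i * y j * m00_coeff p i j n) =
      (if 3 \<le> n then x 1 * y (n - 1) - x (n - 1) * y 1 else 0)" if n: "n \<in> {1..p}" for n
  proof -
    have "x i * y j * m00_coeff p i j n = (if i = 1 then if j = n - 1 then if 3 \<le> n then x 1 * y (n - 1) else 0 else 0 else 0)
        - (if i = n - 1 then if j = 1 then if 3 \<le> n then x (n - 1) * y 1 else 0 else 0 else 0)"
      if "i \<in> {1..p}" "j \<in> {1..p}" for i j
      using that n by (auto simp: m00_coeff_def)
    then have "(\<Sum>i = 1..p. \<Sum>j = 1..p. x i * y j * m00_coeff p i j n) =
        (\<Sum>i = 1..p. \<Sum>j = 1..p. (if i = 1 then if j = n - 1 then if 3 \<le> n then x 1 * y (n - 1) else 0 else 0 else 0)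
        - (if i = n - 1 then if j = 1 then if 3 \<le> n then x (n - 1) * y 1 else 0 else 0 else 0))"
      by (intro sum.cong refl) blast
    also have "\<dots> = (\<Sum>i = 1..p. if i = 1 then if 3 \<le> n then x 1 * y (n - 1) else 0 else 0) -
       (\<Sum>i = 1..p. if i = n - 1 then if 3 \<le> n then x (n - 1) * y 1 else 0 else 0)"
      unfolding sum_subtractf using n
      by (intro arg_cong2[of _ _ _ _ "(-)"] sum.cong refl) (auto simp: sum.delta)
    also have "\<dots> = (if 3 \<le> n then x 1 * y (n - 1) - x (n - 1) * y 1 else 0)"
      using n by (auto simp: sum.delta)
    finally show ?thesis .
  qed
  then show ?thesis
    by (simp add: m00_def module.extend_def cong: restrict_cong)
qed

lemma m00_br_apply:
  "n \<in> {1..p} \<Longrightarrow> lie_br (m00 p) x y n = (if 3 \<le> n then x 1 * y (n - 1) - x (n - 1) * y 1 else 0)"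
  by (simp add: m00_br)

lemma m00_br_extensional: "lie_br (m00 p) x y \<in> extensional {1..p}"
  by (simp only: m00_br restrict_extensional)

text \<open>If \<open>y\<close> has no \<open>e_1\<close> component, bracketing on the right with
  \<open>x\<close> is minus \<open>x 1\<close> times the shift of \<open>e_i\<close> to
  \<open>e_(i+1)\<close>. The bound \<open>length xs + 2\<close> reflects that such a
  \<open>y\<close> starts at \<open>e_2\<close> at the earliest.\<close>

lemma foldl_m00:
  assumes "y 1 = 0" "n \<in> {1..p}"
  shows "foldl (lie_br (m00 p)) y xs n = (if xs = [] then y n else
    if length xs + 2 \<le> n then (- 1) ^ length xs * prod_list (map (\<lambda>x. x 1) xs) * y (n - length xs) else 0)"
  using assms
proof (induction xs arbitrary: y)
  case Nil
  then show ?case by simp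
next
  case (Cons x xs)
  have 1: "lie_br (m00 p) y x 1 = 0" using Cons.prems by (simp add: m00_br)
  have len: "length xs + 2 \<le> n \<Longrightarrow> n - length xs \<in> {1..p}" using Cons.prems by auto
  show ?case
    using Cons.IH[of "lie_br (m00 p) y x", OF 1 Cons.prems(2)] Cons.prems len by (auto simp: m00_br_apply numeral_3_eq_3)
qed

text \<open>Each further bracket clears one more coordinate, since coordinate \<open>n\<close> of
  \<open>[x, z]\<close> involves only the coordinates 1 and \<open>n - 1\<close> of
  \<open>z\<close>. For \<open>m + 1 = p\<close> all coordinates are cleared, as
  \<open>ad_pmap\<close> requires of a zero [p]-operator.\<close>

lemma funpow_br_m00:
  assumes "n \<in> {1..p}" "n \<le> m + 2"
  shows "(lie_br (m00 p) x ^^ Suc m) y n = 0"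
  using assms
proof (induction m arbitrary: n)
  case 0
  then show ?case by (simp add: m00_br)
next
  case (Suc m)
  have "(lie_br (m00 p) x ^^ Suc (Suc m)) y n = lie_br (m00 p) x ((lie_br (m00 p) x ^^ Suc m) y) n"
    by simp
  moreover have "(lie_br (m00 p) x ^^ Suc m) y 1 = 0" using Suc by (intro Suc.IH) auto
  moreover have "(lie_br (m00 p) x ^^ Suc m) y (n - 1) = 0" if "3 \<le> n" using Suc.prems that by (intro Suc.IH) auto
  ultimately show ?case by (auto simp: m00_br_apply[OF Suc.prems(1)])
qed

text \<open>\<open>[g, h]\<close> lies in the span of \<open>e_3, ..., e_p\<close>, and each of the
  \<open>p - 2\<close> further brackets raises the index by one, which leads past
  \<open>e_p\<close>. Hence Jacobson's sum is zero, as the zero [p]-operator demands.\<close>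

lemma left_normed_fill_m00:
  assumes "prime p" "s \<in> formal_seqs p"
  shows "left_normed (m00 p) (fill g h s) = \<zero>\<^bsub>m00 p\<^esub>"
proof
  fix n
  obtain t where t: "s = True # False # t" "length t = p - 2"
    using formal_seqs_eq[of p] prime_ge_2_nat[OF assms(1)] assms(2) by auto
  let ?y = "lie_br (m00 p) g h"
  have eq: "left_normed (m00 p) (fill g h s) = foldl (lie_br (m00 p)) ?y (fill g h t)"
    by (simp add: left_normed_def t fill_def)
  show "left_normed (m00 p) (fill g h s) n = \<zero>\<^bsub>m00 p\<^esub> n"
  proof (cases "n \<in> {1..p}")
    case True
    have "?y 1 = 0" using prime_ge_2_nat[OF assms(1)] by (simp add: m00_br)
    from foldl_m00[of ?y n p "fill g h t", OF this True] show ?thesis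
      unfolding eq using True t prime_ge_2_nat[OF assms(1)]
      by (auto simp: m00_simps fill_def m00_br)
  next
    case False
    have ext: "foldl (lie_br (m00 p)) ?y xs \<in> extensional {1..p}" for xs
      by (induction xs rule: rev_induct) (simp_all add: m00_br_extensional del: One_nat_def)
    show ?thesis unfolding eq using ext[of "fill g h t"] False by (auto simp: m00_simps extensional_def)
  qed
qed

lemma vectorspace_m00: "vectorspace class_ring (m00 p :: ('a::field, nat \<Rightarrow> 'a) restricted_lie)"
proof -
  have "linear_map class_ring (funs {1..p}) (m00 p :: ('a, nat \<Rightarrow> 'a) restricted_lie) (\<lambda>x. x)"
    by (rule vectorspace_surj_image[OF vectorspace_funs]) (simp_all add: m00_simps funs_simps)
  then show ?thesis by (simp add: linear_map_def)
qed

lemma null_restricted_m00: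
  assumes "prime p" "CHAR('a::field) = p"
  shows "null_restricted_lie_algebra p (m00 p :: ('a, nat \<Rightarrow> 'a) restricted_lie)"
proof -
  let ?L = "m00 p :: ('a, nat \<Rightarrow> 'a) restricted_lie"
  interpret V: vectorspace class_ring ?L by (rule vectorspace_m00)
  have p2: "p \<ge> 2" using assms prime_ge_2_nat by blast
  show ?thesis
  proof (unfold_locales)
    fix x y assume "x \<in> carrier ?L" "y \<in> carrier ?L"
    have "(lie_br ?L x ^^ p) y = restrict (\<lambda>_. 0) {1..p}"
    proof
      fix n
      obtain m where m: "p = Suc m" using p2 by (cases p) auto
      show "(lie_br ?L x ^^ p) y n = restrict (\<lambda>_. 0) {1..p} n"
      proof (cases "n \<in> {1..p}")
        case True
        then show ?thesis using funpow_br_m00[of n p m x y] m by (simp del: funpow.simps)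
      next
        case False
        then show ?thesis
          using extensional_arb[OF m00_br_extensional[of p x "(lie_br ?L x ^^ m) y"]] by (auto simp: m)
      qed
    qed
    then show "lie_br ?L (pmap ?L x) y = (lie_br ?L x ^^ p) y"
      using p2 by (auto simp: m00_simps m00_br fun_eq_iff)
  next
    fix g h assume gh: "g \<in> carrier ?L" "h \<in> carrier ?L"
    have "(\<Oplus>\<^bsub>?L\<^esub>s\<in>formal_seqs p. (1 / of_nat (count_list s True)) \<odot>\<^bsub>?L\<^esub> left_normed ?L (fill g h s)) =
        (\<Oplus>\<^bsub>?L\<^esub>s\<in>formal_seqs p. \<zero>\<^bsub>?L\<^esub>)"
      by (rule V.module.M.finsum_cong') (auto simp: left_normed_fill_m00 assms m00_simps fun_eq_iff)
    then show "pmap ?L (g \<oplus>\<^bsub>?L\<^esub> h) = pmap ?L g \<oplus>\<^bsub>?L\<^esub> pmap ?L h \<oplus>\<^bsub>?L\<^esub>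
        (\<Oplus>\<^bsub>?L\<^esub>s\<in>formal_seqs p. (1 / of_nat (count_list s True)) \<odot>\<^bsub>?L\<^esub> left_normed ?L (fill g h s))"
      by (simp add: m00_simps fun_eq_iff)
  next
    fix x y z assume "x \<in> carrier ?L" "y \<in> carrier ?L" "z \<in> carrier ?L"
    show "lie_br ?L x (lie_br ?L y z) \<oplus>\<^bsub>?L\<^esub> lie_br ?L y (lie_br ?L z x) \<oplus>\<^bsub>?L\<^esub> lie_br ?L z (lie_br ?L x y) = \<zero>\<^bsub>?L\<^esub>"
      using p2 by (auto simp: m00_br m00_simps fun_eq_iff algebra_simps)
  qed (use assms p2 in \<open>auto simp: m00_simps m00_br LinearCombinations.module_hom_def fun_eq_iff algebra_simps\<close>)
qed

section \<open>Cocycles on the algebra and the polynomial section\<close>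

lemma C2_antisym:
  assumes "\<phi> \<in> carrier (C2 L)" "x \<in> carrier L" "y \<in> carrier L" "x \<oplus>\<^bsub>L\<^esub> y \<in> carrier L"
  shows "\<phi> (y, x) = - \<phi> (x, y)"
proof -
  have "\<phi> (x \<oplus>\<^bsub>L\<^esub> y, x \<oplus>\<^bsub>L\<^esub> y) = \<phi> (x, x \<oplus>\<^bsub>L\<^esub> y) + \<phi> (y, x \<oplus>\<^bsub>L\<^esub> y)"
    using assms unfolding C2_mem_iff by blast
  also have "\<dots> = \<phi> (x, y) + \<phi> (y, x)"
    using assms by (simp add: C2_mem_iff)
  finally have "\<phi> (x, y) + \<phi> (y, x) = 0"
    using assms by (simp add: C2_mem_iff)
  then show ?thesis by (simp add: eq_neg_iff_add_eq_0 add.commute)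
qed

lemma bvec_carrier [simp]: "bvec p k \<in> carrier (m00 p)"
  by (simp add: bvec_def m00_simps)

text \<open>
  The part of \<open>x\<close> in the span of \<open>e\<^sub>3, \<dots>, e\<^sub>p\<close> is a bracket \<open>[e\<^sub>1, y]\<close> with \<open>y\<close> commuting with \<open>e\<^sub>p\<close>,
  so the cocycle identity for \<open>(e\<^sub>1, y, e\<^sub>p)\<close> shows that it is \<open>\<phi>\<close>-orthogonal to \<open>e\<^sub>p\<close>.
\<close>

lemma cocycle_top:
  assumes \<phi>: "\<phi> \<in> Z2 (m00 p)" and x: "x \<in> carrier (m00 p)" and p: "p \<ge> 2"
  shows "\<phi> (bvec p p, x) = \<phi> (bvec p p, bvec p 1) * x 1 + \<phi> (bvec p p, bvec p 2) * x 2"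
proof -
  let ?L = "m00 p"
  have C2: "\<phi> \<in> carrier (C2 ?L)" using \<phi> by (simp add: Z2_mem_iff)
  \<comment> \<open>The shifted tail of \<open>x\<close>: \<open>[e_1, y]\<close> is the sum of
    \<open>x n e_n\<close> over \<open>n \<ge> 3\<close>, and since \<open>y 1 = 0\<close> the
    bracket of \<open>y\<close> with \<open>e_p\<close> is zero.\<close>
  define y where "y = restrict (\<lambda>n. if 2 \<le> n \<and> n < p then x (n + 1) else 0) {1..p}"
  have y: "y \<in> carrier ?L" by (simp add: y_def m00_simps)
  have x_eq: "x = (x 1 \<odot>\<^bsub>?L\<^esub> bvec p 1 \<oplus>\<^bsub>?L\<^esub> x 2 \<odot>\<^bsub>?L\<^esub> bvec p 2) \<oplus>\<^bsub>?L\<^esub> lie_br ?L (bvec p 1) y"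
  proof
    fix n
    consider "n = 0 \<or> p < n" | "n = 1" | "n = 2" | "3 \<le> n" "n \<le> p" by linarith
    then show "x n = ((x 1 \<odot>\<^bsub>?L\<^esub> bvec p 1 \<oplus>\<^bsub>?L\<^esub> x 2 \<odot>\<^bsub>?L\<^esub> bvec p 2) \<oplus>\<^bsub>?L\<^esub> lie_br ?L (bvec p 1) y) n"
    proof cases
      case 1
      then show ?thesis using x by (auto simp: m00_simps extensional_def)
    qed (use p in \<open>auto simp: m00_simps m00_br bvec_def y_def\<close>)
  qed
  have br0: "lie_br ?L (bvec p 1) (bvec p p) = \<zero>\<^bsub>?L\<^esub>" "lie_br ?L y (bvec p p) = \<zero>\<^bsub>?L\<^esub>"
    using p by (auto simp: m00_simps m00_br bvec_def y_def fun_eq_iff)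
  have zero: "\<phi> (\<zero>\<^bsub>?L\<^esub>, z) = 0" if "z \<in> carrier ?L" for z
  proof -
    have "\<phi> (0 \<odot>\<^bsub>?L\<^esub> bvec p 1, z) = 0 * \<phi> (bvec p 1, z)"
      using C2 that bvec_carrier unfolding C2_mem_iff by blast
    then show ?thesis by (simp add: m00_simps)
  qed
  have closed: "u \<oplus>\<^bsub>?L\<^esub> v \<in> carrier ?L" "a \<odot>\<^bsub>?L\<^esub> u \<in> carrier ?L" "lie_br ?L u v \<in> carrier ?L"
    for a and u v :: "nat \<Rightarrow> 'a"
    by (simp_all add: m00_simps m00_br)
  have "\<phi> (lie_br ?L (bvec p 1) y, bvec p p) - \<phi> (lie_br ?L (bvec p 1) (bvec p p), y)
      + \<phi> (lie_br ?L y (bvec p p), bvec p 1) = 0"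
    using \<phi> y bvec_carrier unfolding Z2_mem_iff by blast
  then have "\<phi> (lie_br ?L (bvec p 1) y, bvec p p) = 0"
    unfolding br0 using zero y by simp
  then have "\<phi> (bvec p p, lie_br ?L (bvec p 1) y) = 0"
    using C2_antisym[OF C2 closed(3) bvec_carrier closed(1)] by simp
  then show ?thesis
    using C2 closed by (subst x_eq) (simp add: C2_mem_iff mult.commute)
qed

text \<open>
  For \<open>p = 2\<close> the second summand vanishes, because \<open>\<phi> (e\<^sub>2, e\<^sub>2) = 0\<close> (and because \<open>x / 2 = 0\<close>).
\<close>

definition star_section :: "nat \<Rightarrow> ((nat \<Rightarrow> 'a) \<times> (nat \<Rightarrow> 'a) \<Rightarrow> 'a::field) \<Rightarrow> (nat \<Rightarrow> 'a) \<Rightarrow> 'a" where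
  "star_section p \<phi> = restrict (\<lambda>x. - \<phi> (bvec p p, bvec p 1) * (x 1 ^ (p - 1) * x 2)
     - \<phi> (bvec p p, bvec p 2) / 2 * (x 1 ^ (p - 2) * (x 2)\<^sup>2)) (carrier (m00 p))"

text \<open>The factor \<open>g 1 * h 2 - h 1 * g 2\<close> is the \<open>e_3\<close> coordinate of
  \<open>[g, h]\<close>. The \<open>p - 3\<close> further brackets move it to \<open>e_p\<close> and
  push every higher coordinate out; each contributes a sign, and \<open>p - 3\<close> is
  even.\<close>

lemma left_normed_butlast_m00:
  assumes "prime p" "p \<ge> 3" "length t = p - 2"
  shows "left_normed (m00 p) (butlast (fill g h (True # False # t))) =
    ((g 1 * h 2 - h 1 * g 2) * prod_list (map (\<lambda>e. if e then g 1 else h 1) (butlast t))) \<odot>\<^bsub>m00 p\<^esub> bvec p p"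
proof
  fix n
  let ?y = "lie_br (m00 p) g h" and ?u = "fill g h (butlast t)"
  have "t \<noteq> []" using assms by auto
  then have eq: "left_normed (m00 p) (butlast (fill g h (True # False # t))) = foldl (lie_br (m00 p)) ?y ?u"
    by (simp add: left_normed_def fill_def map_butlast)
  have len: "length ?u = p - 3" using assms by (simp add: fill_def)
  have "odd p" using assms prime_odd_nat by auto
  then have sign: "(- 1) ^ (p - 3) = (1 :: 'a)" using assms by simp
  have prod: "prod_list (map (\<lambda>x. x 1) (fill g h u)) = prod_list (map (\<lambda>e. if e then g 1 else h 1) u)" for u
    by (induction u) (auto simp: fill_def)
  show "left_normed (m00 p) (butlast (fill g h (True # False # t))) n =
    (((g 1 * h 2 - h 1 * g 2) * prod_list (map (\<lambda>e. if e then g 1 else h 1) (butlast t))) \<odot>\<^bsub>m00 p\<^esub> bvec p p) n"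
  proof (cases "n \<in> {1..p}")
    case True
    have y: "?y k = (if 3 \<le> k then g 1 * h (k - 1) - g (k - 1) * h 1 else 0)" if "k \<in> {1..p}" for k
      using that by (rule m00_br_apply)
    have y1: "?y 1 = 0" using assms y[of 1] by simp
    have *: "foldl (lie_br (m00 p)) ?y ?u n = (if ?u = [] then ?y n else
        if p - 3 + 2 \<le> n then prod_list (map (\<lambda>x. x 1) ?u) * ?y (n - (p - 3)) else 0)"
      using foldl_m00[of ?y n p ?u, OF y1 True] unfolding len sign by simp
    \<comment> \<open>For \<open>p = 3\<close> no bracket follows \<open>[g, h]\<close>. Otherwise
      coordinate \<open>p\<close> receives the old coordinate 3, coordinate \<open>p - 1\<close> the
      old coordinate 2, which is zero, and the lower ones receive nothing.\<close>
    consider "p = 3" | "p > 3" "n = p" | "p > 3" "n = p - 1" | "p > 3" "n < p - 1"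
      using assms True by fastforce
    then show ?thesis
    proof cases
      case 1
      then have "length t = 1" using assms by simp
      then have "butlast t = []" by (cases t) auto
      then have "?u = []" "butlast t = []" by (simp_all add: fill_def)
      then show ?thesis unfolding eq * using True 1 y[OF True]
        by (auto simp: m00_simps bvec_def numeral_3_eq_3 numeral_2_eq_2 mult.commute)
    next
      case 2
      then have "?u \<noteq> []" using len by auto
      moreover have "?y 3 = g 1 * h 2 - h 1 * g 2" using y[of 3] 2 by (simp add: mult.commute)
      ultimately show ?thesis unfolding eq * prod using True 2
        by (auto simp: m00_simps bvec_def)
    next
      case 3
      then have "?u \<noteq> []" using len by auto
      then show ?thesis unfolding eq * prod using True 3 y[of 2]
        by (auto simp: m00_simps bvec_def)
    next
      case 4
      then have "?u \<noteq> []" using len by auto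
      then show ?thesis unfolding eq * prod using True 4
        by (auto simp: m00_simps bvec_def)
    qed
  next
    case False
    have "foldl (lie_br (m00 p)) ?y xs \<in> extensional {1..p}" for xs
      by (induction xs rule: rev_induct) (simp_all add: m00_br_extensional del: One_nat_def)
    then show ?thesis unfolding eq using False by (auto simp: m00_simps extensional_def)
  qed
qed

text \<open>In dimension 2 an alternating form is a multiple of the determinant; the value at
  \<open>(e_2, e_1)\<close> is singled out because it is the coefficient in
  \<open>star_section\<close>.\<close>

lemma C2_m00_2:
  assumes "\<phi> \<in> carrier (C2 (m00 2))" "g \<in> carrier (m00 2)" "h \<in> carrier (m00 2)"
  shows "\<phi> (g, h) = - (g 1 * h 2 - g 2 * h 1) * \<phi> (bvec 2 2, bvec 2 1)"
proof -
  let ?L = "m00 2"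
  have eq: "x = x 1 \<odot>\<^bsub>?L\<^esub> bvec 2 1 \<oplus>\<^bsub>?L\<^esub> x 2 \<odot>\<^bsub>?L\<^esub> bvec 2 2" if "x \<in> carrier ?L" for x :: "nat \<Rightarrow> 'a"
  proof
    fix n :: nat
    consider "n = 0 \<or> 2 < n" | "n = 1" | "n = 2" by linarith
    then show "x n = (x 1 \<odot>\<^bsub>?L\<^esub> bvec 2 1 \<oplus>\<^bsub>?L\<^esub> x 2 \<odot>\<^bsub>?L\<^esub> bvec 2 2) n"
      using that by cases (auto simp: m00_simps extensional_def bvec_def)
  qed
  have closed: "u \<oplus>\<^bsub>?L\<^esub> v \<in> carrier ?L" "a \<odot>\<^bsub>?L\<^esub> u \<in> carrier ?L"
    for a and u v :: "nat \<Rightarrow> 'a"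
    by (simp_all add: m00_simps)
  have "\<phi> (bvec 2 1, bvec 2 2) = - \<phi> (bvec 2 2, bvec 2 1)"
    using C2_antisym[OF assms(1) bvec_carrier bvec_carrier closed(1)] .
  moreover have "\<phi> (bvec 2 1, bvec 2 1) = 0" "\<phi> (bvec 2 2, bvec 2 2) = 0"
    using assms(1) by (simp_all add: C2_mem_iff)
  ultimately show ?thesis
    using assms(1) closed
    by (subst eq[OF assms(2)], subst eq[OF assms(3)]) (simp add: C2_mem_iff algebra_simps)
qed

text \<open>Both monomials are homogeneous of degree p, which gives the scalar rule. For additivity
  with odd p, \<open>left_normed_butlast_m00\<close> and \<open>cocycle_top\<close> reduce the sum
  to \<open>star_sum_identity\<close>; for \<open>p = 2\<close> the sum is the single term
  \<open>\<phi> (g, h)\<close>.\<close>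

lemma star_property_star_section:
  fixes \<phi> :: "(nat \<Rightarrow> 'a::field) \<times> (nat \<Rightarrow> 'a) \<Rightarrow> 'a"
  assumes p: "prime p" "CHAR('a) = p" and \<phi>: "\<phi> \<in> Z2 (m00 p)"
  shows "star_property p (m00 p) \<phi> (star_section p \<phi>)"
  unfolding star_property_def
proof (intro conjI allI ballI)
  let ?L = "m00 p :: ('a, nat \<Rightarrow> 'a) restricted_lie"
  let ?\<mu> = "\<phi> (bvec p p, bvec p 1)" and ?\<nu> = "\<phi> (bvec p p, bvec p 2)"
  have p2: "p \<ge> 2" using p prime_ge_2_nat by blast
  have C2: "\<phi> \<in> carrier (C2 ?L)" using \<phi> by (simp add: Z2_mem_iff)
  {
    fix \<alpha> g assume g: "g \<in> carrier ?L"
    have "(\<alpha> * g 1) ^ (p - 1) * (\<alpha> * g 2) = \<alpha> ^ p * (g 1 ^ (p - 1) * g 2)"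
      using p2 by (simp add: power_mult_distrib power_eq_if[of \<alpha> p])
    moreover have "\<alpha> ^ p = \<alpha> ^ (p - 2) * \<alpha>\<^sup>2" using p2 by (metis le_add_diff_inverse2 power_add)
    then have "(\<alpha> * g 1) ^ (p - 2) * (\<alpha> * g 2)\<^sup>2 = \<alpha> ^ p * (g 1 ^ (p - 2) * (g 2)\<^sup>2)"
      by (simp add: power_mult_distrib)
    ultimately show "star_section p \<phi> (\<alpha> \<odot>\<^bsub>?L\<^esub> g) = \<alpha> ^ p * star_section p \<phi> g"
      using g p2 by (simp add: star_section_def m00_simps right_diff_distrib mult.left_commute)
  }
  fix g h assume gh: "g \<in> carrier ?L" "h \<in> carrier ?L"
  let ?S = "\<Sum>s\<in>formal_seqs p. 1 / of_nat (count_list s True) *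
    \<phi> (left_normed ?L (butlast (fill g h s)), last (fill g h s))"
  have sum: "?S = (\<Sum>t | length t = p - 2. 1 / of_nat (count_list t True + 1) *
      \<phi> (left_normed ?L (butlast (fill g h (True # False # t))), last (fill g h (True # False # t))))"
    unfolding formal_seqs_eq[OF p2] by (subst sum.reindex) (auto simp: inj_on_def)
  have "?S = - ?\<mu> * ((g 1 + h 1) ^ (p - 1) * (g 2 + h 2) - g 1 ^ (p - 1) * g 2 - h 1 ^ (p - 1) * h 2)
      - ?\<nu> / 2 * ((g 1 + h 1) ^ (p - 2) * (g 2 + h 2)\<^sup>2 - g 1 ^ (p - 2) * (g 2)\<^sup>2 - h 1 ^ (p - 2) * (h 2)\<^sup>2)"
  proof (cases "p = 2")
    case True
    have "(2 :: 'a) = 0" using p(2) True of_nat_CHAR[where 'a = 'a] by simp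
    then have neg: "- x = x" for x :: 'a by (metis mult_2 mult_zero_left neg_eq_iff_add_eq_0)
    have "?S = \<phi> (g, h)" unfolding sum using True by (simp add: left_normed_def fill_def)
    also have "\<dots> = - (g 1 * h 2 - g 2 * h 1) * ?\<mu>"
      using C2_m00_2[of \<phi> g h] C2 gh True by simp
    also have "g 1 * h 2 - g 2 * h 1 = g 1 * h 2 + g 2 * h 1" using neg[of "g 2 * h 1"] by simp
    \<comment> \<open>Since 2 = 0 here, the quotient by 2 is 0 by the convention for division, and
      the other part is the mixed term of \<open>(g 1 + h 1) * (g 2 + h 2)\<close>.\<close>
    finally show ?thesis using True \<open>2 = 0\<close> by (simp add: algebra_simps)
  next
    case False
    then have p3: "p \<ge> 3" using p2 by simp
    have "\<phi> (left_normed ?L (butlast (fill g h (True # False # t))), last (fill g h (True # False # t))) =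
        (g 1 * h 2 - h 1 * g 2) * prod_list (map (\<lambda>e. if e then g 1 else h 1) (butlast t)) *
          (if last t then ?\<mu> * g 1 + ?\<nu> * g 2 else ?\<mu> * h 1 + ?\<nu> * h 2)" if t: "length t = p - 2" for t
    proof -
      have "t \<noteq> []" using t p3 by auto
      then have l: "last (fill g h (True # False # t)) = (if last t then g else h)"
        by (simp add: fill_def last_map)
      then have "last (fill g h (True # False # t)) \<in> carrier ?L" using gh by simp
      then have "\<phi> (left_normed ?L (butlast (fill g h (True # False # t))), last (fill g h (True # False # t))) =
          (g 1 * h 2 - h 1 * g 2) * prod_list (map (\<lambda>e. if e then g 1 else h 1) (butlast t)) *
          \<phi> (bvec p p, last (fill g h (True # False # t)))"
        using C2 unfolding left_normed_butlast_m00[OF p(1) p3 t] C2_mem_iff by auto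
      then show ?thesis
        unfolding l using cocycle_top[OF \<phi> gh(1) p2] cocycle_top[OF \<phi> gh(2) p2]
        by (cases "last t") (simp_all only: if_True if_False)
    qed
    then have "?S = (\<Sum>t | length t = p - 2. 1 / of_nat (count_list t True + 1) *
      ((g 1 * h 2 - h 1 * g 2) * prod_list (map (\<lambda>e. if e then g 1 else h 1) (butlast t)) *
        (if last t then ?\<mu> * g 1 + ?\<nu> * g 2 else ?\<mu> * h 1 + ?\<nu> * h 2)))"
      unfolding sum by (intro sum.cong refl) (simp only: mem_Collect_eq)
    then show ?thesis unfolding star_sum_identity[OF p p3] .
  qed
  then show "star_section p \<phi> (g \<oplus>\<^bsub>?L\<^esub> h) = star_section p \<phi> g + star_section p \<phi> h + ?S"
    using gh p2 by (simp add: star_section_def m00_simps right_diff_distrib)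
qed

lemma linear_map_star_section:
  assumes "prime p" "CHAR('a::field) = p"
  shows "linear_map class_ring ((C2 (m00 p))\<lparr>carrier := Z2 (m00 p)\<rparr>)
    (funs (carrier (m00 p))) (star_section p :: _ \<Rightarrow> _ \<Rightarrow> 'a)"
proof (rule linear_mapI)
  interpret null_restricted_lie_algebra p "m00 p :: ('a, nat \<Rightarrow> 'a) restricted_lie"
    by (rule null_restricted_m00[OF assms])
  show "vectorspace class_ring ((C2 (m00 p :: ('a, nat \<Rightarrow> 'a) restricted_lie))\<lparr>carrier := Z2 (m00 p)\<rparr>)"
    using subspace_B2 by (simp add: subspace_def)
  show "vectorspace class_ring (funs (carrier (m00 p :: ('a, nat \<Rightarrow> 'a) restricted_lie)))"
    by (rule vectorspace_funs)
qed (auto simp: star_section_def funs_simps C2_ops fun_eq_iff algebra_simps add_divide_distrib)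

text \<open>\<open>e_p\<close> is central, so a coboundary vanishes at \<open>(e_p, e_1)\<close> and
  \<open>(e_p, e_2)\<close>, the only values that enter \<open>star_section\<close>.\<close>

lemma star_section_B2:
  assumes p: "prime p" "CHAR('a::field) = p"
    and \<phi>: "\<phi> \<in> B2 (m00 p :: ('a, nat \<Rightarrow> 'a) restricted_lie)"
  shows "star_section p \<phi> = \<zero>\<^bsub>funs (carrier (m00 p))\<^esub>"
proof -
  let ?L = "m00 p :: ('a, nat \<Rightarrow> 'a) restricted_lie"
  interpret null_restricted_lie_algebra p ?L by (rule null_restricted_m00[OF p])
  obtain \<psi> where \<psi>: "\<psi> \<in> carrier (C1 ?L)" "\<phi> = d1 ?L \<psi>" using \<phi> by (auto simp: B2_def)
  have "lie_br ?L (bvec p p) (bvec p k) = \<zero>\<^bsub>?L\<^esub>" if "k \<in> {1, 2}" for k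
    using that by (auto simp: m00_br m00_simps bvec_def fun_eq_iff)
  then have "\<phi> (bvec p p, bvec p k) = 0" if "k \<in> {1, 2}" for k
    using that \<psi> functional_zero[of \<psi>] by (simp add: d1_def C1_mem_iff)
  then show ?thesis by (simp add: star_section_def zero_funs)
qed

section \<open>Central extensions\<close>

definition trivial_ext ::
  "('a::field, 'v, 'm) restricted_lie_scheme \<Rightarrow> ('v \<Rightarrow> 'a) \<Rightarrow> ('a, 'v \<times> 'a) restricted_lie" where
  "trivial_ext L \<omega> = module.extend (direct_sum L scalar_space)
     \<lparr>lie_br = (\<lambda>z w. (lie_br L (fst z) (fst w), 0)), pmap = (\<lambda>z. (pmap L (fst z), \<omega> (fst z)))\<rparr>"

lemma direct_sum_scalar_simps:
  "carrier (direct_sum L scalar_space) = carrier L \<times> UNIV"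
  "\<zero>\<^bsub>direct_sum L scalar_space\<^esub> = (\<zero>\<^bsub>L\<^esub>, 0)"
  "z \<oplus>\<^bsub>direct_sum L scalar_space\<^esub> w = (fst z \<oplus>\<^bsub>L\<^esub> fst w, snd z + snd w)"
  "a \<odot>\<^bsub>direct_sum L scalar_space\<^esub> z = (a \<odot>\<^bsub>L\<^esub> fst z, a * snd z)"
  by (simp_all add: direct_sum_def scalar_space_def)

lemma trivial_ext_simps:
  "carrier (trivial_ext L \<omega>) = carrier L \<times> UNIV"
  "\<zero>\<^bsub>trivial_ext L \<omega>\<^esub> = (\<zero>\<^bsub>L\<^esub>, 0)"
  "z \<oplus>\<^bsub>trivial_ext L \<omega>\<^esub> w = (fst z \<oplus>\<^bsub>L\<^esub> fst w, snd z + snd w)"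
  "a \<odot>\<^bsub>trivial_ext L \<omega>\<^esub> z = (a \<odot>\<^bsub>L\<^esub> fst z, a * snd z)"
  "lie_br (trivial_ext L \<omega>) z w = (lie_br L (fst z) (fst w), 0)"
  "pmap (trivial_ext L \<omega>) z = (pmap L (fst z), \<omega> (fst z))"
  by (simp_all add: trivial_ext_def module.extend_def direct_sum_def scalar_space_def)

lemma linear_map_trivial_ext:
  fixes L :: "('a::field, 'v, 'm) restricted_lie_scheme"
  assumes "vectorspace class_ring L"
  shows "linear_map class_ring (direct_sum L scalar_space) (trivial_ext L \<omega>) (\<lambda>z. z)"
  by (rule vectorspace_surj_image)
    (use assms direct_sum_is_vs vectorspace_scalar_space
      in \<open>auto simp: trivial_ext_simps direct_sum_scalar_simps\<close>)

context restricted_lie_algebra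
begin

text \<open>Two leading letters guarantee at least one bracket, which erases all scalar
  parts.\<close>

lemma left_normed_trivial_ext:
  "left_normed (trivial_ext L \<omega>) (u # v # ws) = (left_normed L (fst u # fst v # map fst ws), 0)"
proof -
  have "foldl (lie_br (trivial_ext L \<omega>)) (x, 0) ws = (foldl (lie_br L) x (map fst ws), 0)" for x
    by (induction ws arbitrary: x) (simp_all add: trivial_ext_simps)
  then show ?thesis by (simp add: left_normed_def trivial_ext_simps)
qed

text \<open>Jacobson's sum has scalar part 0, so the scalar part of the [p]-operator has to be
  additive and homogeneous of degree p: this is what Frobenius semilinearity of \<omega>
  provides.\<close>

lemma restricted_trivial_ext:
  assumes \<omega>: "\<omega> \<in> carrier (Hom_Fr p L)"
  shows "restricted_lie_algebra p (trivial_ext L \<omega>)"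
proof -
  let ?E = "trivial_ext L \<omega>"
  have "vectorspace class_ring L" ..
  then interpret E: vectorspace class_ring ?E
    using linear_map_trivial_ext linear_map.axioms(2) by blast
  have star: "star_property p L (restrict (\<lambda>_. 0) (carrier L \<times> carrier L)) \<omega>"
    using \<omega> star_property_zero_iff by (simp add: Hom_Fr_def)
  have \<omega>_smult: "\<omega> (\<alpha> \<odot> x) = \<alpha> ^ p * \<omega> x" if "x \<in> carrier L" for \<alpha> x
    using star that by (simp add: star_property_def)
  have \<omega>_add: "\<omega> (x \<oplus> y) = \<omega> x + \<omega> y" if "x \<in> carrier L" "y \<in> carrier L" for x y
  proof -
    have "\<omega> (1 \<odot> x \<oplus> 1 \<odot> y) = 1 ^ p * \<omega> x + 1 ^ p * \<omega> y" using \<omega> that by (simp add: Hom_Fr_def)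
    then show ?thesis using that smult_one by (simp add: class_ring_simps)
  qed
  have finsum: "(\<Oplus>\<^bsub>?E\<^esub>i\<in>A. (v i, 0)) = ((\<Oplus>i\<in>A. v i), 0)"
    if "finite A" "v \<in> A \<rightarrow> carrier L" for A :: "bool list set" and v
    using that
  proof (induction A)
    case empty
    then show ?case by (simp add: trivial_ext_simps)
  next
    case (insert i A)
    then have "(\<Oplus>\<^bsub>?E\<^esub>i\<in>insert i A. (v i, 0)) = (v i, 0) \<oplus>\<^bsub>?E\<^esub> (\<Oplus>\<^bsub>?E\<^esub>i\<in>A. (v i, 0))"
      by (intro E.module.M.finsum_insert) (auto simp: trivial_ext_simps)
    then show ?case using insert by (simp add: trivial_ext_simps Pi_iff)
  qed
  show ?thesis
  proof (unfold_locales)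
    fix z w assume "z \<in> carrier ?E" "w \<in> carrier ?E"
    then have c: "fst z \<in> carrier L" "fst w \<in> carrier L" by (auto simp: trivial_ext_simps)
    have "(lie_br ?E z ^^ Suc m) w = ((lie_br L (fst z) ^^ Suc m) (fst w), 0)" for m
      by (induction m) (simp_all add: trivial_ext_simps)
    from this[of "p - 1"] show "lie_br ?E (pmap ?E z) w = (lie_br ?E z ^^ p) w"
      using p_pos c by (simp add: trivial_ext_simps ad_pmap)
  next
    fix g h assume "g \<in> carrier ?E" "h \<in> carrier ?E"
    then have c: "fst g \<in> carrier L" "fst h \<in> carrier L" by (auto simp: trivial_ext_simps)
    let ?v = "\<lambda>s. (1 / of_nat (count_list s True)) \<odot> left_normed L (fill (fst g) (fst h) s)"
    have v: "?v s \<in> carrier L" if "s \<in> formal_seqs p" for s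
      using that formal_seq_args_closed c by (simp add: left_normed_fill_butlast br_closed smult_carrier)
    have "(1 / of_nat (count_list s True)) \<odot>\<^bsub>?E\<^esub> left_normed ?E (fill g h s) = (?v s, 0)"
      if s: "s \<in> formal_seqs p" for s
    proof -
      obtain t where t: "s = True # False # t" using formal_seqs_Cons s by blast
      have "map fst (fill g h t) = fill (fst g) (fst h) t" by (simp add: fill_def)
      moreover have "fill g h s = g # h # fill g h t"
        "fill (fst g) (fst h) s = fst g # fst h # fill (fst g) (fst h) t"
        by (simp_all add: t fill_def)
      ultimately show ?thesis
        by (simp add: left_normed_trivial_ext trivial_ext_simps)
    qed
    then have "(\<Oplus>\<^bsub>?E\<^esub>s\<in>formal_seqs p. (1 / of_nat (count_list s True)) \<odot>\<^bsub>?E\<^esub> left_normed ?E (fill g h s)) =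
        (\<Oplus>\<^bsub>?E\<^esub>s\<in>formal_seqs p. (?v s, 0))"
      using v by (intro E.module.M.finsum_cong') (auto simp: trivial_ext_simps)
    also have "\<dots> = ((\<Oplus>s\<in>formal_seqs p. ?v s), 0)"
      using v by (intro finsum formal_seqs_finite) auto
    finally show "pmap ?E (g \<oplus>\<^bsub>?E\<^esub> h) = pmap ?E g \<oplus>\<^bsub>?E\<^esub> pmap ?E h \<oplus>\<^bsub>?E\<^esub>
        (\<Oplus>\<^bsub>?E\<^esub>s\<in>formal_seqs p. (1 / of_nat (count_list s True)) \<odot>\<^bsub>?E\<^esub> left_normed ?E (fill g h s))"
      using c by (simp add: trivial_ext_simps pmap_add \<omega>_add)
  qed (auto simp: trivial_ext_simps prime_p char_p br_closed br_add_left br_add_right br_smult_left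
      br_smult_right br_alternating jacobi pmap_closed pmap_smult \<omega>_smult smult_carrier
      LinearCombinations.module_hom_def)
qed

text \<open>The [p]-th power of the generator is \<open>(pmap L \<zero>, \<omega> \<zero>)\<close>,
  so both entries must vanish; homogeneity with the scalar 0 gives this because
  \<open>p > 0\<close>.\<close>

lemma central_trivial_ext:
  assumes "\<omega> \<in> carrier (Hom_Fr p L)"
  shows "central_extension p L (trivial_ext L \<omega>) fst (\<zero>, 1)"
proof -
  interpret E: restricted_lie_algebra p "trivial_ext L \<omega>" by (rule restricted_trivial_ext[OF assms])
  have L: "restricted_lie_algebra p L" ..
  have "\<forall>\<alpha> \<beta>. \<forall>x\<in>carrier L. \<forall>y\<in>carrier L. \<omega> (\<alpha> \<odot> x \<oplus> \<beta> \<odot> y) = \<alpha> ^ p * \<omega> x + \<beta> ^ p * \<omega> y"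
    using assms by (simp add: Hom_Fr_def)
  then have "\<omega> (0 \<odot> \<zero> \<oplus> 0 \<odot> \<zero>) = 0 ^ p * \<omega> \<zero> + 0 ^ p * \<omega> \<zero>"
    using M.zero_closed by blast
  then have \<omega>0: "\<omega> \<zero> = 0" using p_pos by (simp add: zero_power)
  have pmap0: "pmap L \<zero> = \<zero>"
    using pmap_smult[of \<zero> 0] p_pos pmap_closed[of \<zero>] lmult_0[of "pmap L \<zero>"] lmult_0[of \<zero>]
    by (simp add: class_ring_simps zero_power)
  have br0: "lie_br L x \<zero> = \<zero>" if "x \<in> carrier L" for x
    using br_smult_right[of \<zero> x 0] that lmult_0[of \<zero>] lmult_0[of "lie_br L x \<zero>"] br_closed[of x \<zero>]
    by (simp add: class_ring_simps)
  show ?thesis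
    unfolding central_extension_def
    using L E.restricted_lie_algebra_axioms
    by (auto simp: restricted_hom_def LinearCombinations.module_hom_def trivial_ext_simps \<omega>0 pmap0 br0 image_iff)
qed

text \<open>Every monomial in Jacobson's sum begins with \<open>[g, z] = 0\<close>.\<close>

lemma pmap_add_central:
  assumes g: "g \<in> carrier L" and z: "z \<in> carrier L" and central: "\<And>x. x \<in> carrier L \<Longrightarrow> lie_br L x z = \<zero>"
  shows "pmap L (g \<oplus> z) = pmap L g \<oplus> pmap L z"
proof -
  have br0: "lie_br L \<zero> x = \<zero>" if "x \<in> carrier L" for x
    using br_smult_left[of \<zero> x 0] that lmult_0[of \<zero>] lmult_0[of "lie_br L \<zero> x"] br_closed[of \<zero> x]
    by (simp add: class_ring_simps)
  have "left_normed L (fill g z s) = \<zero>" if s: "s \<in> formal_seqs p" for s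
  proof -
    obtain t where t: "s = True # False # t" using formal_seqs_Cons s by blast
    have "foldl (lie_br L) \<zero> ws = \<zero>" if "set ws \<subseteq> carrier L" for ws
      using that by (induction ws) (simp_all add: br0)
    then show ?thesis using fill_subset[OF g z, of t] central[OF g] by (simp add: t left_normed_def fill_def)
  qed
  then have "(\<Oplus>s\<in>formal_seqs p. (1 / of_nat (count_list s True)) \<odot> left_normed L (fill g z s)) =
      (\<Oplus>s\<in>formal_seqs p. \<zero>)"
    by (intro M.finsum_cong') auto
  then show ?thesis using g z by (simp add: pmap_add pmap_closed)
qed

end

context null_restricted_lie_algebra
begin

lemma corresponds_trivial_ext:
  assumes \<omega>: "\<omega> \<in> carrier (Hom_Fr p L)"
  shows "corresponds L (trivial_ext L \<omega>) fst (\<zero>, 1) (class2s p L (\<zero>\<^bsub>C2 L\<^esub>, \<omega>))"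
proof -
  let ?E = "trivial_ext L \<omega>"
  have ext: "\<omega> \<in> extensional (carrier L)" using \<omega> by (simp add: Hom_Fr_def)
  have "(\<zero>\<^bsub>C2 L\<^esub>, \<omega>) = (\<zero>\<^bsub>C2 L\<^esub>, restrict (\<lambda>_. 0) (carrier L)) \<oplus>\<^bsub>C2s p L\<^esub> (\<zero>\<^bsub>C2 L\<^esub>, \<omega>)"
    using ext by (auto simp: C2s_ops C2_ops funs_simps fun_eq_iff extensional_def)
  moreover have "(\<zero>\<^bsub>C2 L\<^esub>, restrict (\<lambda>_. 0) (carrier L)) \<in> B2s L"
    using zero_mem_B2 by (simp add: B2s_eq C2_ops)
  ultimately have mem: "(\<zero>\<^bsub>C2 L\<^esub>, \<omega>) \<in> class2s p L (\<zero>\<^bsub>C2 L\<^esub>, \<omega>)"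
    unfolding class2s_def a_r_coset_def' by blast
  have "vectorspace class_ring L" ..
  then have "identification L ?E fst (\<zero>, 1) (\<lambda>z. z)"
    using linear_map_trivial_ext
    by (auto simp: identification_def direct_sum_scalar_simps trivial_ext_simps bij_betw_def)
  moreover have "\<forall>x\<in>carrier L. \<forall>y\<in>carrier L. lie_br ?E (x, 0) (y, 0) =
      (lie_br L x y, 0) \<oplus>\<^bsub>?E\<^esub> \<zero>\<^bsub>C2 L\<^esub> (x, y) \<odot>\<^bsub>?E\<^esub> (\<zero>, 1)"
    by (auto simp: trivial_ext_simps C2_ops br_closed)
  moreover have "\<forall>x\<in>carrier L. pmap ?E (x, 0) = (pmap L x, 0) \<oplus>\<^bsub>?E\<^esub> \<omega> x \<odot>\<^bsub>?E\<^esub> (\<zero>, 1)"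
    by (auto simp: trivial_ext_simps pmap_closed)
  ultimately show ?thesis
    unfolding corresponds_def by (intro bexI[OF _ mem]) auto
qed

text \<open>
  A representative of the class of \<open>(0, \<omega>)\<close> is \<open>(d\<^sup>1 \<psi>, \<omega>)\<close>; shearing the identification along
  \<open>\<psi>\<close> removes \<open>d\<^sup>1 \<psi>\<close>.
\<close>

lemma corresponds_Hom_Fr:
  fixes E :: "('a, 'e, 'n) restricted_lie_scheme"
  assumes ext: "central_extension p L E \<pi> c"
    and corr: "corresponds L E \<pi> c (class2s p L (\<zero>\<^bsub>C2 L\<^esub>, \<omega>))"
  shows "\<exists>\<theta>. identification L E \<pi> c \<theta> \<and>
    (\<forall>x\<in>carrier L. \<forall>y\<in>carrier L. lie_br E (\<theta> (x, 0)) (\<theta> (y, 0)) = \<theta> (lie_br L x y, 0)) \<and>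
    (\<forall>x\<in>carrier L. pmap E (\<theta> (x, 0)) = \<theta> (pmap L x, 0) \<oplus>\<^bsub>E\<^esub> \<omega> x \<odot>\<^bsub>E\<^esub> c)"
proof -
  interpret E: restricted_lie_algebra p E using ext by (simp add: central_extension_def)
  have c: "c \<in> carrier E" "pmap E c = \<zero>\<^bsub>E\<^esub>" "\<And>x. x \<in> carrier E \<Longrightarrow> lie_br E x c = \<zero>\<^bsub>E\<^esub>"
    using ext by (auto simp: central_extension_def)
  obtain \<phi> \<omega>' \<theta> where mem: "(\<phi>, \<omega>') \<in> class2s p L (\<zero>\<^bsub>C2 L\<^esub>, \<omega>)"
    and \<theta>: "identification L E \<pi> c \<theta>"
    and br: "\<And>x y. x \<in> carrier L \<Longrightarrow> y \<in> carrier L \<Longrightarrow>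
      lie_br E (\<theta> (x, 0)) (\<theta> (y, 0)) = \<theta> (lie_br L x y, 0) \<oplus>\<^bsub>E\<^esub> \<phi> (x, y) \<odot>\<^bsub>E\<^esub> c"
    and pm: "\<And>x. x \<in> carrier L \<Longrightarrow> pmap E (\<theta> (x, 0)) = \<theta> (pmap L x, 0) \<oplus>\<^bsub>E\<^esub> \<omega>' x \<odot>\<^bsub>E\<^esub> c"
    using corr unfolding corresponds_def by auto
  obtain \<psi> where \<psi>: "\<psi> \<in> carrier (C1 L)"
    and \<phi>: "\<And>x y. x \<in> carrier L \<Longrightarrow> y \<in> carrier L \<Longrightarrow> \<phi> (x, y) = \<psi> (lie_br L x y)"
    and \<omega>': "\<And>x. x \<in> carrier L \<Longrightarrow> \<omega>' x = \<omega> x"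
  proof -
    obtain b where b: "b \<in> B2s L" "(\<phi>, \<omega>') = b \<oplus>\<^bsub>C2s p L\<^esub> (\<zero>\<^bsub>C2 L\<^esub>, \<omega>)"
      using mem by (auto simp: class2s_def a_r_coset_def')
    then obtain \<psi> where \<psi>: "\<psi> \<in> carrier (C1 L)" "b = (d1 L \<psi>, restrict (\<lambda>_. 0) (carrier L))"
      by (auto simp: B2s_eq B2_def)
    show ?thesis
      by (rule that[OF \<psi>(1)]) (use b(2) in \<open>auto simp: \<psi>(2) C2s_ops C2_ops funs_simps d1_def\<close>)
  qed
  have hom: "\<psi> \<in> LinearCombinations.module_hom class_ring L scalar_space"
    using \<psi> by (simp add: C1_mem_iff)
  note lin = hom[unfolded linear_functional_iff] and \<psi>0 = functional_zero[OF hom]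
  let ?D = "direct_sum L scalar_space"
  have \<theta>_lin: "linear_map class_ring ?D E \<theta>" and \<theta>_bij: "bij_betw \<theta> (carrier ?D) (carrier E)"
    and \<theta>_\<pi>: "\<And>x a. x \<in> carrier L \<Longrightarrow> \<pi> (\<theta> (x, a)) = x" and \<theta>_c: "\<theta> (\<zero>, 1) = c"
    using \<theta> by (auto simp: identification_def)
  interpret \<theta>: linear_map class_ring ?D E \<theta> by (rule \<theta>_lin)
  \<comment> \<open>The shear changes only the scalar coordinate and fixes
    \<open>(\<zero>, 1)\<close> because \<open>\<psi> \<zero> = 0\<close>; hence it respects both
    the projection and the generator.\<close>
  define \<sigma> where "\<sigma> = (\<lambda>(x, a). (x, a + \<psi> x))"
  have "vectorspace class_ring L" ..
  then have D: "vectorspace class_ring ?D" by (intro direct_sum_is_vs vectorspace_scalar_space)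
  have \<sigma>_lin: "linear_map class_ring ?D ?D \<sigma>"
    by (rule linear_mapI[OF D D]) (auto simp: \<sigma>_def direct_sum_scalar_simps lin algebra_simps)
  have \<sigma>_bij: "bij_betw \<sigma> (carrier ?D) (carrier ?D)"
    by (rule bij_betw_byWitness[of _ "\<lambda>(x, a). (x, a - \<psi> x)"]) (auto simp: \<sigma>_def direct_sum_scalar_simps)
  have ident: "identification L E \<pi> c (\<lambda>z. \<theta> (\<sigma> z))"
    unfolding identification_def
    using linear_map_comp[OF \<sigma>_lin \<theta>_lin] bij_betw_trans[OF \<sigma>_bij \<theta>_bij] \<theta>_\<pi> \<theta>_c \<psi>0
    by (auto simp: \<sigma>_def comp_def)
  have \<theta>_closed: "\<theta> (x, a) \<in> carrier E" if "x \<in> carrier L" for x a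
    using that \<theta>.f_im[of "(x, a)"] by (simp add: direct_sum_scalar_simps)
  have shear: "\<theta> (\<sigma> (x, 0)) = \<theta> (x, 0) \<oplus>\<^bsub>E\<^esub> \<psi> x \<odot>\<^bsub>E\<^esub> c" if x: "x \<in> carrier L" for x
  proof -
    have "\<sigma> (x, 0) = (x, 0) \<oplus>\<^bsub>?D\<^esub> \<psi> x \<odot>\<^bsub>?D\<^esub> (\<zero>, 1)"
      using x by (simp add: \<sigma>_def direct_sum_scalar_simps)
    then show ?thesis
      using x \<theta>_c \<theta>.f_add[of "(x, 0)" "\<psi> x \<odot>\<^bsub>?D\<^esub> (\<zero>, 1)"] \<theta>.f_smult[of "\<psi> x" "(\<zero>, 1)"]
      by (simp add: direct_sum_scalar_simps)
  qed
  have sc: "a \<odot>\<^bsub>E\<^esub> c \<in> carrier E" for a using c by (simp add: E.smult_carrier)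
  have central: "lie_br E x (a \<odot>\<^bsub>E\<^esub> c) = \<zero>\<^bsub>E\<^esub>" if "x \<in> carrier E" for x a
    using that c by (simp add: E.br_smult_right)
  have central': "lie_br E (a \<odot>\<^bsub>E\<^esub> c) x = \<zero>\<^bsub>E\<^esub>" if "x \<in> carrier E" for x a
    using that E.br_anticomm[of x "a \<odot>\<^bsub>E\<^esub> c"] central sc by simp
  have "lie_br E (\<theta> (\<sigma> (x, 0))) (\<theta> (\<sigma> (y, 0))) = \<theta> (\<sigma> (lie_br L x y, 0))"
    if xy: "x \<in> carrier L" "y \<in> carrier L" for x y
  proof -
    have "lie_br E (\<theta> (\<sigma> (x, 0))) (\<theta> (\<sigma> (y, 0))) = lie_br E (\<theta> (x, 0)) (\<theta> (y, 0))"
      unfolding shear[OF xy(1)] shear[OF xy(2)] using xy \<theta>_closed sc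
      by (simp add: E.br_add_left E.br_add_right central central' E.br_closed)
    \<comment> \<open>What remains is \<theta> of the bracket plus
      \<open>\<psi> (lie_br L x y)\<close> times \<open>c\<close>, and this is the sheared image of
      the bracket.\<close>
    then show ?thesis using xy by (simp add: br \<phi> shear br_closed)
  qed
  moreover have "pmap E (\<theta> (\<sigma> (x, 0))) = \<theta> (\<sigma> (pmap L x, 0)) \<oplus>\<^bsub>E\<^esub> \<omega> x \<odot>\<^bsub>E\<^esub> c"
    if x: "x \<in> carrier L" for x
  proof -
    have "pmap E (\<theta> (\<sigma> (x, 0))) = pmap E (\<theta> (x, 0)) \<oplus>\<^bsub>E\<^esub> pmap E (\<psi> x \<odot>\<^bsub>E\<^esub> c)"
      unfolding shear[OF x] by (intro E.pmap_add_central \<theta>_closed x sc central)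
    also have "pmap E (\<psi> x \<odot>\<^bsub>E\<^esub> c) = \<zero>\<^bsub>E\<^esub>" using c by (simp add: E.pmap_smult)
    finally show ?thesis
      using x sc \<theta>_closed by (simp add: pm \<omega>' pmap_null \<sigma>_def \<psi>0)
  qed
  ultimately show ?thesis using ident by blast
qed

end

section \<open>Classes of Frobenius-linear maps\<close>

lemma (in vectorspace) dim_span_lin_indpt:
  assumes "finite S" "S \<subseteq> carrier V" "lin_indpt S"
  shows "vectorspace.fin_dim K (vs (span S))" "vectorspace.dim K (vs (span S)) = card S"
proof -
  have sub: "subspace K (span S) V" by (rule span_is_subspace[OF assms(2)])
  interpret W: vectorspace K "vs (span S)" by (rule subspace_is_vs[OF sub])
  have S: "S \<subseteq> span S" using in_own_span assms(2) by blast
  note nd = span_li_not_depend[OF S is_module[OF sub]]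
  have gen: "W.gen_set S" using nd(1) by simp
  then show "W.fin_dim" unfolding W.fin_dim_def using assms(1) S by auto
  show "W.dim = card S"
    by (rule W.dim_basis[OF assms(1)]) (use gen nd(2) S assms(3) in \<open>simp add: W.basis_def\<close>)
qed

lemma (in linear_map) inj_image_lin_indpt:
  assumes "inj_on T (carrier V)" "finite B" "B \<subseteq> carrier V" "V.module.lin_indpt B"
  shows "W.module.lin_indpt (T ` B)"
proof (rule W.module.finite_lin_indpt2)
  show "finite (T ` B)" using assms(2) by simp
  show "T ` B \<subseteq> carrier W" using assms(3) by auto
  fix a assume a: "a \<in> T ` B \<rightarrow> carrier K" and "W.module.lincomb a (T ` B) = \<zero>\<^bsub>W\<^esub>"
  then have "T (V.module.lincomb (a \<circ> T) B) = T \<zero>\<^bsub>V\<^esub>"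
    using lincomb_linear_image[OF assms(1,3) a assms(2)] by simp
  moreover have "a \<circ> T \<in> B \<rightarrow> carrier K" using a by auto
  ultimately have "V.module.lincomb (a \<circ> T) B = \<zero>\<^bsub>V\<^esub>"
    by (intro inj_onD[OF assms(1)] V.module.lincomb_closed assms(3)) simp_all
  then have "a \<circ> T \<in> B \<rightarrow> {\<zero>\<^bsub>K\<^esub>}"
    using V.not_lindepD[OF assms(4,2) subset_refl \<open>a \<circ> T \<in> B \<rightarrow> carrier K\<close>] by blast
  then show "\<forall>v\<in>T ` B. a v = \<zero>\<^bsub>K\<^esub>" by auto
qed

lemma (in restricted_lie_algebra) finsum_Hom_Fr_apply:
  assumes "finite A" "f \<in> A \<rightarrow> carrier (Hom_Fr p L)" "x \<in> carrier L"
  shows "(\<Oplus>\<^bsub>Hom_Fr p L\<^esub>i\<in>A. f i) x = (\<Sum>i\<in>A. f i x)"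
proof -
  interpret H: vectorspace class_ring "Hom_Fr p L" by (rule vectorspace_Hom_Fr)
  show ?thesis
    using assms
  proof (induction A)
    case empty
    then show ?case by (simp add: Hom_Fr_ops)
  next
    case (insert i A)
    then have "(\<Oplus>\<^bsub>Hom_Fr p L\<^esub>i\<in>insert i A. f i) = f i \<oplus>\<^bsub>Hom_Fr p L\<^esub> (\<Oplus>\<^bsub>Hom_Fr p L\<^esub>i\<in>A. f i)"
      by (intro H.module.M.finsum_insert) auto
    then show ?case using insert by (simp add: Hom_Fr_ops Pi_iff)
  qed
qed

lemma ebar_bvec: "i \<in> {1..p} \<Longrightarrow> k \<in> {1..p} \<Longrightarrow> ebar p k (bvec p i) = (if k = i then 1 else 0)"
  by (auto simp: ebar_def) (auto simp: bvec_def)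

lemma ebar_Hom_Fr:
  assumes p: "prime p" "CHAR('a::field) = p" and k: "k \<in> {1..p}"
  shows "(ebar p k :: _ \<Rightarrow> 'a) \<in> carrier (Hom_Fr p (m00 p))"
proof -
  have "ebar p k (\<alpha> \<odot>\<^bsub>m00 p\<^esub> x \<oplus>\<^bsub>m00 p\<^esub> \<beta> \<odot>\<^bsub>m00 p\<^esub> y) = \<alpha> ^ p * ebar p k x + \<beta> ^ p * ebar p k y"
    if "x \<in> carrier (m00 p)" "y \<in> carrier (m00 p)" for \<alpha> \<beta> :: 'a and x y
  proof -
    have "(\<alpha> \<odot>\<^bsub>m00 p\<^esub> x \<oplus>\<^bsub>m00 p\<^esub> \<beta> \<odot>\<^bsub>m00 p\<^esub> y) k = \<alpha> * x k + \<beta> * y k"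
      using k by (simp add: m00_simps)
    moreover have "\<alpha> \<odot>\<^bsub>m00 p\<^esub> x \<oplus>\<^bsub>m00 p\<^esub> \<beta> \<odot>\<^bsub>m00 p\<^esub> y \<in> carrier (m00 p)"
      by (simp add: m00_simps)
    ultimately show ?thesis
      using that add_power_char[OF p, of "\<alpha> * x k" "\<beta> * y k"]
      by (simp add: ebar_def power_mult_distrib)
  qed
  moreover have "(ebar p k :: _ \<Rightarrow> 'a) \<in> extensional (carrier (m00 p))" by (simp add: ebar_def)
  ultimately show ?thesis by (simp add: Hom_Fr_def)
qed

context
  fixes p :: nat and L :: "('a::field, nat \<Rightarrow> 'a) restricted_lie"
  assumes p: "prime p" "CHAR('a) = p" and L: "L = m00 p"
begin

interpretation null_restricted_lie_algebra p L
  unfolding L by (rule null_restricted_m00[OF p])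

text \<open>The maps \<open>ebar p k\<close> are dual to the basis: evaluating a relation at
  \<open>e_j\<close> leaves its coefficient at \<open>ebar p j\<close>.\<close>

lemma ebar_lin_indpt: "\<not> LinearCombinations.module.lin_dep class_ring (Hom_Fr p L) (ebar p ` {1..p})"
  and inj_ebar: "inj_on (ebar p :: nat \<Rightarrow> _ \<Rightarrow> 'a) {1..p}"
proof -
  show inj: "inj_on (ebar p :: nat \<Rightarrow> _ \<Rightarrow> 'a) {1..p}"
  proof (rule inj_onI)
    fix i k assume ik: "i \<in> {1..p}" "k \<in> {1..p}" "(ebar p i :: _ \<Rightarrow> 'a) = ebar p k"
    have "(ebar p i (bvec p i) :: 'a) = 1" using ebar_bvec[OF ik(1) ik(1)] by simp
    then have "(if k = i then 1 else 0) = (1 :: 'a)" unfolding ik(3) ebar_bvec[OF ik(1,2)] .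
    then show "i = k" by (cases "k = i") simp_all
  qed
  interpret H: vectorspace class_ring "Hom_Fr p L" by (rule vectorspace_Hom_Fr)
  let ?B = "ebar p ` {1..p} :: ((nat \<Rightarrow> 'a) \<Rightarrow> 'a) set"
  show "H.lin_indpt ?B"
  proof (rule H.finite_lin_indpt2)
    show "finite ?B" by simp
    show B: "?B \<subseteq> carrier (Hom_Fr p L)" using ebar_Hom_Fr[OF p] unfolding L by blast
    fix a assume "H.lincomb a ?B = \<zero>\<^bsub>Hom_Fr p L\<^esub>"
    then have eq: "(\<Oplus>\<^bsub>Hom_Fr p L\<^esub>v\<in>?B. a v \<odot>\<^bsub>Hom_Fr p L\<^esub> v) = \<zero>\<^bsub>Hom_Fr p L\<^esub>"
      by (simp only: H.lincomb_def)
    have "a (ebar p j) = 0" if j: "j \<in> {1..p}" for j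
    proof -
      have c: "(\<lambda>v. a v \<odot>\<^bsub>Hom_Fr p L\<^esub> v) \<in> ?B \<rightarrow> carrier (Hom_Fr p L)"
        using B by (auto intro!: H.smult_closed)
      have bv: "bvec p j \<in> carrier L" by (simp add: L)
      have "(\<Oplus>\<^bsub>Hom_Fr p L\<^esub>v\<in>?B. a v \<odot>\<^bsub>Hom_Fr p L\<^esub> v) (bvec p j) =
          (\<Sum>v\<in>?B. (a v \<odot>\<^bsub>Hom_Fr p L\<^esub> v) (bvec p j))"
        by (rule finsum_Hom_Fr_apply[OF _ c bv]) simp
      then have "(\<Sum>v\<in>?B. (a v \<odot>\<^bsub>Hom_Fr p L\<^esub> v) (bvec p j)) = 0"
        unfolding eq by (simp add: Hom_Fr_ops bv)
      then have "(\<Sum>v\<in>?B. a v * v (bvec p j)) = 0" by (simp add: Hom_Fr_ops bv)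
      then have "(\<Sum>k\<in>{1..p}. a (ebar p k) * ebar p k (bvec p j)) = 0"
        by (simp only: sum.reindex[OF inj] comp_def)
      moreover have "(\<Sum>k\<in>{1..p}. a (ebar p k) * ebar p k (bvec p j)) =
          (\<Sum>k\<in>{1..p}. if k = j then a (ebar p k) else 0)"
        using j by (intro sum.cong refl) (simp only: ebar_bvec, simp)
      ultimately show ?thesis using j by simp
    qed
    then show "\<forall>v\<in>?B. a v = \<zero>\<^bsub>class_ring\<^esub>" by simp
  qed
qed

text \<open>Injectivity of \<open>Fr_incl\<close> serves twice: it carries independence over to
  cohomology, and it keeps the p classes distinct, so that the span has dimension exactly p.\<close>

lemma span_ebar_classes:
  defines "S \<equiv> {class2s p L (\<zero>\<^bsub>C2 L\<^esub>, ebar p k) | k. k \<in> {1..p}}"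
  assumes inj: "inj_on (Fr_incl p L) (carrier (Hom_Fr p L))"
  shows "subspace class_ring (LinearCombinations.module.span class_ring (H2s p L) S) (H2s p L)"
    and "vectorspace.fin_dim class_ring
      ((H2s p L)\<lparr>carrier := LinearCombinations.module.span class_ring (H2s p L) S\<rparr>)"
    and "vectorspace.dim class_ring
      ((H2s p L)\<lparr>carrier := LinearCombinations.module.span class_ring (H2s p L) S\<rparr>) = p"
proof -
  let ?B = "ebar p ` {1..p} :: ((nat \<Rightarrow> 'a) \<Rightarrow> 'a) set"
  have S: "S = Fr_incl p L ` ?B" by (auto simp: S_def Fr_incl_def)
  have B: "?B \<subseteq> carrier (Hom_Fr p L)" using ebar_Hom_Fr[OF p] unfolding L by blast
  interpret F: linear_map class_ring "Hom_Fr p L" "H2s p L" "Fr_incl p L" by (rule linear_map_Fr_incl)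
  have fin: "finite S" unfolding S by simp
  have carr: "S \<subseteq> carrier (H2s p L)" unfolding S using B by auto
  have indpt: "\<not> LinearCombinations.module.lin_dep class_ring (H2s p L) S"
    unfolding S using F.inj_image_lin_indpt[OF inj _ B ebar_lin_indpt] by simp
  have "card S = p"
    unfolding S using card_image[OF inj_on_subset[OF inj B]] card_image[OF inj_ebar] by simp
  then show "subspace class_ring (LinearCombinations.module.span class_ring (H2s p L) S) (H2s p L)"
    and "vectorspace.fin_dim class_ring
      ((H2s p L)\<lparr>carrier := LinearCombinations.module.span class_ring (H2s p L) S\<rparr>)"
    and "vectorspace.dim class_ring
      ((H2s p L)\<lparr>carrier := LinearCombinations.module.span class_ring (H2s p L) S\<rparr>) = p"
    using vectorspace.span_is_subspace[OF vectorspace_H2s carr]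
      vectorspace.dim_span_lin_indpt[OF vectorspace_H2s fin carr indpt] by auto
qed

text \<open>The projection \<open>pr\<close> is taken to be the first component of \<Phi>, so its
  linearity, image and kernel are read off from \<Phi>. The second component of \<Phi> is a left
  inverse of \<open>Fr_incl\<close>, whence injectivity.\<close>

lemma H2s_m00_split:
  "\<exists>pr \<Phi>. (\<forall>\<omega>\<in>carrier (Hom_Fr p L). (\<zero>\<^bsub>C2 L\<^esub>, \<omega>) \<in> Z2s p L) \<and>
    linear_map class_ring (Hom_Fr p L) (H2s p L) (Fr_incl p L) \<and>
    linear_map class_ring (H2s p L) (H2 L) pr \<and>
    (\<forall>(\<phi>, \<omega>)\<in>Z2s p L. pr (class2s p L (\<phi>, \<omega>)) = class2 L \<phi>) \<and>
    inj_on (Fr_incl p L) (carrier (Hom_Fr p L)) \<and>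
    Fr_incl p L ` carrier (Hom_Fr p L) = {X \<in> carrier (H2s p L). pr X = \<zero>\<^bsub>H2 L\<^esub>} \<and>
    pr ` carrier (H2s p L) = carrier (H2 L) \<and>
    linear_map class_ring (H2s p L) (direct_sum (H2 L) (Hom_Fr p L)) \<Phi> \<and>
    bij_betw \<Phi> (carrier (H2s p L)) (carrier (direct_sum (H2 L) (Hom_Fr p L))) \<and>
    (\<forall>\<omega>\<in>carrier (Hom_Fr p L). \<Phi> (Fr_incl p L \<omega>) = (\<zero>\<^bsub>H2 L\<^esub>, \<omega>)) \<and>
    (\<forall>X\<in>carrier (H2s p L). fst (\<Phi> X) = pr X)"
proof -
  obtain \<Phi> where lin: "linear_map class_ring (H2s p L) (direct_sum (H2 L) (Hom_Fr p L)) \<Phi>"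
    and bij: "bij_betw \<Phi> (carrier (H2s p L)) (carrier (direct_sum (H2 L) (Hom_Fr p L)))"
    and cls: "\<forall>(\<phi>, \<omega>)\<in>Z2s p L. fst (\<Phi> (class2s p L (\<phi>, \<omega>))) = class2 L \<phi>"
    and Fr: "\<forall>\<omega>\<in>carrier (Hom_Fr p L). \<Phi> (Fr_incl p L \<omega>) = (\<zero>\<^bsub>H2 L\<^esub>, \<omega>)"
    using H2s_split[of "star_section p", unfolded L, OF linear_map_star_section[OF p]
        star_property_star_section[OF p] star_section_B2[OF p], folded L] by blast
  interpret F: linear_map class_ring "Hom_Fr p L" "H2s p L" "Fr_incl p L" by (rule linear_map_Fr_incl)
  have img: "\<Phi> ` carrier (H2s p L) = carrier (H2 L) \<times> carrier (Hom_Fr p L)"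
    using bij by (simp add: bij_betw_def direct_sum_def)
  have pr: "linear_map class_ring (H2s p L) (H2 L) (\<lambda>X. fst (\<Phi> X))"
    by (rule linear_map_comp[OF lin linear_map_fst[OF vectorspace_H2 vectorspace_Hom_Fr]])
  have inj: "inj_on (Fr_incl p L) (carrier (Hom_Fr p L))"
    using Fr by (intro inj_onI) (metis snd_conv)
  have ker: "Fr_incl p L ` carrier (Hom_Fr p L) = {X \<in> carrier (H2s p L). fst (\<Phi> X) = \<zero>\<^bsub>H2 L\<^esub>}"
  proof (intro equalityI subsetI)
    fix X assume "X \<in> Fr_incl p L ` carrier (Hom_Fr p L)"
    then show "X \<in> {X \<in> carrier (H2s p L). fst (\<Phi> X) = \<zero>\<^bsub>H2 L\<^esub>}" using Fr F.f_im by auto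
  next
    fix X assume X: "X \<in> {X \<in> carrier (H2s p L). fst (\<Phi> X) = \<zero>\<^bsub>H2 L\<^esub>}"
    then have "\<Phi> X \<in> carrier (H2 L) \<times> carrier (Hom_Fr p L)" unfolding img[symmetric] by blast
    then have \<eta>: "snd (\<Phi> X) \<in> carrier (Hom_Fr p L)" by (rule mem_Times_iff[THEN iffD1, THEN conjunct2])
    \<comment> \<open>An element with first component 0 has the same value under \<Phi> as the class
      of its second component; injectivity of \<Phi> identifies the two.\<close>
    have "\<Phi> (Fr_incl p L (snd (\<Phi> X))) = (\<zero>\<^bsub>H2 L\<^esub>, snd (\<Phi> X))" using Fr \<eta> by blast
    also have "\<dots> = \<Phi> X" using X by (simp add: prod_eq_iff)
    finally have eq: "\<Phi> (Fr_incl p L (snd (\<Phi> X))) = \<Phi> X" .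
    have "Fr_incl p L (snd (\<Phi> X)) = X"
      by (rule inj_onD[OF bij_betw_imp_inj_on[OF bij] eq F.f_im[OF \<eta>]]) (use X in simp)
    then show "X \<in> Fr_incl p L ` carrier (Hom_Fr p L)" using \<eta> by (rule image_eqI[OF sym])
  qed
  have zero: "\<zero>\<^bsub>Hom_Fr p L\<^esub> \<in> carrier (Hom_Fr p L)" by simp
  have onto: "(\<lambda>X. fst (\<Phi> X)) ` carrier (H2s p L) = carrier (H2 L)"
  proof -
    have "(\<lambda>X. fst (\<Phi> X)) ` carrier (H2s p L) = fst ` (\<Phi> ` carrier (H2s p L))"
      by (simp only: image_image)
    also have "\<dots> = carrier (H2 L)" unfolding img using zero by auto
    finally show ?thesis .
  qed
  show ?thesis
    using Hom_Fr_Z2s linear_map_Fr_incl pr cls inj ker onto lin bij Fr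
    by (intro exI[of _ "\<lambda>X. fst (\<Phi> X)"] exI[of _ \<Phi>]) blast
qed

end

text \<open>Existence is witnessed by \<open>trivial_ext\<close> on pairs, while the formulas are
  derived for every corresponding extension over an arbitrary element type \<open>'e\<close>, so
  that they do not depend on the chosen model.\<close>

theorem theorem5p1:
  fixes p :: nat and \<gg> :: "('a::field, nat \<Rightarrow> 'a) restricted_lie"
  assumes "prime p" and "CHAR('a) = p" and "\<gg> = m00 p"
  shows
    "(\<exists>pr \<Phi>.
        (\<forall>\<omega>\<in>carrier (Hom_Fr p \<gg>). (\<zero>\<^bsub>C2 \<gg>\<^esub>, \<omega>) \<in> Z2s p \<gg>) \<and>
        linear_map class_ring (Hom_Fr p \<gg>) (H2s p \<gg>) (Fr_incl p \<gg>) \<and>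
        linear_map class_ring (H2s p \<gg>) (H2 \<gg>) pr \<and>
        (\<forall>(\<phi>, \<omega>)\<in>Z2s p \<gg>. pr (class2s p \<gg> (\<phi>, \<omega>)) = class2 \<gg> \<phi>) \<and>
        inj_on (Fr_incl p \<gg>) (carrier (Hom_Fr p \<gg>)) \<and>
        Fr_incl p \<gg> ` carrier (Hom_Fr p \<gg>) = {X \<in> carrier (H2s p \<gg>). pr X = \<zero>\<^bsub>H2 \<gg>\<^esub>} \<and>
        pr ` carrier (H2s p \<gg>) = carrier (H2 \<gg>) \<and>
        linear_map class_ring (H2s p \<gg>) (direct_sum (H2 \<gg>) (Hom_Fr p \<gg>)) \<Phi> \<and>
        bij_betw \<Phi> (carrier (H2s p \<gg>)) (carrier (direct_sum (H2 \<gg>) (Hom_Fr p \<gg>))) \<and>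
        (\<forall>\<omega>\<in>carrier (Hom_Fr p \<gg>). \<Phi> (Fr_incl p \<gg> \<omega>) = (\<zero>\<^bsub>H2 \<gg>\<^esub>, \<omega>)) \<and>
        (\<forall>X\<in>carrier (H2s p \<gg>). fst (\<Phi> X) = pr X)) \<and>
     (\<forall>k\<in>{1..p}. (\<zero>\<^bsub>C2 \<gg>\<^esub>, ebar p k) \<in> Z2s p \<gg>) \<and>
     (\<exists>W. W = LinearCombinations.module.span class_ring (H2s p \<gg>)
                {class2s p \<gg> (\<zero>\<^bsub>C2 \<gg>\<^esub>, ebar p k) | k. k \<in> {1..p}} \<and>
        subspace class_ring W (H2s p \<gg>) \<and>
        vectorspace.fin_dim class_ring ((H2s p \<gg>)\<lparr>carrier := W\<rparr>) \<and>
        vectorspace.dim class_ring ((H2s p \<gg>)\<lparr>carrier := W\<rparr>) = p) \<and>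
     (\<forall>k\<in>{1..p}.
        (\<exists>(E :: ('a, (nat \<Rightarrow> 'a) \<times> 'a) restricted_lie) \<pi> c. central_extension p \<gg> E \<pi> c \<and>
           corresponds \<gg> E \<pi> c (class2s p \<gg> (\<zero>\<^bsub>C2 \<gg>\<^esub>, ebar p k))) \<and>
        (\<forall>(E :: ('a, 'e) restricted_lie) \<pi> c. central_extension p \<gg> E \<pi> c \<and>
           corresponds \<gg> E \<pi> c (class2s p \<gg> (\<zero>\<^bsub>C2 \<gg>\<^esub>, ebar p k)) \<longrightarrow>
           (\<exists>\<theta>. identification \<gg> E \<pi> c \<theta> \<and>
              (\<forall>i\<in>{1..p}. \<forall>j\<in>{1..p}.
                 lie_br E (\<theta> (bvec p i, 0)) (\<theta> (bvec p j, 0)) =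
                   \<theta> (lie_br \<gg> (bvec p i) (bvec p j), 0) \<and>
                 lie_br E (\<theta> (bvec p i, 0)) c = \<zero>\<^bsub>E\<^esub> \<and>
                 pmap E (\<theta> (bvec p i, 0)) =
                   \<theta> (pmap \<gg> (bvec p i), 0) \<oplus>\<^bsub>E\<^esub> (if k = i then 1 else 0) \<odot>\<^bsub>E\<^esub> c \<and>
                 pmap E c = \<zero>\<^bsub>E\<^esub>))))"
proof -
  interpret null_restricted_lie_algebra p \<gg>
    unfolding assms(3) by (rule null_restricted_m00[OF assms(1,2)])
  have ebar: "ebar p k \<in> carrier (Hom_Fr p \<gg>)" if "k \<in> {1..p}" for k
    unfolding assms(3) by (rule ebar_Hom_Fr[OF assms(1,2) that])
  note split = H2s_m00_split[OF assms]
  then have inj: "inj_on (Fr_incl p \<gg>) (carrier (Hom_Fr p \<gg>))" by blast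
  have cocycles: "\<forall>k\<in>{1..p}. (\<zero>\<^bsub>C2 \<gg>\<^esub>, ebar p k) \<in> Z2s p \<gg>"
    using Hom_Fr_Z2s ebar by blast
  have existence: "\<exists>(E :: ('a, (nat \<Rightarrow> 'a) \<times> 'a) restricted_lie) \<pi> c. central_extension p \<gg> E \<pi> c \<and>
      corresponds \<gg> E \<pi> c (class2s p \<gg> (\<zero>\<^bsub>C2 \<gg>\<^esub>, ebar p k))" if "k \<in> {1..p}" for k
    using central_trivial_ext[OF ebar[OF that]] corresponds_trivial_ext[OF ebar[OF that]] by blast
  have description: "\<exists>\<theta>. identification \<gg> E \<pi> c \<theta> \<and>
      (\<forall>i\<in>{1..p}. \<forall>j\<in>{1..p}.
         lie_br E (\<theta> (bvec p i, 0)) (\<theta> (bvec p j, 0)) = \<theta> (lie_br \<gg> (bvec p i) (bvec p j), 0) \<and>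
         lie_br E (\<theta> (bvec p i, 0)) c = \<zero>\<^bsub>E\<^esub> \<and>
         pmap E (\<theta> (bvec p i, 0)) =
           \<theta> (pmap \<gg> (bvec p i), 0) \<oplus>\<^bsub>E\<^esub> (if k = i then 1 else 0) \<odot>\<^bsub>E\<^esub> c \<and>
         pmap E c = \<zero>\<^bsub>E\<^esub>)"
    if k: "k \<in> {1..p}" and ext: "central_extension p \<gg> E \<pi> c"
      and corr: "corresponds \<gg> E \<pi> c (class2s p \<gg> (\<zero>\<^bsub>C2 \<gg>\<^esub>, ebar p k))"
    for k and E :: "('a, 'e) restricted_lie" and \<pi> c
  proof -
    obtain \<theta> where \<theta>: "identification \<gg> E \<pi> c \<theta>"
      and br: "\<And>x y. x \<in> carrier \<gg> \<Longrightarrow> y \<in> carrier \<gg> \<Longrightarrow>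
        lie_br E (\<theta> (x, 0)) (\<theta> (y, 0)) = \<theta> (lie_br \<gg> x y, 0)"
      and pm: "\<And>x. x \<in> carrier \<gg> \<Longrightarrow>
        pmap E (\<theta> (x, 0)) = \<theta> (pmap \<gg> x, 0) \<oplus>\<^bsub>E\<^esub> ebar p k x \<odot>\<^bsub>E\<^esub> c"
      using corresponds_Hom_Fr[OF ext corr] by blast
    have e: "bvec p i \<in> carrier \<gg>" for i by (simp add: assms(3))
    have "\<theta> (bvec p i, 0) \<in> carrier E" for i
      using \<theta> e bij_betw_apply[of \<theta> "carrier \<gg> \<times> UNIV" "carrier E" "(bvec p i, 0)"]
      by (simp add: identification_def direct_sum_scalar_simps)
    then have "lie_br E (\<theta> (bvec p i, 0)) c = \<zero>\<^bsub>E\<^esub>" "pmap E c = \<zero>\<^bsub>E\<^esub>" for i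
      using ext by (auto simp: central_extension_def)
    moreover have "pmap E (\<theta> (bvec p i, 0)) =
        \<theta> (pmap \<gg> (bvec p i), 0) \<oplus>\<^bsub>E\<^esub> (if k = i then 1 else 0) \<odot>\<^bsub>E\<^esub> c" if "i \<in> {1..p}" for i
      using pm[OF e, of i] unfolding ebar_bvec[OF that k] .
    ultimately show ?thesis using \<theta> br[OF e e] by blast
  qed
  show ?thesis
    by (intro conjI split cocycles exI[of _ "LinearCombinations.module.span class_ring (H2s p \<gg>)
          {class2s p \<gg> (\<zero>\<^bsub>C2 \<gg>\<^esub>, ebar p k) | k. k \<in> {1..p}}"] refl
        span_ebar_classes[OF assms inj] ballI existence allI impI)
      (assumption, rule description, assumption, erule conjunct1, erule conjunct2)
qed

end
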